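(* Let $\Gamma$ be a tropical curve. The automorphism group $\operatorname{Aut}(\Gamma)$ of $\Gamma$ is isomorphic to the $\boldsymbol{T}$-algebra automorphism group of $\operatorname{Rat}(\Gamma)$.
   Context: **Semirings.** A semiring is a commutative semiring with absorbing additive neutral element, multiplicative identity, and these two distinct. A semiring homomorphism preserves addition, multiplication, the additive neutral element and the multiplicative identity. The tropical semifield is $\boldsymbol{T} := (\mathbb{R} \cup \{-\infty\}, \oplus = \max, \odot = +)$ (additive neutral element $-\infty$, multiplicative identity the real number $0$). **Tropical curves.** A graph is an unweighted, undirected, finite, connected nonempty multigraph, possibly with loops. A leaf end is a vertex of valence one (loops count twice); a leaf edge is an edge incident to a leaf end. An edge-weighted graph $(G,l)$ is a graph $G$ with a function $l : E(G) \to \mathbb{R}_{>0} \cup \{\infty\}$ that takes the value $\infty$ only on leaf edges. A tropical curve $\Gamma$ is the underlying topological space of some $(G,l)$ together with an identification of each edge $e$ with $[0,l(e)]$, where $[0,\infty]$ is the one-point compactification of $[0,\infty)$; if $l(e)=\infty$, the leaf end of $e$ is identified with $\infty$ (if $E(G)=\{e\}$ and $l(e)=\infty$, either leaf end may be chosen). $(G,l)$ is a model for $\Gamma$; it is loopless if $G$ is. Points identified with $\infty$ are points at infinity and form the set $\Gamma_\infty$; other points are finite points. $\operatorname{dist}$ is the path-length distance; the distance between a point at infinity and any other point is $\infty$. **Rational functions.** A rational function on $\Gamma$ is either the constant function $-\infty$ or a continuous map $f:\Gamma\to\mathbb{R}\cup\{\pm\infty\}$ that is piecewise affine with integer slopes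 and finitely many pieces and takes values $\pm\infty$ only at points at infinity. $\operatorname{Rat}(\Gamma)$ is the set of these; with $(f\oplus g)(x)=\max\{f(x),g(x)\}$ and $(f\odot g)(x)=f(x)+g(x)$ at finite points, extended continuously to points at infinity (and $f\oplus(-\infty)=f$, $f\odot(-\infty)=-\infty$), it is a semifield, and a $\boldsymbol{T}$-algebra via the inclusion of constants $\boldsymbol{T}\hookrightarrow\operatorname{Rat}(\Gamma)$. A $\boldsymbol{T}$-algebra automorphism of $\operatorname{Rat}(\Gamma)$ is a bijective semiring homomorphism $\operatorname{Rat}(\Gamma)\to\operatorname{Rat}(\Gamma)$ fixing every constant $t\in\boldsymbol{T}$. **Automorphisms of tropical curves.** A continuous map $\varphi:\Gamma\to\Gamma'$ between tropical curves is a finite harmonic morphism if there are loopless models $(G,l)$, $(G',l')$ for $\Gamma,\Gamma'$ such that (1) $\varphi(V(G))\subset V(G')$; (2) $\varphi(E(G))\subset E(G')$; (3) for each edge $e$ of $G$ there is a positive integer $\deg_e(\varphi)$ with $\operatorname{dist}(\varphi(x),\varphi(y))=\deg_e(\varphi)\cdot\operatorname{dist}(x,y)$ for all $x,y\in e$; (4) for every vertex $v$ of $G$, the sum $\deg_v(\varphi)=\sum_{e\in E(G):\,e\mapsto e',\,v\in e}\deg_e(\varphi)$ is independent of the edge $e'\in E(G')$ incident to $\varphi(v)$. Its degree is $\sum_{v\mapsto v'}\deg_v(\varphi)$, which is independent of the vertex $v'$ of $G'$. If both curves are singletons, $\varphi$ is regarded as a finite harmonic morphism that can have any positive integer as degree.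 $\operatorname{Aut}(\Gamma)$ is the group (under composition) of finite harmonic morphisms $\Gamma\to\Gamma$ of degree one; equivalently, the continuous maps $\Gamma\to\Gamma$ whose restrictions to $\Gamma\setminus\Gamma_\infty$ are isometries $\Gamma\setminus\Gamma_\infty\to\Gamma\setminus\Gamma_\infty$. *)

theory Defs
  imports "HOL-Analysis.Analysis" "HOL-Algebra.Ring"
begin

text \<open>
  A tropical curve is given by an edge-weighted graph drawn on its set of points: the vertices
  are points, and \<open>chart \<Gamma> e\<close>, restricted to \<open>{0..len \<Gamma> e}\<close>, is the identification of the edge
  \<open>e\<close> with the interval \<open>[0, len \<Gamma> e]\<close>.  The subspace \<open>{0..\<infinity>}\<close> of \<^typ>\<open>ereal\<close> is the one-point
  compactification of the half-line.
\<close>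

record ('p, 'e) curve =
  verts :: "'p set"
  edges :: "'e set"
  len :: "'e \<Rightarrow> ereal"
  chart :: "'e \<Rightarrow> ereal \<Rightarrow> 'p"

definition src :: "('p, 'e) curve \<Rightarrow> 'e \<Rightarrow> 'p" where
  "src \<Gamma> e = chart \<Gamma> e 0"

definition tgt :: "('p, 'e) curve \<Rightarrow> 'e \<Rightarrow> 'p" where
  "tgt \<Gamma> e = chart \<Gamma> e (len \<Gamma> e)"

definition edge_set :: "('p, 'e) curve \<Rightarrow> 'e \<Rightarrow> 'p set" where
  "edge_set \<Gamma> e = chart \<Gamma> e ` {0..len \<Gamma> e}"

definition edge_interior :: "('p, 'e) curve \<Rightarrow> 'e \<Rightarrow> 'p set" where
  "edge_interior \<Gamma> e = chart \<Gamma> e ` {0<..<len \<Gamma> e}"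

definition points :: "('p, 'e) curve \<Rightarrow> 'p set" where
  "points \<Gamma> = verts \<Gamma> \<union> (\<Union>e\<in>edges \<Gamma>. edge_set \<Gamma> e)"

text \<open>A loop contributes to both summands.\<close>

definition valence :: "('p, 'e) curve \<Rightarrow> 'p \<Rightarrow> nat" where
  "valence \<Gamma> v = card {e \<in> edges \<Gamma>. src \<Gamma> e = v} + card {e \<in> edges \<Gamma>. tgt \<Gamma> e = v}"

definition adjacent :: "('p, 'e) curve \<Rightarrow> ('p \<times> 'p) set" where
  "adjacent \<Gamma> = (\<Union>e\<in>edges \<Gamma>. {(src \<Gamma> e, tgt \<Gamma> e), (tgt \<Gamma> e, src \<Gamma> e)})"

text \<open>
  The last condition says both that only leaf edges have infinite length and that the point
  identified with \<open>\<infinity>\<close> is a leaf end.  If a single edge joins two leaf ends, either of them can be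
  its \<open>tgt\<close>.
\<close>

definition tropical_curve :: "('p, 'e) curve \<Rightarrow> bool" where
  "tropical_curve \<Gamma> \<longleftrightarrow>
     finite (verts \<Gamma>) \<and> verts \<Gamma> \<noteq> {} \<and> finite (edges \<Gamma>) \<and>
     (\<forall>u\<in>verts \<Gamma>. \<forall>v\<in>verts \<Gamma>. (u, v) \<in> (adjacent \<Gamma>)\<^sup>*) \<and>
     (\<forall>e\<in>edges \<Gamma>.
        0 < len \<Gamma> e \<and> src \<Gamma> e \<in> verts \<Gamma> \<and> tgt \<Gamma> e \<in> verts \<Gamma> \<and>
        inj_on (chart \<Gamma> e) {0<..<len \<Gamma> e} \<and> edge_interior \<Gamma> e \<inter> verts \<Gamma> = {}) \<and>
     (\<forall>e\<in>edges \<Gamma>. \<forall>e'\<in>edges \<Gamma>. e \<noteq> e' \<longrightarrow> edge_interior \<Gamma> e \<inter> edge_interior \<Gamma> e' = {}) \<and>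
     (\<forall>e\<in>edges \<Gamma>. len \<Gamma> e = \<infinity> \<longrightarrow> valence \<Gamma> (tgt \<Gamma> e) = 1)"

definition loopless :: "('p, 'e) curve \<Rightarrow> bool" where
  "loopless \<Gamma> \<longleftrightarrow> (\<forall>e\<in>edges \<Gamma>. src \<Gamma> e \<noteq> tgt \<Gamma> e)"

definition inf_points :: "('p, 'e) curve \<Rightarrow> 'p set" where
  "inf_points \<Gamma> = {tgt \<Gamma> e | e. e \<in> edges \<Gamma> \<and> len \<Gamma> e = \<infinity>}"

definition fin_points :: "('p, 'e) curve \<Rightarrow> 'p set" where
  "fin_points \<Gamma> = points \<Gamma> - inf_points \<Gamma>"

text \<open>The quotient topology of the disjoint union of the closed edges (and the vertices).\<close>

definition curve_top :: "('p, 'e) curve \<Rightarrow> 'p topology" where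
  "curve_top \<Gamma> = topology (\<lambda>U. U \<subseteq> points \<Gamma> \<and>
     (\<forall>e\<in>edges \<Gamma>. openin (top_of_set {0..len \<Gamma> e}) {t \<in> {0..len \<Gamma> e}. chart \<Gamma> e t \<in> U}))"

lemma openin_curve_top:
  "openin (curve_top \<Gamma>) U \<longleftrightarrow> U \<subseteq> points \<Gamma> \<and>
     (\<forall>e\<in>edges \<Gamma>. openin (top_of_set {0..len \<Gamma> e}) {t \<in> {0..len \<Gamma> e}. chart \<Gamma> e t \<in> U})"
proof -
  have "istopology (\<lambda>U. U \<subseteq> points \<Gamma> \<and>
     (\<forall>e\<in>edges \<Gamma>. openin (top_of_set {0..len \<Gamma> e}) {t \<in> {0..len \<Gamma> e}. chart \<Gamma> e t \<in> U}))"
    (is "istopology ?P")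
  proof -
    have "?P (S \<inter> T)" if "?P S" "?P T" for S T
    proof -
      have "{t \<in> {0..len \<Gamma> e}. chart \<Gamma> e t \<in> S \<inter> T} =
        {t \<in> {0..len \<Gamma> e}. chart \<Gamma> e t \<in> S} \<inter> {t \<in> {0..len \<Gamma> e}. chart \<Gamma> e t \<in> T}" for e
        by auto
      then show ?thesis
        using that by (metis (no_types, lifting) inf.coboundedI1 openin_Int)
    qed
    moreover have "?P (\<Union>K)" if K: "\<forall>S\<in>K. ?P S" for K
    proof -
      have *: "{t \<in> {0..len \<Gamma> e}. chart \<Gamma> e t \<in> \<Union>K} =
        \<Union>((\<lambda>S. {t \<in> {0..len \<Gamma> e}. chart \<Gamma> e t \<in> S}) ` K)" for e
        by auto
      have "openin (top_of_set {0..len \<Gamma> e}) {t \<in> {0..len \<Gamma> e}. chart \<Gamma> e t \<in> \<Union>K}"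
        if "e \<in> edges \<Gamma>" for e
        unfolding * using K that by (intro openin_Union) blast
      then show ?thesis
        using K by blast
    qed
    ultimately show ?thesis
      unfolding istopology_def by blast
  qed
  then show ?thesis
    by (simp add: curve_top_def topology_inverse')
qed

lemma topspace_curve_top: "topspace (curve_top \<Gamma>) = points \<Gamma>"
proof -
  have "{t \<in> {0..len \<Gamma> e}. chart \<Gamma> e t \<in> points \<Gamma>} = {0..len \<Gamma> e}" if "e \<in> edges \<Gamma>" for e
    using that by (auto simp: points_def edge_set_def)
  then have "openin (curve_top \<Gamma>) (points \<Gamma>)"
    by (simp add: openin_curve_top)
  then show ?thesis
    by (meson openin_curve_top openin_subset openin_topspace subset_antisym)
qed

text \<open>
  \<open>walk \<Gamma> x d y\<close>: some path from \<open>x\<close> to \<open>y\<close> made of finitely many segments of edges has length \<open>d\<close>.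
  A segment with exactly one endpoint at infinity has length \<open>\<infinity>\<close>.
\<close>

inductive walk :: "('p, 'e) curve \<Rightarrow> 'p \<Rightarrow> ereal \<Rightarrow> 'p \<Rightarrow> bool" for \<Gamma> where
  refl: "x \<in> points \<Gamma> \<Longrightarrow> walk \<Gamma> x 0 x"
| step: "walk \<Gamma> x d (chart \<Gamma> e s) \<Longrightarrow> e \<in> edges \<Gamma> \<Longrightarrow> s \<in> {0..len \<Gamma> e} \<Longrightarrow> t \<in> {0..len \<Gamma> e}
     \<Longrightarrow> walk \<Gamma> x (d + \<bar>s - t\<bar>) (chart \<Gamma> e t)"

definition cdist :: "('p, 'e) curve \<Rightarrow> 'p \<Rightarrow> 'p \<Rightarrow> ereal" where
  "cdist \<Gamma> x y = Inf {d. walk \<Gamma> x d y}"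

text \<open>
  A model is an edge-weighted graph drawn on the same points and inducing the same topology and the
  same distance.  As graphs are finite, natural numbers suffice as names of the edges.
\<close>

definition model_for :: "('p, 'e) curve \<Rightarrow> ('p, nat) curve \<Rightarrow> bool" where
  "model_for \<Gamma> G \<longleftrightarrow> tropical_curve G \<and> points G = points \<Gamma> \<and> curve_top G = curve_top \<Gamma> \<and>
     (\<forall>x\<in>points \<Gamma>. \<forall>y\<in>points \<Gamma>. cdist G x y = cdist \<Gamma> x y)"


subsection \<open>Finite harmonic morphisms\<close>

text \<open>The functions \<open>k\<close> and \<open>m\<close> are the degrees of \<open>\<phi>\<close> at the edges and at the vertices of \<open>G\<close>.\<close>

definition harmonic_on_models ::
  "('p, nat) curve \<Rightarrow> ('q, nat) curve \<Rightarrow> ('p \<Rightarrow> 'q) \<Rightarrow> (nat \<Rightarrow> nat) \<Rightarrow> ('p \<Rightarrow> nat) \<Rightarrow> bool" where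
  "harmonic_on_models G G' \<phi> k m \<longleftrightarrow>
     \<phi> ` verts G \<subseteq> verts G' \<and>
     (\<forall>e\<in>edges G. \<exists>e'\<in>edges G'. \<phi> ` edge_set G e = edge_set G' e') \<and>
     (\<forall>e\<in>edges G. 0 < k e \<and>
        (\<forall>x\<in>edge_set G e. \<forall>y\<in>edge_set G e.
           cdist G' (\<phi> x) (\<phi> y) = ereal (real (k e)) * cdist G x y)) \<and>
     (\<forall>v\<in>verts G. \<forall>e'\<in>edges G'. \<phi> v \<in> {src G' e', tgt G' e'} \<longrightarrow>
        (\<Sum>e | e \<in> edges G \<and> \<phi> ` edge_set G e = edge_set G' e' \<and> v \<in> edge_set G e. k e) = m v)"

text \<open>\<open>\<phi>\<close> is a finite harmonic morphism of degree \<open>n\<close>.\<close>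

definition finite_harmonic ::
  "('p, 'e) curve \<Rightarrow> ('q, 'f) curve \<Rightarrow> ('p \<Rightarrow> 'q) \<Rightarrow> nat \<Rightarrow> bool" where
  "finite_harmonic \<Gamma> \<Gamma>' \<phi> n \<longleftrightarrow>
     continuous_map (curve_top \<Gamma>) (curve_top \<Gamma>') \<phi> \<and>
     (if is_singleton (points \<Gamma>) \<and> is_singleton (points \<Gamma>') then 0 < n
      else \<exists>G G' k m.
        model_for \<Gamma> G \<and> loopless G \<and> model_for \<Gamma>' G' \<and> loopless G' \<and>
        harmonic_on_models G G' \<phi> k m \<and>
        (\<forall>v'\<in>verts G'. (\<Sum>v | v \<in> verts G \<and> \<phi> v = v'. m v) = n))"

definition curve_aut :: "('p, 'e) curve \<Rightarrow> ('p \<Rightarrow> 'p) monoid" where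
  "curve_aut \<Gamma> =
     \<lparr>carrier = {\<phi> \<in> extensional (points \<Gamma>). finite_harmonic \<Gamma> \<Gamma> \<phi> 1},
      monoid.mult = compose (points \<Gamma>),
      one = (\<lambda>x\<in>points \<Gamma>. x)\<rparr>"


subsection \<open>Rational functions\<close>

definition tropical_semifield :: "ereal ring" where
  "tropical_semifield =
     \<lparr>carrier = {t. t \<noteq> \<infinity>}, monoid.mult = (+), one = 0, zero = - \<infinity>, add = max\<rparr>"

definition const_fun :: "('p, 'e) curve \<Rightarrow> ereal \<Rightarrow> 'p \<Rightarrow> ereal" where
  "const_fun \<Gamma> t = (\<lambda>x\<in>points \<Gamma>. t)"

text \<open>The value at \<open>\<infinity>\<close> is not mentioned here: it is determined by continuity.\<close>

definition piecewise_affine_on_edge :: "('p, 'e) curve \<Rightarrow> 'e \<Rightarrow> ('p \<Rightarrow> ereal) \<Rightarrow> bool" where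
  "piecewise_affine_on_edge \<Gamma> e f \<longleftrightarrow>
     (\<exists>(n::nat) (s :: nat \<Rightarrow> ereal). s 0 = 0 \<and> s n = len \<Gamma> e \<and>
        (\<forall>i<n. s i < s (Suc i) \<and>
           (\<exists>(a::real) (b::int). \<forall>t::real. s i \<le> ereal t \<and> ereal t \<le> s (Suc i) \<longrightarrow>
              f (chart \<Gamma> e (ereal t)) = ereal (a + of_int b * t))))"

definition rational_functions :: "('p, 'e) curve \<Rightarrow> ('p \<Rightarrow> ereal) set" where
  "rational_functions \<Gamma> = {const_fun \<Gamma> (- \<infinity>)} \<union>
     {f \<in> extensional (points \<Gamma>).
        continuous_map (curve_top \<Gamma>) euclidean f \<and>
        (\<forall>e\<in>edges \<Gamma>. piecewise_affine_on_edge \<Gamma> e f) \<and>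
        (\<forall>x\<in>fin_points \<Gamma>. \<bar>f x\<bar> \<noteq> \<infinity>)}"

text \<open>
  The continuous extension to \<open>\<Gamma>\<close> of a function given on the finite points; it is unique because
  these are dense.  For products the pointwise sum in \<^typ>\<open>ereal\<close> would be wrong at points at
  infinity, where it may be of the form \<open>\<infinity> + - \<infinity>\<close>.  At finite points no value is \<open>\<infinity>\<close>, so there
  the sum with the constant \<open>- \<infinity>\<close> is \<open>- \<infinity>\<close>, as it should be.
\<close>

definition cont_ext :: "('p, 'e) curve \<Rightarrow> ('p \<Rightarrow> ereal) \<Rightarrow> 'p \<Rightarrow> ereal" where
  "cont_ext \<Gamma> u = (THE h. h \<in> extensional (points \<Gamma>) \<and>
     continuous_map (curve_top \<Gamma>) euclidean h \<and> (\<forall>x\<in>fin_points \<Gamma>. h x = u x))"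

definition Rat :: "('p, 'e) curve \<Rightarrow> ('p \<Rightarrow> ereal) ring" where
  "Rat \<Gamma> =
     \<lparr>carrier = rational_functions \<Gamma>,
      monoid.mult = (\<lambda>f g. cont_ext \<Gamma> (\<lambda>x. f x + g x)),
      one = const_fun \<Gamma> 0,
      zero = const_fun \<Gamma> (- \<infinity>),
      add = (\<lambda>f g. cont_ext \<Gamma> (\<lambda>x. max (f x) (g x)))\<rparr>"

text \<open>Unlike in rings, preservation of zero has to be demanded.\<close>

definition semiring_hom :: "('a, 'm) ring_scheme \<Rightarrow> ('b, 'n) ring_scheme \<Rightarrow> ('a \<Rightarrow> 'b) set" where
  "semiring_hom R S = {h \<in> ring_hom R S. h \<zero>\<^bsub>R\<^esub> = \<zero>\<^bsub>S\<^esub>}"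

text \<open>The automorphisms of the \<open>T\<close>-algebra \<open>R\<close> with structure map \<open>\<iota>\<close> from \<open>T\<close> to \<open>R\<close>.\<close>

definition alg_aut ::
  "('t, 'k) ring_scheme \<Rightarrow> ('a, 'm) ring_scheme \<Rightarrow> ('t \<Rightarrow> 'a) \<Rightarrow> ('a \<Rightarrow> 'a) monoid" where
  "alg_aut T R \<iota> =
     \<lparr>carrier = {h \<in> semiring_hom R R. h \<in> extensional (carrier R) \<and>
        bij_betw h (carrier R) (carrier R) \<and> (\<forall>t\<in>carrier T. h (\<iota> t) = \<iota> t)},
      monoid.mult = compose (carrier R),
      one = (\<lambda>f\<in>carrier R. f)\<rparr>"

definition rat_aut :: "('p, 'e) curve \<Rightarrow> (('p \<Rightarrow> ereal) \<Rightarrow> ('p \<Rightarrow> ereal)) monoid" where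
  "rat_aut \<Gamma> = alg_aut tropical_semifield (Rat \<Gamma>) (const_fun \<Gamma>)"

end

theory Submission
  imports Defs
begin

text \<open>
  The isomorphism sends \<open>\<phi>\<close> to the map \<open>f \<mapsto> f \<circ> \<phi>\<inverse>\<close>.  Everything goes through a third group, that of
  the homeomorphisms of \<open>\<Gamma>\<close> onto itself that preserve the distance (here called isometries).

  The finite harmonic morphisms of degree one are exactly the isometries.  The local degrees of a
  finite harmonic morphism are positive, so if they add up to one over a vertex, there is only one
  vertex above it, and only one edge above each edge.  Hence the morphism is bijective, it preserves
  the distances on each edge, and summing along walks it preserves all distances
  (\<open>finite_harmonic_imp_isometry\<close>).  Conversely, cutting every edge in two gives a loopless model, and
  an isometry carries this model to another model and is harmonic with respect to the two
  (\<open>isometry_imp_finite_harmonic\<close>).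

  Composition with an isometry preserves rational functions (\<open>integral_pl_isometry\<close>), because being
  rational can be said in terms of the distance: near a finite point \<open>a\<close>, a rational function has the
  form \<open>f(a) + k dist(a, _)\<close> where the integer \<open>k\<close> depends on the direction but takes only finitely many
  values.  After composition with an isometry one sees along an edge a continuous function with the
  same property, and a continuous choice among finitely many slopes is constant.

  Every automorphism \<open>\<psi>\<close> is the composition with some isometry \<open>\<theta>\<close> (\<open>aut_induced_by_isometry\<close>).  For a
  point \<open>x\<close> there is a point \<open>y\<close> with \<open>\<psi>(f)(x) = f(y)\<close> for all \<open>f\<close>: otherwise each \<open>y\<close> has a rational
  function that is positive at \<open>y\<close> while its image under \<open>\<psi>\<close> is negative at \<open>x\<close>; by compactness the
  maximum of finitely many of these is positive everywhere, hence its image is nonnegative, but at \<open>x\<close>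
  this image is negative (\<open>aut_eval\<close>).  This needs only the order, the constants and negation, and it
  treats points at infinity like all others.  Setting \<open>\<theta> x = y\<close>, continuity of \<open>\<theta>\<close> follows because
  rational functions separate points from closed sets (\<open>rational_urysohn\<close>).  The distance is recovered
  from the integrality of slopes: among the rational functions that vanish at \<open>a\<close> and are positive
  elsewhere, the truncated distance from \<open>a\<close> is the smallest one near \<open>a\<close>, since no positive integer is
  smaller than one.  So neither \<open>\<theta>\<close> nor its inverse increases small distances
  (\<open>locally_nonexpanding\<close>), and therefore they increase no distance at all.

  Two isometries that act in the same way on rational functions are equal because rational functions
  separate points.
\<close>

section \<open>Piecewise affine functions on an interval\<close>

text \<open>
  The filters of one-sided approach to the points of \<open>{0..L}\<close>, from inside the interval.  A function
  with finitely many affine pieces is affine along each of them, and conversely; unlike the pieces,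
  these local conditions combine well under sums and maxima.
\<close>

definition germ_filters :: "ereal \<Rightarrow> real filter set" where
  "germ_filters L = {at_right x | x. 0 \<le> x \<and> ereal x < L} \<union>
     {at_left x | x. 0 < x \<and> ereal x \<le> L} \<union> (if L = \<infinity> then {at_top} else {})"

definition int_affine :: "real filter \<Rightarrow> (real \<Rightarrow> ereal) \<Rightarrow> bool" where
  "int_affine \<Phi> g \<longleftrightarrow> (\<exists>(a::real) (b::int). \<forall>\<^sub>F t in \<Phi>. g t = ereal (a + of_int b * t))"

text \<open>
  An affine function changes its sign at most once, so along a one-sided approach, or towards infinity,
  its sign is eventually constant.  This is why maxima of functions with affine germs have affine germs.
\<close>

lemma affine_sign:
  fixes a b :: real
  assumes "\<Phi> \<in> germ_filters L"
  shows "(\<forall>\<^sub>F t in \<Phi>. a + b * t \<ge> 0) \<or> (\<forall>\<^sub>F t in \<Phi>. a + b * t \<le> 0)"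
proof -
  have *: ?thesis if x: "\<Phi> = at_right x \<or> \<Phi> = at_left x" for x
  proof (cases "a + b * x = 0")
    case True
    then have eq: "a + b * t = b * (t - x)" for t
      by (simp add: algebra_simps eq_neg_iff_add_eq_0)
    have "(\<forall>\<^sub>F t in \<Phi>. t > x) \<or> (\<forall>\<^sub>F t in \<Phi>. t < x)"
      using x by (auto simp: eventually_at_filter)
    then show ?thesis
    proof
      assume ev: "\<forall>\<^sub>F t in \<Phi>. t > x"
      have "\<forall>\<^sub>F t in \<Phi>. 0 \<le> b * (t - x)" if "b \<ge> 0"
        using ev by eventually_elim (use that in simp)
      moreover have "\<forall>\<^sub>F t in \<Phi>. b * (t - x) \<le> 0" if "\<not> b \<ge> 0"
        using ev by eventually_elim (use that in \<open>simp add: mult_le_0_iff\<close>)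
      ultimately show ?thesis unfolding eq by blast
    next
      assume ev: "\<forall>\<^sub>F t in \<Phi>. t < x"
      have "\<forall>\<^sub>F t in \<Phi>. b * (t - x) \<le> 0" if "b \<ge> 0"
        using ev by eventually_elim (use that in \<open>simp add: mult_le_0_iff\<close>)
      moreover have "\<forall>\<^sub>F t in \<Phi>. 0 \<le> b * (t - x)" if "\<not> b \<ge> 0"
        using ev by eventually_elim (use that in \<open>simp add: zero_le_mult_iff\<close>)
      ultimately show ?thesis unfolding eq by blast
    qed
  next
    case False
    have "((\<lambda>t. a + b * t) \<longlongrightarrow> a + b * x) \<Phi>"
      using x by (elim disjE) (auto intro!: tendsto_eq_intros)
    then have "(a + b * x > 0 \<longrightarrow> (\<forall>\<^sub>F t in \<Phi>. a + b * t > 0)) \<and>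
        (a + b * x < 0 \<longrightarrow> (\<forall>\<^sub>F t in \<Phi>. a + b * t < 0))"
      by (auto dest: order_tendstoD)
    then show ?thesis
      using False by (smt (verit, best) eventually_mono)
  qed
  moreover have ?thesis if "\<Phi> = at_top"
  proof -
    consider "b > 0" | "b = 0" | "b < 0" by linarith
    then show ?thesis
    proof cases
      case 1
      have "\<forall>\<^sub>F t in at_top. t \<ge> - a / b" by (rule eventually_ge_at_top)
      then have "\<forall>\<^sub>F t in at_top. a + b * t \<ge> 0"
        using 1 by (elim eventually_mono) (simp add: field_simps)
      then show ?thesis using that by simp
    next
      case 2
      then show ?thesis by (cases "a \<ge> 0") (auto intro: always_eventually)
    next
      case 3
      have "\<forall>\<^sub>F t in at_top. t \<ge> - a / b" by (rule eventually_ge_at_top)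
      then have "\<forall>\<^sub>F t in at_top. a + b * t \<le> 0"
        using 3 by (elim eventually_mono) (simp add: field_simps)
      then show ?thesis using that by simp
    qed
  qed
  ultimately show ?thesis
    using assms by (auto simp: germ_filters_def split: if_splits)
qed

lemma int_affine_const: "int_affine \<Phi> (\<lambda>t. ereal c)"
  unfolding int_affine_def by (rule exI[of _ c], rule exI[of _ 0]) simp

lemma int_affine_cong:
  "\<forall>\<^sub>F t in \<Phi>. g t = h t \<Longrightarrow> int_affine \<Phi> g \<longleftrightarrow> int_affine \<Phi> h"
  unfolding int_affine_def by (intro iff_exI eventually_subst) (auto elim: eventually_mono)

lemma int_affine_uminus:
  assumes "int_affine \<Phi> g" shows "int_affine \<Phi> (\<lambda>t. - g t)"
proof -
  obtain a b where "\<forall>\<^sub>F t in \<Phi>. g t = ereal (a + of_int b * t)"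
    using assms by (auto simp: int_affine_def)
  then have "\<forall>\<^sub>F t in \<Phi>. - g t = ereal (- a + of_int (- b) * t)"
    by eventually_elim simp
  then show ?thesis unfolding int_affine_def by blast
qed

lemma int_affine_add:
  assumes "int_affine \<Phi> g" "int_affine \<Phi> h" shows "int_affine \<Phi> (\<lambda>t. g t + h t)"
proof -
  obtain a b a' b' where "\<forall>\<^sub>F t in \<Phi>. g t = ereal (a + of_int b * t)"
      "\<forall>\<^sub>F t in \<Phi>. h t = ereal (a' + of_int b' * t)"
    using assms by (auto simp: int_affine_def)
  then have "\<forall>\<^sub>F t in \<Phi>. g t + h t = ereal ((a + a') + of_int (b + b') * t)"
    by eventually_elim (simp add: algebra_simps)
  then show ?thesis unfolding int_affine_def by blast
qed

lemma int_affine_max: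
  assumes "\<Phi> \<in> germ_filters L" "int_affine \<Phi> g" "int_affine \<Phi> h"
  shows "int_affine \<Phi> (\<lambda>t. max (g t) (h t))"
proof -
  obtain a b a' b' where g: "\<forall>\<^sub>F t in \<Phi>. g t = ereal (a + of_int b * t)"
     and h: "\<forall>\<^sub>F t in \<Phi>. h t = ereal (a' + of_int b' * t)"
    using assms by (auto simp: int_affine_def)
  from affine_sign[OF assms(1), of "a - a'" "of_int b - of_int b'"] show ?thesis
  proof
    assume "\<forall>\<^sub>F t in \<Phi>. 0 \<le> a - a' + (of_int b - of_int b') * t"
    with g h have "\<forall>\<^sub>F t in \<Phi>. max (g t) (h t) = g t"
      by eventually_elim (simp add: algebra_simps max_def)
    then show ?thesis using assms(2) by (simp add: int_affine_cong)
  next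
    assume "\<forall>\<^sub>F t in \<Phi>. a - a' + (of_int b - of_int b') * t \<le> 0"
    with g h have "\<forall>\<^sub>F t in \<Phi>. max (g t) (h t) = h t"
      by eventually_elim (simp add: algebra_simps max_def)
    then show ?thesis using assms(3) by (simp add: int_affine_cong)
  qed
qed

lemma int_affine_min:
  assumes "\<Phi> \<in> germ_filters L" "int_affine \<Phi> g" "int_affine \<Phi> h"
  shows "int_affine \<Phi> (\<lambda>t. min (g t) (h t))"
proof -
  have "min x y = - max (- x) (- y)" for x y :: ereal
    by (auto simp: min_def max_def)
  then show ?thesis
    using assms by (simp add: int_affine_uminus int_affine_max)
qed

text \<open>
  The pieces allowed in a rational function, on an arbitrary interval so that they can be glued.  For
  \<open>x = y\<close> no piece is needed.
\<close>

definition pieces :: "ereal \<Rightarrow> ereal \<Rightarrow> (ereal \<Rightarrow> ereal) \<Rightarrow> bool" where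
  "pieces x y g \<longleftrightarrow> (\<exists>(n::nat) (s :: nat \<Rightarrow> ereal). s 0 = x \<and> s n = y \<and>
        (\<forall>i<n. s i < s (Suc i) \<and>
           (\<exists>(a::real) (b::int). \<forall>t::real. s i \<le> ereal t \<and> ereal t \<le> s (Suc i) \<longrightarrow>
              g (ereal t) = ereal (a + of_int b * t))))"

lemma pieces_refl: "pieces x x g"
  unfolding pieces_def by (rule exI[of _ 0]) auto

lemma pieces_single:
  assumes "x \<le> y" "\<And>t::real. x \<le> ereal t \<Longrightarrow> ereal t \<le> y \<Longrightarrow> g (ereal t) = ereal (a + of_int b * t)"
  shows "pieces x y g"
proof (cases "x = y")
  case False
  then show ?thesis
    unfolding pieces_def using assms
    by (intro exI[of _ 1] exI[of _ "\<lambda>i. if i = 0 then x else y"]) (auto intro!: exI[of _ a] exI[of _ b])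
qed (simp add: pieces_refl)

lemma pieces_trans:
  assumes "pieces x y g" "pieces y z g"
  shows "pieces x z g"
proof -
  let ?ok = "\<lambda>u v. u < v \<and>
           (\<exists>(a::real) (b::int). \<forall>t::real. u \<le> ereal t \<and> ereal t \<le> v \<longrightarrow>
              g (ereal t) = ereal (a + of_int b * t))"
  obtain n s where s: "s 0 = x" "s n = y" "\<And>i. i < n \<Longrightarrow> ?ok (s i) (s (Suc i))"
    using assms(1) unfolding pieces_def by blast
  obtain m r where r: "r 0 = y" "r m = z" "\<And>i. i < m \<Longrightarrow> ?ok (r i) (r (Suc i))"
    using assms(2) unfolding pieces_def by blast
  define q where "q i = (if i \<le> n then s i else r (i - n))" for i
  have "?ok (q i) (q (Suc i))" if "i < n + m" for i
  proof (cases "i < n")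
    case True
    then show ?thesis using s(3)[of i] by (simp add: q_def)
  next
    case False
    then have "q i = r (i - n)" "q (Suc i) = r (Suc (i - n))"
      using s(2) r(1) by (auto simp: q_def Suc_diff_le)
    then show ?thesis using r(3)[of "i - n"] that False by auto
  qed
  moreover have "q 0 = x" "q (n + m) = z"
    using s r by (auto simp: q_def)
  ultimately show ?thesis
    unfolding pieces_def by blast
qed

text \<open>
  A point that is a breakpoint belongs to two pieces; the germ to its right is governed by the piece
  that begins there, the germ to its left by the piece that ends there.
\<close>

lemma step_containing_right:
  fixes s :: "nat \<Rightarrow> ereal"
  assumes "s 0 \<le> x" "x < s n"
  obtains i where "i < n" "s i \<le> x" "x < s (Suc i)"
proof -
  have "\<exists>i<n. s i \<le> x \<and> x < s (Suc i)"
    using assms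
  proof (induction n)
    case (Suc n)
    then show ?case by (cases "x < s n") (auto simp: not_less less_Suc_eq)
  qed auto
  then show ?thesis using that by blast
qed

lemma step_containing_left:
  fixes s :: "nat \<Rightarrow> ereal"
  assumes "s 0 < x" "x \<le> s n"
  obtains i where "i < n" "s i < x" "x \<le> s (Suc i)"
proof -
  have "\<exists>i<n. s i < x \<and> x \<le> s (Suc i)"
    using assms
  proof (induction n)
    case (Suc n)
    then show ?case by (cases "x \<le> s n") (auto simp: not_le less_Suc_eq)
  qed auto
  then show ?thesis using that by blast
qed

lemma eventually_at_right_ereal:
  "ereal x < u \<Longrightarrow> \<forall>\<^sub>F t in at_right x. ereal t < u"
  by (cases u) (auto simp: eventually_at_right_field dense intro: exI[of _ "x+1"])

lemma eventually_at_left_ereal: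
  "u < ereal x \<Longrightarrow> \<forall>\<^sub>F t in at_left x. u < ereal t"
  by (cases u) (auto simp: eventually_at_left_field dense intro: exI[of _ "x-1"])

lemma pieces_imp_int_affine:
  assumes "pieces 0 L g" "\<Phi> \<in> germ_filters L"
  shows "int_affine \<Phi> (\<lambda>t. g (ereal t))"
proof -
  obtain n s where s: "s 0 = 0" "s n = L" "\<And>i. i < n \<Longrightarrow> s i < s (Suc i)"
    and p: "\<And>i. i < n \<Longrightarrow> (\<exists>(a::real) (b::int). \<forall>t::real. s i \<le> ereal t \<and> ereal t \<le> s (Suc i) \<longrightarrow>
              g (ereal t) = ereal (a + of_int b * t))"
    using assms(1) unfolding pieces_def by blast
  have key: "int_affine \<Phi> (\<lambda>t. g (ereal t))"
    if "i < n" "\<forall>\<^sub>F t in \<Phi>. s i \<le> ereal t \<and> ereal t \<le> s (Suc i)" for i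
  proof -
    from p[OF that(1)] obtain a b where "\<forall>t::real. s i \<le> ereal t \<and> ereal t \<le> s (Suc i) \<longrightarrow>
              g (ereal t) = ereal (a + of_int b * t)" by blast
    then have "\<forall>\<^sub>F t in \<Phi>. g (ereal t) = ereal (a + of_int b * t)"
      using that(2) by (auto elim: eventually_mono)
    then show ?thesis unfolding int_affine_def by blast
  qed
  consider (r) x where "\<Phi> = at_right x" "0 \<le> x" "ereal x < L"
    | (l) x where "\<Phi> = at_left x" "0 < x" "ereal x \<le> L" | (t) "\<Phi> = at_top" "L = \<infinity>"
    using assms(2) by (auto simp: germ_filters_def split: if_splits)
  then show ?thesis
  proof cases
    case r
    obtain i where i: "i < n" "s i \<le> ereal x" "ereal x < s (Suc i)"
      using step_containing_right[of s "ereal x" n] r s by auto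
    have "\<forall>\<^sub>F t in at_right x. t > x" by (auto simp: eventually_at_filter)
    with eventually_at_right_ereal[OF i(3)]
    have "\<forall>\<^sub>F t in at_right x. s i \<le> ereal t \<and> ereal t \<le> s (Suc i)"
    proof eventually_elim
      case (elim t)
      then have "ereal x < ereal t" by simp
      then show ?case using i(2) elim by (meson less_imp_le order.trans)
    qed
    then show ?thesis using key i r by blast
  next
    case l
    obtain i where i: "i < n" "s i < ereal x" "ereal x \<le> s (Suc i)"
      using step_containing_left[of s "ereal x" n] l s by auto
    have "\<forall>\<^sub>F t in at_left x. t < x" by (auto simp: eventually_at_filter)
    with eventually_at_left_ereal[OF i(2)]
    have "\<forall>\<^sub>F t in at_left x. s i \<le> ereal t \<and> ereal t \<le> s (Suc i)"
    proof eventually_elim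
      case (elim t)
      then have "ereal t < ereal x" by simp
      then show ?case using i(3) elim by (meson less_imp_le order.trans)
    qed
    then show ?thesis using key i l by blast
  next
    case t
    then obtain i where i: "n = Suc i" using s by (cases n) auto
    then have "s i < \<infinity>" using s(2) s(3)[of i] t by auto
    then obtain N where N: "s i \<le> ereal N"
      by (cases "s i") auto
    have "\<forall>\<^sub>F t in at_top. s i \<le> ereal t \<and> ereal t \<le> s (Suc i)"
      using eventually_ge_at_top[of N]
      by eventually_elim (use i s t N in \<open>auto intro: order.trans\<close>)
    then show ?thesis using key[of i] i t by blast
  qed
qed

lemma tendsto_chart_at_right:
  fixes g :: "ereal \<Rightarrow> 'a::topological_space"
  assumes "continuous_on {0..L} g" "0 \<le> x" "ereal x < L"
  shows "((\<lambda>t. g (ereal t)) \<longlongrightarrow> g (ereal x)) (at_right x)"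
proof -
  obtain b where b: "x < b" "ereal b < L"
    using ereal_dense2[OF assms(3)] by auto
  have "continuous_on {x..b} (\<lambda>t. g (ereal t))"
    by (rule continuous_on_compose2[OF assms(1) continuous_on_ereal])
       (use b assms in \<open>auto intro: continuous_intros\<close>,
        meson ereal_less_eq(3) less_imp_le order.trans)
  then show ?thesis
    using b by (force simp: continuous_on_def at_within_Icc_at_right dest: bspec[of _ _ x])
qed

lemma tendsto_chart_at_left:
  fixes g :: "ereal \<Rightarrow> 'a::topological_space"
  assumes "continuous_on {0..L} g" "0 < x" "ereal x \<le> L"
  shows "((\<lambda>t. g (ereal t)) \<longlongrightarrow> g (ereal x)) (at_left x)"
proof -
  have "continuous_on {0..x} (\<lambda>t. g (ereal t))"
    by (rule continuous_on_compose2[OF assms(1) continuous_on_ereal])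
       (use assms in \<open>auto intro: continuous_intros\<close>,
        meson ereal_less_eq(3) less_imp_le order.trans)
  then show ?thesis
    using assms by (force simp: continuous_on_def at_within_Icc_at_left dest: bspec[of _ _ x])
qed

text \<open>
  Continuity extends the affine formula from a punctured one-sided neighbourhood to the point itself.
\<close>

lemma int_affine_at_rightE:
  assumes "continuous_on {0..L} g" "0 \<le> x" "ereal x < L" "int_affine (at_right x) (\<lambda>t. g (ereal t))"
  obtains c d and b :: int where "c = real_of_ereal (g (ereal x))" "d > 0"
    "\<And>t. x \<le> t \<Longrightarrow> t < x + d \<Longrightarrow> g (ereal t) = ereal (c + of_int b * (t - x))"
proof -
  obtain a b where ab: "\<forall>\<^sub>F t in at_right x. g (ereal t) = ereal (a + of_int b * t)"
    using assms(4) by (auto simp: int_affine_def)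
  have "((\<lambda>t. ereal (a + of_int b * t)) \<longlongrightarrow> ereal (a + of_int b * x)) (at_right x)"
    by (intro tendsto_intros)
  then have "((\<lambda>t. g (ereal t)) \<longlongrightarrow> ereal (a + of_int b * x)) (at_right x)"
    using tendsto_cong[OF ab] by blast
  then have x: "g (ereal x) = ereal (a + of_int b * x)"
    using tendsto_chart_at_right[OF assms(1-3)] tendsto_unique trivial_limit_at_right_real by blast
  obtain d where "d > x" "\<And>t. x < t \<Longrightarrow> t < d \<Longrightarrow> g (ereal t) = ereal (a + of_int b * t)"
    using ab by (auto simp: eventually_at_right_field)
  then show ?thesis
    using that[of "a + of_int b * x" "d - x" b] x by (auto simp: algebra_simps le_less)
qed

lemma int_affine_at_leftE:
  assumes "continuous_on {0..L} g" "0 < x" "ereal x \<le> L" "int_affine (at_left x) (\<lambda>t. g (ereal t))"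
  obtains c d and b :: int where "c = real_of_ereal (g (ereal x))" "d > 0"
    "\<And>t. t \<le> x \<Longrightarrow> x - d < t \<Longrightarrow> g (ereal t) = ereal (c + of_int b * (t - x))"
proof -
  obtain a b where ab: "\<forall>\<^sub>F t in at_left x. g (ereal t) = ereal (a + of_int b * t)"
    using assms(4) by (auto simp: int_affine_def)
  have "((\<lambda>t. ereal (a + of_int b * t)) \<longlongrightarrow> ereal (a + of_int b * x)) (at_left x)"
    by (intro tendsto_intros)
  then have "((\<lambda>t. g (ereal t)) \<longlongrightarrow> ereal (a + of_int b * x)) (at_left x)"
    using tendsto_cong[OF ab] by blast
  then have x: "g (ereal x) = ereal (a + of_int b * x)"
    using tendsto_chart_at_left[OF assms(1-3)] tendsto_unique trivial_limit_at_left_real by blast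
  obtain d where "d < x" "\<And>t. d < t \<Longrightarrow> t < x \<Longrightarrow> g (ereal t) = ereal (a + of_int b * t)"
    using ab by (auto simp: eventually_at_left_field)
  then show ?thesis
    using that[of "a + of_int b * x" "x - d" b] x by (auto simp: algebra_simps le_less)
qed

lemma pieces_affine_shift:
  assumes "x \<le> y" "\<And>t. x \<le> t \<Longrightarrow> t \<le> y \<Longrightarrow> g (ereal t) = ereal (c + of_int b * (t - z))"
  shows "pieces (ereal x) (ereal y) g"
  by (rule pieces_single[of _ _ _ "c - of_int b * z" b]) (use assms in \<open>auto simp: algebra_simps\<close>)

text \<open>
  On bounded parts, affine germs are glued to finitely many pieces by bisection; a germ at infinity
  supplies one last unbounded piece.
\<close>

lemma int_affine_imp_pieces:
  assumes "0 < L" "continuous_on {0..L} g"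
    and germs: "\<And>\<Phi>. \<Phi> \<in> germ_filters L \<Longrightarrow> int_affine \<Phi> (\<lambda>t. g (ereal t))"
  shows "pieces 0 L g"
proof -
  have fin: "pieces (ereal p) (ereal q) g" if "0 \<le> p" "p \<le> q" "ereal q \<le> L" for p q
  proof -
   \<comment> \<open>Bisection leaves \<open>[p, q]\<close> when it looks at neighbourhoods of \<open>p\<close> and \<open>q\<close>, so the claim is guarded.\<close>
   have "p \<le> p \<and> q \<le> q \<longrightarrow> pieces (ereal p) (ereal q) g"
   proof (rule Bolzano[where P = "\<lambda>a b. p \<le> a \<and> b \<le> q \<longrightarrow> pieces (ereal a) (ereal b) g", OF that(2)])
    fix a b c assume "p \<le> a \<and> b \<le> q \<longrightarrow> pieces (ereal a) (ereal b) g"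
      "p \<le> b \<and> c \<le> q \<longrightarrow> pieces (ereal b) (ereal c) g" "a \<le> b" "b \<le> c"
    then show "p \<le> a \<and> c \<le> q \<longrightarrow> pieces (ereal a) (ereal c) g" using pieces_trans by auto
  next
    fix x assume x: "p \<le> x" "x \<le> q"
    have "\<exists>d>0. \<forall>b\<ge>x. b \<le> q \<longrightarrow> b < x + d \<longrightarrow> pieces (ereal x) (ereal b) g"
    proof (cases "x = q")
      case True
      then show ?thesis by (intro exI[of _ 1]) (auto intro: pieces_refl)
    next
      case False
      then have xL: "0 \<le> x" "ereal x < L"
        using x that by (auto intro: less_le_trans[of _ "ereal q"])
      then have "int_affine (at_right x) (\<lambda>t. g (ereal t))"
        by (intro germs) (auto simp: germ_filters_def)
      from int_affine_at_rightE[OF assms(2) xL this] obtain c d b where "d > 0"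
        "\<And>t. x \<le> t \<Longrightarrow> t < x + d \<Longrightarrow> g (ereal t) = ereal (c + of_int b * (t - x))" by metis
      then show ?thesis
        by (intro exI[of _ d]) (auto intro!: pieces_affine_shift[where z = x])
    qed
    then obtain d1 where d1: "d1 > 0" "\<And>b. x \<le> b \<Longrightarrow> b \<le> q \<Longrightarrow> b < x + d1 \<Longrightarrow> pieces (ereal x) (ereal b) g"
      by blast
    have "\<exists>d>0. \<forall>a\<le>x. p \<le> a \<longrightarrow> x - d < a \<longrightarrow> pieces (ereal a) (ereal x) g"
    proof (cases "x = p")
      case True
      then show ?thesis by (intro exI[of _ 1]) (auto intro: pieces_refl)
    next
      case False
      then have xL: "0 < x" "ereal x \<le> L"
        using x that by (auto intro: order.trans[of _ "ereal q"])
      then have "int_affine (at_left x) (\<lambda>t. g (ereal t))"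
        by (intro germs) (auto simp: germ_filters_def)
      from int_affine_at_leftE[OF assms(2) xL this] obtain c d b where "d > 0"
        "\<And>t. t \<le> x \<Longrightarrow> x - d < t \<Longrightarrow> g (ereal t) = ereal (c + of_int b * (t - x))" by metis
      then show ?thesis
        by (intro exI[of _ d]) (auto intro!: pieces_affine_shift[where z = x])
    qed
    then obtain d2 where d2: "d2 > 0" "\<And>a. a \<le> x \<Longrightarrow> p \<le> a \<Longrightarrow> x - d2 < a \<Longrightarrow> pieces (ereal a) (ereal x) g"
      by blast
    show "\<exists>d>0. \<forall>a b. a \<le> x \<and> x \<le> b \<and> b - a < d \<longrightarrow>
        p \<le> a \<and> b \<le> q \<longrightarrow> pieces (ereal a) (ereal b) g"
      using d1 d2 by (intro exI[of _ "min d1 d2"]) (auto intro: pieces_trans[of _ "ereal x"])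
   qed
   then show ?thesis by simp
  qed
  show ?thesis
  proof (cases L)
    case (real l)
    then show ?thesis using fin[of 0 l] assms(1) by (simp add: zero_ereal_def)
  next
    case PInf
    then have "int_affine at_top (\<lambda>t. g (ereal t))"
      by (intro germs) (auto simp: germ_filters_def)
    then obtain a b N where N: "\<And>t. t \<ge> N \<Longrightarrow> g (ereal t) = ereal (a + of_int b * t)"
      by (auto simp: int_affine_def eventually_at_top_linorder)
    have "pieces 0 (ereal (max 0 N)) g"
      using fin[of 0 "max 0 N"] PInf by (simp add: zero_ereal_def)
    moreover have "pieces (ereal (max 0 N)) L g"
      by (rule pieces_single[of _ _ _ a b]) (use N PInf in auto)
    ultimately show ?thesis by (rule pieces_trans)
  qed (use assms in auto)
qed

section \<open>Walks, distance and topology\<close>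

lemma walk_nonneg: "walk \<Gamma> x d y \<Longrightarrow> 0 \<le> d"
  by (induction rule: walk.induct) auto

lemma chart_in_points: "e \<in> edges \<Gamma> \<Longrightarrow> t \<in> {0..len \<Gamma> e} \<Longrightarrow> chart \<Gamma> e t \<in> points \<Gamma>"
  unfolding points_def edge_set_def by blast

lemma walk_segment:
  assumes "e \<in> edges \<Gamma>" "s \<in> {0..len \<Gamma> e}" "t \<in> {0..len \<Gamma> e}"
  shows "walk \<Gamma> (chart \<Gamma> e s) \<bar>s - t\<bar> (chart \<Gamma> e t)"
proof -
  have "walk \<Gamma> (chart \<Gamma> e s) (0 + \<bar>s - t\<bar>) (chart \<Gamma> e t)"
    by (intro walk.step walk.refl chart_in_points assms)
  then show ?thesis by simp
qed

lemma walk_append: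
  assumes "walk \<Gamma> y d' z" "walk \<Gamma> x d y"
  shows "walk \<Gamma> x (d + d') z"
  using assms
proof (induction arbitrary: d rule: walk.induct)
  case (step y d' e s t)
  then have "walk \<Gamma> x (d + d' + \<bar>s - t\<bar>) (chart \<Gamma> e t)"
    by (intro walk.step) auto
  then show ?case by (simp add: add.assoc)
qed simp

lemma ereal_abs_minus_commute: "\<bar>a - b\<bar> = \<bar>b - a\<bar>" for a b :: ereal
  by (cases a; cases b) auto

lemma walk_sym: "walk \<Gamma> x d y \<Longrightarrow> walk \<Gamma> y d x"
proof (induction rule: walk.induct)
  case (step x d e s t)
  then show ?case
    using walk_append[OF step.IH walk_segment[of e \<Gamma> t s]]
    by (simp add: add.commute ereal_abs_minus_commute[of t])
qed (rule walk.refl)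

lemma cdist_sym: "cdist \<Gamma> x y = cdist \<Gamma> y x"
  unfolding cdist_def by (metis walk_sym)

lemma cdist_nonneg: "0 \<le> cdist \<Gamma> x y"
  unfolding cdist_def by (auto intro: Inf_greatest walk_nonneg)

lemma cdist_refl: "x \<in> points \<Gamma> \<Longrightarrow> cdist \<Gamma> x x = 0"
  using cdist_nonneg[of \<Gamma> x x] walk.refl[of x \<Gamma>] unfolding cdist_def
  by (metis CollectI Inf_lower antisym)

lemma cdist_le_walk: "walk \<Gamma> x d y \<Longrightarrow> cdist \<Gamma> x y \<le> d"
  unfolding cdist_def by (auto intro: Inf_lower)

lemma cdist_lessE:
  assumes "cdist \<Gamma> x y < r"
  obtains d where "walk \<Gamma> x d y" "d < r"
  using assms unfolding cdist_def by (auto simp: Inf_less_iff)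

lemma cdist_segment:
  "e \<in> edges \<Gamma> \<Longrightarrow> s \<in> {0..len \<Gamma> e} \<Longrightarrow> t \<in> {0..len \<Gamma> e} \<Longrightarrow>
   cdist \<Gamma> (chart \<Gamma> e s) (chart \<Gamma> e t) \<le> \<bar>s - t\<bar>"
  by (rule cdist_le_walk[OF walk_segment])

lemma cdist_triangle: "cdist \<Gamma> x z \<le> cdist \<Gamma> x y + cdist \<Gamma> y z"
proof (cases "cdist \<Gamma> x y = \<infinity> \<or> cdist \<Gamma> y z = \<infinity>")
  case False
  then obtain p q where pq: "cdist \<Gamma> x y = ereal p" "cdist \<Gamma> y z = ereal q"
    using cdist_nonneg[of \<Gamma>] by (metis PInfty_neq_ereal(1) MInfty_neq_PInfty(1) ereal_cases ereal_less_eq(6) not_MInfty_nonneg)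
  show ?thesis
  proof (rule ereal_le_epsilon2)
    fix \<epsilon> :: real assume "0 < \<epsilon>"
    then have "cdist \<Gamma> x y < ereal (p + \<epsilon> / 2)" "cdist \<Gamma> y z < ereal (q + \<epsilon> / 2)"
      using pq by auto
    then obtain d d' where d: "walk \<Gamma> x d y" "d < ereal (p + \<epsilon> / 2)" "walk \<Gamma> y d' z" "d' < ereal (q + \<epsilon> / 2)"
      by (meson cdist_lessE)
    have "cdist \<Gamma> x z \<le> d + d'"
      using cdist_le_walk[OF walk_append[OF d(3,1)]] .
    also have "\<dots> \<le> ereal (p + \<epsilon> / 2) + ereal (q + \<epsilon> / 2)"
      using d by (intro add_mono) auto
    finally show "cdist \<Gamma> x z \<le> cdist \<Gamma> x y + cdist \<Gamma> y z + ereal \<epsilon>"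
      by (simp add: pq algebra_simps)
  qed
qed (use cdist_nonneg[of \<Gamma>] in auto)

text \<open>
  The distance is the infimum of the lengths of walks, so it is enough to control a map on single
  segments.  Distances between two curves are compared only through this lemma.
\<close>

lemma nonexpanding_if_on_edges:
  assumes maps: "\<theta> \<in> points \<Gamma> \<rightarrow> points \<Gamma>'"
    and edges: "\<And>e s t. e \<in> edges \<Gamma> \<Longrightarrow> s \<in> {0..len \<Gamma> e} \<Longrightarrow> t \<in> {0..len \<Gamma> e} \<Longrightarrow>
      cdist \<Gamma>' (\<theta> (chart \<Gamma> e s)) (\<theta> (chart \<Gamma> e t)) \<le> \<bar>s - t\<bar>"
  shows "cdist \<Gamma>' (\<theta> x) (\<theta> y) \<le> cdist \<Gamma> x y"
proof -
  have "cdist \<Gamma>' (\<theta> x) (\<theta> y) \<le> d" if "walk \<Gamma> x d y" for d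
    using that
  proof (induction rule: walk.induct)
    case (refl x)
    then show ?case using maps by (auto simp: cdist_refl Pi_iff)
  next
    case (step x d e s t)
    then show ?case
      using cdist_triangle[of \<Gamma>' "\<theta> x" "\<theta> (chart \<Gamma> e t)" "\<theta> (chart \<Gamma> e s)"] edges[of e s t]
      by (meson add_mono order.trans)
  qed
  then show ?thesis
    unfolding cdist_def[of \<Gamma>] by (auto intro: Inf_greatest)
qed

text \<open>
  The topology of a curve is a quotient topology.
\<close>

lemma continuous_map_curve:
  "continuous_map (curve_top \<Gamma>) X f \<longleftrightarrow> f \<in> points \<Gamma> \<rightarrow> topspace X \<and>
     (\<forall>e\<in>edges \<Gamma>. continuous_map (top_of_set {0..len \<Gamma> e}) X (\<lambda>t. f (chart \<Gamma> e t)))"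
  (is "?l \<longleftrightarrow> ?r")
proof -
  have eq: "{t \<in> {0..len \<Gamma> e}. chart \<Gamma> e t \<in> {x \<in> points \<Gamma>. f x \<in> U}} =
      {t \<in> {0..len \<Gamma> e}. f (chart \<Gamma> e t) \<in> U}" if "e \<in> edges \<Gamma>" for e U
    using chart_in_points[OF that] by auto
  have charts: "(\<lambda>t. f (chart \<Gamma> e t)) \<in> {0..len \<Gamma> e} \<rightarrow> topspace X"
    if "f \<in> points \<Gamma> \<rightarrow> topspace X" "e \<in> edges \<Gamma>" for e
    using that chart_in_points[OF that(2)] by blast
  have "?l \<longleftrightarrow> f \<in> points \<Gamma> \<rightarrow> topspace X \<and> (\<forall>U. openin X U \<longrightarrow>
      (\<forall>e\<in>edges \<Gamma>. openin (top_of_set {0..len \<Gamma> e}) {t \<in> {0..len \<Gamma> e}. f (chart \<Gamma> e t) \<in> U}))"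
    unfolding continuous_map_def topspace_curve_top openin_curve_top
    using eq by (auto simp: Pi_iff simp del: mem_Collect_eq atLeastAtMost_iff)
  also have "\<dots> \<longleftrightarrow> ?r"
    unfolding continuous_map_def using charts by auto
  finally show ?thesis .
qed

lemma continuous_map_curve_euclidean:
  "continuous_map (curve_top \<Gamma>) euclidean f \<longleftrightarrow>
     (\<forall>e\<in>edges \<Gamma>. continuous_on {0..len \<Gamma> e} (\<lambda>t. f (chart \<Gamma> e t)))"
  by (simp add: continuous_map_curve)

lemma continuous_map_chart:
  assumes "e \<in> edges \<Gamma>"
  shows "continuous_map (top_of_set {0..len \<Gamma> e}) (curve_top \<Gamma>) (chart \<Gamma> e)"
  using assms chart_in_points[OF assms] unfolding continuous_map_def topspace_curve_top
  by (auto simp: openin_curve_top)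

locale tropical =
  fixes \<Gamma> :: "('p, 'e) curve"
  assumes tropical: "tropical_curve \<Gamma>"
begin

abbreviation "E \<equiv> edges \<Gamma>"
abbreviation "V \<equiv> verts \<Gamma>"

lemma finite_verts: "finite V" and verts_nonempty: "V \<noteq> {}" and finite_edges: "finite E"
  and connected: "u \<in> V \<Longrightarrow> v \<in> V \<Longrightarrow> (u, v) \<in> (adjacent \<Gamma>)\<^sup>*"
  using tropical unfolding tropical_curve_def by auto

lemma len_pos: "e \<in> E \<Longrightarrow> 0 < len \<Gamma> e"
  and src_vert: "e \<in> E \<Longrightarrow> src \<Gamma> e \<in> V" and tgt_vert: "e \<in> E \<Longrightarrow> tgt \<Gamma> e \<in> V"
  and inj_interior: "e \<in> E \<Longrightarrow> inj_on (chart \<Gamma> e) {0<..<len \<Gamma> e}"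
  and interior_verts: "e \<in> E \<Longrightarrow> edge_interior \<Gamma> e \<inter> V = {}"
  and interior_disjoint: "e \<in> E \<Longrightarrow> e' \<in> E \<Longrightarrow> e \<noteq> e' \<Longrightarrow> edge_interior \<Gamma> e \<inter> edge_interior \<Gamma> e' = {}"
  and valence_infinite: "e \<in> E \<Longrightarrow> len \<Gamma> e = \<infinity> \<Longrightarrow> valence \<Gamma> (tgt \<Gamma> e) = 1"
  using tropical unfolding tropical_curve_def by auto

lemma chart_vert_iff:
  assumes "e \<in> E" "t \<in> {0..len \<Gamma> e}"
  shows "chart \<Gamma> e t \<in> V \<longleftrightarrow> t \<in> {0, len \<Gamma> e}"
proof
  assume v: "chart \<Gamma> e t \<in> V"
  show "t \<in> {0, len \<Gamma> e}"
  proof (rule ccontr)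
    assume "t \<notin> {0, len \<Gamma> e}"
    then have "t \<in> {0<..<len \<Gamma> e}" using assms by auto
    then have "chart \<Gamma> e t \<in> edge_interior \<Gamma> e"
      unfolding edge_interior_def by (rule imageI)
    then show False using v interior_verts[OF assms(1)] by auto
  qed
qed (use assms src_vert tgt_vert in \<open>auto simp: src_def tgt_def\<close>)

text \<open>
  The only coincidences between points of edges are at vertices.
\<close>

lemma chart_eq_cases:
  assumes "e \<in> E" "s \<in> {0..len \<Gamma> e}" "e' \<in> E" "t \<in> {0..len \<Gamma> e'}" "chart \<Gamma> e s = chart \<Gamma> e' t"
  obtains "e = e'" "s = t" | "s \<in> {0, len \<Gamma> e}" "t \<in> {0, len \<Gamma> e'}"
proof (cases "chart \<Gamma> e s \<in> V")
  case True
  then show ?thesis using that(2) chart_vert_iff assms by metis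
next
  case False
  then have st: "s \<in> {0<..<len \<Gamma> e}" "t \<in> {0<..<len \<Gamma> e'}"
    using assms chart_vert_iff by (metis atLeastAtMost_iff greaterThanLessThan_iff insert_iff order_le_less)+
  then have "e = e'"
    using interior_disjoint[OF assms(1,3)] assms(5) unfolding edge_interior_def by (metis IntI empty_iff imageI)
  then show ?thesis
    using that(1) inj_interior[OF assms(1)] assms(5) st by (auto dest: inj_onD)
qed

lemma pointsE:
  assumes "x \<in> points \<Gamma>"
  obtains "x \<in> V" | e t where "e \<in> E" "t \<in> {0..len \<Gamma> e}" "x = chart \<Gamma> e t"
  using assms unfolding points_def edge_set_def by blast

text \<open>
  A point at infinity has valence one, so no other edge, and no other point of its own edge, reaches it.
\<close>

lemma infinite_end:
  assumes "e \<in> E" "len \<Gamma> e = \<infinity>" "e' \<in> E" "t \<in> {0..len \<Gamma> e'}" "chart \<Gamma> e' t = tgt \<Gamma> e"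
  shows "e' = e \<and> t = \<infinity>"
proof -
  let ?S = "{e' \<in> E. src \<Gamma> e' = tgt \<Gamma> e}" and ?T = "{e' \<in> E. tgt \<Gamma> e' = tgt \<Gamma> e}"
  have fin: "finite ?S" "finite ?T" using finite_edges by auto
  have "e \<in> ?T" using assms by auto
  then have "card ?T \<noteq> 0" using fin by auto
  then have c: "card ?S = 0" "card ?T = 1"
    using valence_infinite[OF assms(1,2)] by (auto simp: valence_def)
  then have S: "?S = {}" and T: "?T = {e}"
    using fin \<open>e \<in> ?T\<close> by (simp, metis (lifting) card_1_singletonE singletonD)
  have "t \<in> {0, len \<Gamma> e'}"
    using chart_vert_iff[OF assms(3,4)] assms(5) tgt_vert[OF assms(1)] by auto
  then show ?thesis
  proof
    assume "t = 0"
    then have "e' \<in> ?S" using assms by (auto simp: src_def)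
    then show ?thesis using S by auto
  next
    assume "t \<in> {len \<Gamma> e'}"
    then have "e' \<in> ?T" using assms by (auto simp: tgt_def)
    then show ?thesis using T \<open>t \<in> {len \<Gamma> e'}\<close> assms by auto
  qed
qed

lemma inf_points_subset: "inf_points \<Gamma> \<subseteq> V"
  using tgt_vert by (auto simp: inf_points_def)

lemma verts_subset: "V \<subseteq> points \<Gamma>" by (auto simp: points_def)

lemma chart_inf_iff:
  assumes "e \<in> E" "t \<in> {0..len \<Gamma> e}"
  shows "chart \<Gamma> e t \<in> inf_points \<Gamma> \<longleftrightarrow> t = \<infinity>"
proof
  assume "chart \<Gamma> e t \<in> inf_points \<Gamma>"
  then show "t = \<infinity>" using infinite_end assms by (auto simp: inf_points_def)
next
  assume "t = \<infinity>"
  then have "len \<Gamma> e = \<infinity>" using assms by simp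
  then show "chart \<Gamma> e t \<in> inf_points \<Gamma>"
    using assms \<open>t = \<infinity>\<close> unfolding inf_points_def tgt_def by force
qed

lemma chart_fin_iff:
  assumes "e \<in> E" "t \<in> {0..len \<Gamma> e}"
  shows "chart \<Gamma> e t \<in> fin_points \<Gamma> \<longleftrightarrow> t \<noteq> \<infinity>"
  using chart_inf_iff[OF assms] chart_in_points[OF assms] by (auto simp: fin_points_def)

lemma fin_points_subset: "x \<in> fin_points \<Gamma> \<Longrightarrow> x \<in> points \<Gamma>"
  by (simp add: fin_points_def)

lemma inf_pointsE:
  assumes "x \<in> inf_points \<Gamma>"
  obtains e where "e \<in> E" "len \<Gamma> e = \<infinity>" "x = chart \<Gamma> e \<infinity>"
  using assms by (auto simp: inf_points_def tgt_def)

lemma infinite_edge_inj: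
  assumes "e \<in> E" "len \<Gamma> e = \<infinity>" "0 \<le> s" "0 \<le> t" "chart \<Gamma> e s = chart \<Gamma> e t"
  shows "s = t"
proof -
  have st: "s \<in> {0..len \<Gamma> e}" "t \<in> {0..len \<Gamma> e}" using assms by auto
  show ?thesis
    using chart_eq_cases[OF assms(1) st(1) assms(1) st(2) assms(5)]
      infinite_end[OF assms(1,2,1) st(1)] infinite_end[OF assms(1,2,1) st(2)] assms
    by (cases rule: chart_eq_cases[OF assms(1) st(1) assms(1) st(2) assms(5)]) (auto simp: tgt_def)
qed

text \<open>
  Even a segment from a point at infinity to itself has infinite length, since \<open>\<bar>\<infinity> - \<infinity>\<bar> = \<infinity>\<close> in
  \<^typ>\<open>ereal\<close>.  The empty walk is the only finite one.
\<close>

lemma walk_infinite: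
  assumes "walk \<Gamma> x d y" "x \<in> inf_points \<Gamma>"
  shows "y = x \<or> d = \<infinity>"
  using assms
proof (induction rule: walk.induct)
  case (step x d e s t)
  show ?case
  proof (cases "d = \<infinity>")
    case False
    then have "chart \<Gamma> e s \<in> inf_points \<Gamma>" using step by auto
    then have "s = \<infinity>" using chart_inf_iff step by auto
    then show ?thesis using walk_nonneg[OF step.hyps(1)] by auto
  qed auto
qed auto

lemma cdist_infinite:
  assumes "x \<in> inf_points \<Gamma> \<or> y \<in> inf_points \<Gamma>" "x \<noteq> y"
  shows "cdist \<Gamma> x y = \<infinity>"
proof -
  have *: "cdist \<Gamma> x y = \<infinity>" if "x \<in> inf_points \<Gamma>" "x \<noteq> y" for x y
  proof (rule ccontr)
    assume "cdist \<Gamma> x y \<noteq> \<infinity>"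
    then obtain d where "walk \<Gamma> x d y" "d < \<infinity>" by (metis cdist_lessE less_PInf_Ex_of_nat PInfty_neq_ereal(1) ereal_infty_less(1))
    then show False using walk_infinite that by fastforce
  qed
  show ?thesis using assms *[of x y] *[of y x] cdist_sym[of \<Gamma> x y] by auto
qed

text \<open>
  The parameters of a point on an edge; there can be two if the edge is a loop.
\<close>

definition fibre :: "'e \<Rightarrow> 'p \<Rightarrow> ereal set" where
  "fibre e a = {t \<in> {0..len \<Gamma> e}. chart \<Gamma> e t = a}"

lemma finite_fibre: "e \<in> E \<Longrightarrow> finite (fibre e a)"
proof (cases "fibre e a \<subseteq> {0, len \<Gamma> e}")
  case False
  then obtain s where s: "s \<in> fibre e a" "s \<notin> {0, len \<Gamma> e}" by auto
  assume e: "e \<in> E"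
  have "fibre e a \<subseteq> {s}"
  proof
    fix t assume "t \<in> fibre e a"
    then show "t \<in> {s}"
      using chart_eq_cases[OF e _ e, of s t] s by (auto simp: fibre_def)
  qed
  then show ?thesis using finite_subset by blast
qed (auto intro: finite_subset)

lemma fibre_finite_point:
  "a \<in> fin_points \<Gamma> \<Longrightarrow> e \<in> E \<Longrightarrow> s \<in> fibre e a \<Longrightarrow> \<exists>r\<ge>0. s = ereal r \<and> ereal r \<le> len \<Gamma> e"
  using chart_fin_iff[of e s] by (cases s) (auto simp: fibre_def)

text \<open>
  Walking less than this distance away from \<open>a\<close> along an edge does not reach a further end of this edge.
\<close>

definition star_radius :: "'p \<Rightarrow> real \<Rightarrow> bool" where
  "star_radius a R \<longleftrightarrow> 0 < R \<and> (\<forall>e\<in>E. \<forall>s\<in>fibre e a. \<forall>t\<in>{0, len \<Gamma> e}. s \<noteq> t \<longrightarrow> ereal R \<le> \<bar>s - t\<bar>)"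

lemma finite_pos_lower_bound:
  assumes "finite A" "\<And>x. x \<in> A \<Longrightarrow> 0 < (x::ereal)"
  obtains r where "0 < r" "\<And>x. x \<in> A \<Longrightarrow> ereal r \<le> x"
proof -
  have "0 < Min (insert 1 A)" using assms by auto
  then obtain r where "0 < ereal r" "ereal r < Min (insert 1 A)" by (metis ereal_dense2 zero_ereal_def)
  then show ?thesis using that[of r] assms by (auto simp: less_imp_le)
qed

lemma star_radius_exists: obtains R where "star_radius a R"
proof -
  let ?A = "(\<Union>e\<in>E. \<Union>s\<in>fibre e a. (\<lambda>t. \<bar>s - t\<bar>) ` {t \<in> {0, len \<Gamma> e}. s \<noteq> t})"
  have "finite ?A" using finite_edges finite_fibre by auto
  moreover have "0 < \<bar>s - t\<bar>" if "s \<noteq> t" for s t :: ereal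
    using that by (cases s; cases t) auto
  ultimately obtain r where "0 < r" "\<And>x. x \<in> ?A \<Longrightarrow> ereal r \<le> x"
    using finite_pos_lower_bound[of ?A] by blast
  then have "star_radius a r" unfolding star_radius_def by blast
  then show ?thesis by (rule that)
qed

lemma star_radius_mono: "star_radius a R \<Longrightarrow> 0 < r \<Longrightarrow> r \<le> R \<Longrightarrow> star_radius a r"
  unfolding star_radius_def by (meson ereal_less_eq(3) order.trans)

lemma ereal_abs_triangle: "\<bar>a - c\<bar> \<le> \<bar>a - b\<bar> + \<bar>b - c\<bar>" for a b c :: ereal
  by (cases a; cases b; cases c) auto

text \<open>
  A walk from \<open>a\<close> that is shorter than a star radius can pass from one edge to another only at \<open>a\<close>, for
  any other vertex is too far away.  So it is never shorter than the segment that leads straight to its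
  end.
\<close>

lemma walk_within_star:
  assumes "walk \<Gamma> a d y" "star_radius a R" "d < ereal R"
  shows "y = a \<or> (\<exists>e\<in>E. \<exists>s\<in>fibre e a. \<exists>t\<in>{0..len \<Gamma> e}. y = chart \<Gamma> e t \<and> \<bar>s - t\<bar> \<le> d)"
  using assms
proof (induction rule: walk.induct)
  case (step a d e s t)
  note R = \<open>star_radius a R\<close>
  have d: "d \<le> d + \<bar>s - t\<bar>" using step.prems by (intro ereal_le_add_self) auto
  then have "d < ereal R" using step.prems by auto
  from step.IH[OF R this] have "chart \<Gamma> e s = a \<or> (\<exists>s1\<in>fibre e a. \<bar>s1 - s\<bar> \<le> d)"
  proof (elim disjE bexE conjE)
    fix e1 s1 t1 assume 1: "e1 \<in> E" "s1 \<in> fibre e1 a" "t1 \<in> {0..len \<Gamma> e1}"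
      "chart \<Gamma> e s = chart \<Gamma> e1 t1" "\<bar>s1 - t1\<bar> \<le> d"
    show ?thesis
    proof (cases rule: chart_eq_cases[OF step.hyps(2,3) 1(1,3,4)])
      case 2
      then have "s1 = t1" using 1 R \<open>d < ereal R\<close> unfolding star_radius_def
        by (meson leD order.strict_trans1)
      then show ?thesis using 1 by (auto simp: fibre_def)
    qed (use 1 in auto)
  qed auto
  then show ?case
  proof
    assume "chart \<Gamma> e s = a"
    then have "s \<in> fibre e a" using step by (auto simp: fibre_def)
    moreover have "\<bar>s - t\<bar> \<le> d + \<bar>s - t\<bar>"
      using walk_nonneg[OF step.hyps(1)] by (metis add.commute ereal_le_add_self)
    ultimately show ?thesis using step.hyps by blast
  next
    assume "\<exists>s1\<in>fibre e a. \<bar>s1 - s\<bar> \<le> d"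
    then obtain s1 where s1: "s1 \<in> fibre e a" "\<bar>s1 - s\<bar> \<le> d" by blast
    have "\<bar>s1 - t\<bar> \<le> d + \<bar>s - t\<bar>"
      using ereal_abs_triangle[of s1 t s] add_right_mono[OF s1(2)] by (meson order.trans)
    then show ?thesis using s1 step.hyps by blast
  qed
qed auto

text \<open>
  The infimum over all walks is attained: by the previous lemma only the finitely many straight
  segments from \<open>a\<close> compete.
\<close>

lemma cdist_within_star:
  assumes a: "a \<in> fin_points \<Gamma>" and R: "star_radius a R" and e: "e \<in> E" "t \<in> {0..len \<Gamma> e}"
    and less: "cdist \<Gamma> a (chart \<Gamma> e t) < ereal R"
  obtains s where "s \<in> fibre e a" "cdist \<Gamma> a (chart \<Gamma> e t) = \<bar>s - t\<bar>"
proof -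
  have *: "\<exists>s\<in>fibre e a. \<bar>s - t\<bar> \<le> d" if w: "walk \<Gamma> a d (chart \<Gamma> e t)" and d: "d < ereal R" for d
  proof -
    have "chart \<Gamma> e t = a \<or> (\<exists>s\<in>fibre e a. \<bar>s - t\<bar> \<le> d)"
      using walk_within_star[OF w R d]
    proof (elim disjE bexE conjE)
      fix e1 s1 t1 assume 1: "e1 \<in> E" "s1 \<in> fibre e1 a" "t1 \<in> {0..len \<Gamma> e1}"
        "chart \<Gamma> e t = chart \<Gamma> e1 t1" "\<bar>s1 - t1\<bar> \<le> d"
      show ?thesis
      proof (cases rule: chart_eq_cases[OF e 1(1,3,4)])
        case 2
        then have "s1 = t1" using 1 R \<open>d < ereal R\<close> unfolding star_radius_def
          by (meson leD order.strict_trans1)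
        then show ?thesis using 1 by (auto simp: fibre_def)
      qed (use 1 in auto)
    qed auto
    then show ?thesis
    proof
      assume ta: "chart \<Gamma> e t = a"
      then have "t \<in> fibre e a" using e by (auto simp: fibre_def)
      moreover have "\<bar>t - t\<bar> \<le> d"
        using fibre_finite_point[OF a e(1) \<open>t \<in> fibre e a\<close>] walk_nonneg[OF w] by auto
      ultimately show ?thesis by blast
    qed
  qed
  let ?D = "(\<lambda>s. \<bar>s - t\<bar>) ` fibre e a"
  obtain d0 where d0: "walk \<Gamma> a d0 (chart \<Gamma> e t)" "d0 < ereal R"
    using less by (rule cdist_lessE)
  have fin: "finite ?D" using finite_fibre[OF e(1)] by auto
  have "?D \<noteq> {}" using *[OF d0] by auto
  then have "Min ?D \<in> ?D" using fin by simp
  then obtain s where s: "s \<in> fibre e a" "\<bar>s - t\<bar> = Min ?D" by auto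
  have le: "Min ?D \<le> d" if "walk \<Gamma> a d (chart \<Gamma> e t)" "d < ereal R" for d
    using *[OF that] fin by (meson Min_le image_eqI order.trans)
  have "\<bar>s - t\<bar> \<le> d" if "walk \<Gamma> a d (chart \<Gamma> e t)" for d
    using le[OF that] le[OF d0] d0(2) s(2) by (metis less_imp_le linorder_le_less_linear order.trans)
  then have "\<bar>s - t\<bar> \<le> cdist \<Gamma> a (chart \<Gamma> e t)"
    unfolding cdist_def by (auto intro: Inf_greatest)
  moreover have "cdist \<Gamma> a (chart \<Gamma> e t) \<le> \<bar>s - t\<bar>"
    using cdist_segment[of e \<Gamma> s t] s(1) e by (auto simp: fibre_def)
  ultimately show ?thesis using that s by auto
qed

text \<open>
  Along an edge, the truncated distance from \<open>a\<close> is thus the minimum of a constant and finitely many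
  functions \<open>t \<mapsto> \<bar>s - t\<bar>\<close>.  This makes it a rational function.
\<close>

lemma min_cdist_chart:
  assumes "a \<in> fin_points \<Gamma>" "star_radius a R" "e \<in> E" "t \<in> {0..len \<Gamma> e}"
  shows "min (ereal R) (cdist \<Gamma> a (chart \<Gamma> e t)) = Min (insert (ereal R) ((\<lambda>s. \<bar>s - t\<bar>) ` fibre e a))"
    (is "?l = Min ?A")
proof (rule antisym)
  have fin: "finite ?A" using finite_fibre[OF assms(3)] by auto
  have "?l \<le> x" if "x \<in> ?A" for x
    using that cdist_segment[of e \<Gamma> _ t] assms(3,4) by (auto simp: fibre_def min_le_iff_disj)
  then show "?l \<le> Min ?A" using fin by auto
  show "Min ?A \<le> ?l"
  proof (cases "cdist \<Gamma> a (chart \<Gamma> e t) < ereal R")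
    case True
    then obtain s where s: "s \<in> fibre e a" "cdist \<Gamma> a (chart \<Gamma> e t) = \<bar>s - t\<bar>"
      using cdist_within_star[OF assms(1,2,3,4)] by blast
    then have "Min ?A \<le> \<bar>s - t\<bar>" "Min ?A \<le> ereal R" using fin by (auto intro!: Min_le)
    then show ?thesis using s by simp
  next
    case False
    then have "?l = ereal R" by (auto simp: min_def)
    then show ?thesis using fin by (metis Min_le insertI1)
  qed
qed

lemma cdist_zero_imp_eq:
  assumes "x \<in> points \<Gamma>" "y \<in> points \<Gamma>" "cdist \<Gamma> x y = 0"
  shows "x = y"
proof (rule ccontr)
  assume ne: "x \<noteq> y"
  then have x: "x \<in> fin_points \<Gamma>" "y \<in> fin_points \<Gamma>"
    using cdist_infinite[of x y] assms by (auto simp: fin_points_def)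
  obtain R where R: "star_radius x R" by (rule star_radius_exists)
  then have less: "cdist \<Gamma> x y < ereal R" using assms by (simp add: star_radius_def)
  show False
  proof -
    obtain d where d: "walk \<Gamma> x d y" "d < ereal R" using less by (rule cdist_lessE)
    obtain e t where e: "e \<in> E" "t \<in> {0..len \<Gamma> e}" "y = chart \<Gamma> e t"
      using walk_within_star[OF d(1) R d(2)] ne by auto
    obtain s where s: "s \<in> fibre e x" "\<bar>s - t\<bar> = 0"
      using cdist_within_star[OF x(1) R e(1,2)] less e(3) assms(3) by metis
    then have "s = t" by (cases s; cases t) auto
    then show False using s e ne by (auto simp: fibre_def)
  qed
qed

text \<open>
  Globally a curve may offer short cuts; locally the charts are isometric.
\<close>

lemma cdist_eq_nearby:
  assumes "e \<in> E" "0 \<le> s" "ereal s \<le> len \<Gamma> e"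
  obtains \<rho> where "0 < \<rho>"
    "\<And>t. 0 \<le> t \<Longrightarrow> ereal t \<le> len \<Gamma> e \<Longrightarrow> \<bar>s - t\<bar> < \<rho> \<Longrightarrow>
      cdist \<Gamma> (chart \<Gamma> e (ereal s)) (chart \<Gamma> e (ereal t)) = ereal \<bar>s - t\<bar>"
proof -
  let ?a = "chart \<Gamma> e (ereal s)"
  have s: "ereal s \<in> {0..len \<Gamma> e}" using assms by auto
  then have a: "?a \<in> fin_points \<Gamma>" using assms(1) by (simp add: chart_fin_iff)
  obtain R where R: "star_radius ?a R" by (rule star_radius_exists)
  then have "0 < R" by (simp add: star_radius_def)
  show ?thesis
  \<comment> \<open>Two parameters of the same point are at least \<open>R\<close> apart, so at most one is closer than \<open>R / 2\<close> to \<open>t\<close>.\<close>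
  proof (rule that[of "R / 2"])
    fix t assume t: "0 \<le> t" "ereal t \<le> len \<Gamma> e" "\<bar>s - t\<bar> < R / 2"
    then have t': "ereal t \<in> {0..len \<Gamma> e}" by auto
    have le: "cdist \<Gamma> ?a (chart \<Gamma> e (ereal t)) \<le> ereal \<bar>s - t\<bar>"
      using cdist_segment[OF assms(1) s t'] by simp
    also have "\<dots> < ereal R" using t(3) \<open>0 < R\<close> by simp
    finally obtain s1 where s1: "s1 \<in> fibre e ?a" "cdist \<Gamma> ?a (chart \<Gamma> e (ereal t)) = \<bar>s1 - ereal t\<bar>"
      using cdist_within_star[OF a R assms(1) t'] by blast
    obtain r where r: "s1 = ereal r" using fibre_finite_point[OF a assms(1) s1(1)] by blast
    have "s1 = ereal s"
    proof (rule ccontr)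
      assume ne: "s1 \<noteq> ereal s"
      have s1': "s1 \<in> {0..len \<Gamma> e}" "chart \<Gamma> e (ereal s) = chart \<Gamma> e s1"
        using s1(1) by (auto simp: fibre_def)
      have "ereal s \<in> {0, len \<Gamma> e}"
        by (cases rule: chart_eq_cases[OF assms(1) s assms(1) s1']) (use ne in auto)
      then have "ereal R \<le> \<bar>s1 - ereal s\<bar>"
        using R s1(1) ne assms(1) unfolding star_radius_def by blast
      then show False using le s1(2) r t(3) by (auto simp: abs_if split: if_splits)
    qed
    then show "cdist \<Gamma> ?a (chart \<Gamma> e (ereal t)) = ereal \<bar>s - t\<bar>"
      using s1(2) by simp
  qed (use \<open>0 < R\<close> in auto)
qed

end

lemma eventually_germ_filters:
  assumes "\<Phi> \<in> germ_filters L"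
  shows "\<forall>\<^sub>F t in \<Phi>. 0 \<le> t \<and> ereal t \<le> L"
proof -
  consider (r) x where "\<Phi> = at_right x" "0 \<le> x" "ereal x < L"
    | (l) x where "\<Phi> = at_left x" "0 < x" "ereal x \<le> L" | (t) "\<Phi> = at_top" "L = \<infinity>"
    using assms by (auto simp: germ_filters_def split: if_splits)
  then show ?thesis
  proof cases
    case r
    have "\<forall>\<^sub>F t in at_right x. t > x" by (auto simp: eventually_at_filter)
    with eventually_at_right_ereal[OF r(3)] show ?thesis
      unfolding r(1) by eventually_elim (use r in auto)
  next
    case l
    have "\<forall>\<^sub>F t in at_left x. t < x" by (auto simp: eventually_at_filter)
    moreover have "\<forall>\<^sub>F t in at_left x. t > 0"
      using l(2) by (auto simp: eventually_at_left_field)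
    ultimately show ?thesis
      unfolding l(1)
    proof eventually_elim
      case (elim t)
      then have "ereal t \<le> ereal x" by simp
      then show ?case using l(3) elim by (metis less_imp_le order.trans)
    qed
  next
    case t
    then show ?thesis using eventually_ge_at_top[of 0] by simp
  qed
qed

text \<open>
  Continuity at \<open>\<infinity>\<close> is a limit along the reals.
\<close>

lemma continuous_on_ereal_interval:
  fixes g :: "ereal \<Rightarrow> 'a::topological_space"
  assumes real: "continuous_on {t. 0 \<le> t \<and> ereal t \<le> L} (\<lambda>t. g (ereal t))"
    and top: "L = \<infinity> \<Longrightarrow> ((\<lambda>t. g (ereal t)) \<longlongrightarrow> g \<infinity>) at_top"
  shows "continuous_on {0..L} g"
proof -
  have cont: "continuous_on ({0..L} - {\<infinity>}) g"
  proof -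
    have "continuous_on ({0..L} - {\<infinity>}) real_of_ereal"
      by (rule continuous_on_subset[OF continuous_on_real]) auto
    then have "continuous_on ({0..L} - {\<infinity>}) (\<lambda>x. g (ereal (real_of_ereal x)))"
      by (rule continuous_on_compose2[OF real])
         (auto simp: ereal_real real_of_ereal_pos)
    then show ?thesis
      by (rule continuous_on_cong[THEN iffD1, rotated -1]) (auto simp: ereal_real)
  qed
  show ?thesis
  proof (cases "L = \<infinity>")
    case True
    show ?thesis
      unfolding continuous_on_def
    proof
      fix x assume x: "x \<in> {0..L}"
      show "(g \<longlongrightarrow> g x) (at x within {0..L})"
      proof (cases "x = \<infinity>")
        case True
        have "at x within {0..L} = filtermap ereal at_top"
          unfolding True \<open>L = \<infinity>\<close> at_left_PInf[symmetric] by (rule at_within_Icc_at_left) simp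
        then show ?thesis
          using top[OF \<open>L = \<infinity>\<close>] True by (simp add: filterlim_filtermap)
      next
        case False
        then have "at x within {0..L} = at x within ({0..L} - {\<infinity>})"
          by (intro at_within_nhd[of x "- {\<infinity>}"]) auto
        then show ?thesis
          using cont x False by (simp add: continuous_on_def)
      qed
    qed
  next
    case False
    then have "{0..L} - {\<infinity>} = {0..L}" by auto
    then show ?thesis using cont by simp
  qed
qed

lemma eventually_affine_tendsto:
  assumes "int_affine at_top u"
  obtains l where "(u \<longlongrightarrow> l) at_top"
proof -
  obtain a b where ab: "\<forall>\<^sub>F t in at_top. u t = ereal (a + of_int b * t)"
    using assms by (auto simp: int_affine_def)
  have "\<exists>l. ((\<lambda>t. ereal (a + of_int b * t)) \<longlongrightarrow> l) at_top"
  proof -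
    consider "b > 0" | "b = 0" | "b < 0" by linarith
    then show ?thesis
    proof cases
      case 1
      have "filterlim (\<lambda>t. a + of_int b * t) at_top at_top"
        by (rule filterlim_tendsto_add_at_top[OF tendsto_const])
           (use 1 in \<open>auto intro: filterlim_tendsto_pos_mult_at_top[OF tendsto_const] filterlim_ident\<close>)
      then show ?thesis by (metis tendsto_PInfty_eq_at_top)
    next
      case 2
      then show ?thesis by auto
    next
      case 3
      then have "0 < real_of_int (- b)" by simp
      then have "filterlim (\<lambda>t. - a + of_int (- b) * t) at_top at_top"
        by (intro filterlim_tendsto_add_at_top[OF tendsto_const]
            filterlim_tendsto_pos_mult_at_top[OF tendsto_const] filterlim_ident)
      then have "((\<lambda>t. ereal (- a + of_int (- b) * t)) \<longlongrightarrow> \<infinity>) at_top"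
        by (metis tendsto_PInfty_eq_at_top)
      then have "((\<lambda>t. - ereal (- a + of_int (- b) * t)) \<longlongrightarrow> - \<infinity>) at_top"
        by (rule tendsto_uminus_ereal)
      then show ?thesis by (auto simp: algebra_simps)
    qed
  qed
  then show ?thesis using that tendsto_cong[OF ab] by metis
qed

context tropical
begin

lemma fin_points_nonempty: "fin_points \<Gamma> \<noteq> {}"
proof -
  obtain v where v: "v \<in> V" using verts_nonempty by auto
  show ?thesis
  proof (cases "v \<in> inf_points \<Gamma>")
    case True
    then obtain e where e: "e \<in> E" "len \<Gamma> e = \<infinity>" by (rule inf_pointsE)
    then have "chart \<Gamma> e 0 \<in> fin_points \<Gamma>" using chart_fin_iff[of e 0] by auto
    then show ?thesis by blast
  qed (use v verts_subset in \<open>auto simp: fin_points_def\<close>)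
qed

lemma compact_space_curve: "compact_space (curve_top \<Gamma>)"
proof -
  have "compactin (curve_top \<Gamma>) (edge_set \<Gamma> e)" if "e \<in> E" for e
    unfolding edge_set_def
    by (rule image_compactin[OF _ continuous_map_chart[OF that]])
       (simp add: compact_eq_closed)
  then have "compactin (curve_top \<Gamma>) (\<Union> ((\<lambda>v. {v}) ` V \<union> edge_set \<Gamma> ` E))"
    by (intro compactin_Union)
       (use finite_verts finite_edges verts_subset in \<open>auto simp: topspace_curve_top\<close>)
  moreover have "\<Union> ((\<lambda>v. {v}) ` V \<union> edge_set \<Gamma> ` E) = points \<Gamma>"
    by (auto simp: points_def)
  ultimately show ?thesis
    by (simp add: compact_space_def topspace_curve_top)
qed

lemma open_minus_point: "openin (curve_top \<Gamma>) (points \<Gamma> - {y})"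
  unfolding openin_curve_top
proof (intro conjI ballI)
  fix e assume e: "e \<in> E"
  have "{t \<in> {0..len \<Gamma> e}. chart \<Gamma> e t \<in> points \<Gamma> - {y}} = {0..len \<Gamma> e} \<inter> - fibre e y"
    using chart_in_points[OF e] by (auto simp: fibre_def)
  moreover have "open (- fibre e y)"
    using finite_fibre[OF e] by (simp add: finite_imp_closed open_Compl)
  ultimately show "openin (top_of_set {0..len \<Gamma> e}) {t \<in> {0..len \<Gamma> e}. chart \<Gamma> e t \<in> points \<Gamma> - {y}}"
    by (simp add: openin_open_Int)
qed auto

text \<open>
  A property that holds near \<open>a\<close> on each of the finitely many branches of the star of \<open>a\<close>, in terms of
  the length along the branch, holds in a ball around \<open>a\<close>, in terms of the distance.
\<close>

lemma eventually_in_star: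
  assumes a: "a \<in> fin_points \<Gamma>" and Qa: "Q a 0"
    and Q: "\<And>e s. e \<in> E \<Longrightarrow> s \<in> fibre e a \<Longrightarrow>
      \<exists>\<delta>>0. \<forall>t\<in>{0..len \<Gamma> e}. \<bar>s - t\<bar> < ereal \<delta> \<longrightarrow> Q (chart \<Gamma> e t) \<bar>s - t\<bar>"
  obtains r where "0 < r" "star_radius a r" "\<And>y. cdist \<Gamma> a y < ereal r \<Longrightarrow> Q y (cdist \<Gamma> a y)"
proof -
  obtain R where R: "star_radius a R" by (rule star_radius_exists)
  let ?I = "Sigma E (\<lambda>e. fibre e a)"
  have fin: "finite ?I" using finite_edges finite_fibre by auto
  have "\<forall>p\<in>?I. \<exists>\<delta>>0. \<forall>t\<in>{0..len \<Gamma> (fst p)}. \<bar>snd p - t\<bar> < ereal \<delta> \<longrightarrow> Q (chart \<Gamma> (fst p) t) \<bar>snd p - t\<bar>"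
    using Q by auto
  then obtain \<delta> where \<delta>: "\<forall>p\<in>?I. 0 < \<delta> p \<and>
      (\<forall>t\<in>{0..len \<Gamma> (fst p)}. \<bar>snd p - t\<bar> < ereal (\<delta> p) \<longrightarrow> Q (chart \<Gamma> (fst p) t) \<bar>snd p - t\<bar>)"
    by metis
  define r where "r = Min (insert R (\<delta> ` ?I))"
  have r: "0 < r" "r \<le> R" "\<And>p. p \<in> ?I \<Longrightarrow> r \<le> \<delta> p"
    using fin \<delta> R by (auto simp: r_def star_radius_def)
  have star: "star_radius a r" by (rule star_radius_mono[OF R r(1,2)])
  show ?thesis
  proof (rule that[OF r(1) star])
    fix y assume less: "cdist \<Gamma> a y < ereal r"
    then obtain d where d: "walk \<Gamma> a d y" "d < ereal r" by (rule cdist_lessE)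
    from walk_within_star[OF d(1) star d(2)] consider "y = a" |
      e t where "e \<in> E" "t \<in> {0..len \<Gamma> e}" "y = chart \<Gamma> e t" by blast
    then show "Q y (cdist \<Gamma> a y)"
    proof cases
      case 1
      then show ?thesis using Qa fin_points_subset[OF a] by (simp add: cdist_refl)
    next
      case 2
      then obtain s where s: "s \<in> fibre e a" "cdist \<Gamma> a y = \<bar>s - t\<bar>"
        using cdist_within_star[OF a star 2(1,2)] less by blast
      have I: "(e, s) \<in> ?I" using 2 s by auto
      have "\<bar>s - t\<bar> < ereal r" using less s by simp
      also have "ereal r \<le> ereal (\<delta> (e, s))" using r(3)[OF I] by simp
      finally show ?thesis
        using bspec[OF \<delta> I] 2 s by (simp del: atLeastAtMost_iff)
    qed
  qed
qed

text \<open>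
  Near a finite point, the distance induces the topology.
\<close>

lemma ball_in_open:
  assumes a: "a \<in> fin_points \<Gamma>" and U: "openin (curve_top \<Gamma>) U" "a \<in> U"
  obtains r where "0 < r" "star_radius a r" "\<And>y. cdist \<Gamma> a y < ereal r \<Longrightarrow> y \<in> U"
proof -
  have "\<exists>\<delta>>0. \<forall>t\<in>{0..len \<Gamma> e}. \<bar>s - t\<bar> < ereal \<delta> \<longrightarrow> chart \<Gamma> e t \<in> U"
    if es: "e \<in> E" "s \<in> fibre e a" for e s
  proof -
    obtain W where W: "open W" "{t \<in> {0..len \<Gamma> e}. chart \<Gamma> e t \<in> U} = {0..len \<Gamma> e} \<inter> W"
      using U(1) es(1) unfolding openin_curve_top openin_open by blast
    have "s \<in> W" using W(2) es(2) U(2) by (auto simp: fibre_def)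
    obtain r where r: "s = ereal r" using fibre_finite_point[OF a es] by auto
    then obtain \<delta> where \<delta>: "0 < \<delta>" "{s - \<delta> <..< s + \<delta>} \<subseteq> W"
      using ereal_open_cont_interval[OF W(1) \<open>s \<in> W\<close>] by auto
    obtain d where d: "0 < ereal d" "ereal d < \<delta>" using ereal_dense2[OF \<delta>(1)] by auto
    have "chart \<Gamma> e t \<in> U" if t: "t \<in> {0..len \<Gamma> e}" "\<bar>s - t\<bar> < ereal d" for t
    proof -
      have "\<bar>s - t\<bar> < \<delta>" using t(2) d(2) by (rule less_trans)
      then have "t \<in> {s - \<delta> <..< s + \<delta>}"
        using r \<delta>(1) by (cases t; cases \<delta>) auto
      then show ?thesis using \<delta>(2) t(1) W(2) by blast
    qed
    then show ?thesis using d by (intro exI[of _ d]) (auto simp: zero_ereal_def)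
  qed
  from eventually_in_star[of a "\<lambda>y d. y \<in> U", OF a U(2) this] show ?thesis
    using that by blast
qed

section \<open>Rational functions in terms of germs\<close>

text \<open>
  The rational functions other than \<open>-\<infinity>\<close>, without the convention on values outside the curve.
\<close>

definition integral_pl :: "('p \<Rightarrow> ereal) \<Rightarrow> bool" where
  "integral_pl f \<longleftrightarrow> (\<forall>x\<in>fin_points \<Gamma>. \<bar>f x\<bar> \<noteq> \<infinity>) \<and>
     (\<forall>e\<in>E. continuous_on {0..len \<Gamma> e} (\<lambda>t. f (chart \<Gamma> e t)) \<and>
        (\<forall>\<Phi>\<in>germ_filters (len \<Gamma> e). int_affine \<Phi> (\<lambda>t. f (chart \<Gamma> e (ereal t)))))"

lemma integral_pl_finite: "integral_pl f \<Longrightarrow> x \<in> fin_points \<Gamma> \<Longrightarrow> \<bar>f x\<bar> \<noteq> \<infinity>"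
  by (simp add: integral_pl_def)

lemma integral_pl_cong:
  assumes "\<And>x. x \<in> points \<Gamma> \<Longrightarrow> f x = g x"
  shows "integral_pl f \<longleftrightarrow> integral_pl g"
proof -
  have chart: "f (chart \<Gamma> e t) = g (chart \<Gamma> e t)" if "e \<in> E" "t \<in> {0..len \<Gamma> e}" for e t
    using assms[OF chart_in_points[OF that]] .
  have "int_affine \<Phi> (\<lambda>t. f (chart \<Gamma> e (ereal t))) \<longleftrightarrow> int_affine \<Phi> (\<lambda>t. g (chart \<Gamma> e (ereal t)))"
    if "e \<in> E" "\<Phi> \<in> germ_filters (len \<Gamma> e)" for e \<Phi>
    using eventually_germ_filters[OF that(2)]
    by (intro int_affine_cong) (auto elim!: eventually_mono intro!: chart that(1))
  moreover have "continuous_on {0..len \<Gamma> e} (\<lambda>t. f (chart \<Gamma> e t)) \<longleftrightarrow>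
      continuous_on {0..len \<Gamma> e} (\<lambda>t. g (chart \<Gamma> e t))" if "e \<in> E" for e
    by (rule continuous_on_cong[OF HOL.refl]) (rule chart[OF that])
  moreover have "(\<forall>x\<in>fin_points \<Gamma>. \<bar>f x\<bar> \<noteq> \<infinity>) \<longleftrightarrow> (\<forall>x\<in>fin_points \<Gamma>. \<bar>g x\<bar> \<noteq> \<infinity>)"
    using assms fin_points_subset by auto
  ultimately show ?thesis
    unfolding integral_pl_def by auto
qed

lemma integral_pl_restrict [simp]: "integral_pl (restrict f (points \<Gamma>)) \<longleftrightarrow> integral_pl f"
  by (rule integral_pl_cong) simp

lemma rational_functions_eq:
  "rational_functions \<Gamma> = insert (const_fun \<Gamma> (- \<infinity>)) {f \<in> extensional (points \<Gamma>). integral_pl f}"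
proof -
  have "piecewise_affine_on_edge \<Gamma> e f \<longleftrightarrow> pieces 0 (len \<Gamma> e) (\<lambda>t. f (chart \<Gamma> e t))" for e f
    by (simp add: piecewise_affine_on_edge_def pieces_def)
  moreover have "pieces 0 (len \<Gamma> e) (\<lambda>t. f (chart \<Gamma> e t)) \<longleftrightarrow>
      (\<forall>\<Phi>\<in>germ_filters (len \<Gamma> e). int_affine \<Phi> (\<lambda>t. f (chart \<Gamma> e (ereal t))))"
    if "e \<in> E" "continuous_on {0..len \<Gamma> e} (\<lambda>t. f (chart \<Gamma> e t))" for e f
    using pieces_imp_int_affine[of "len \<Gamma> e" "\<lambda>t. f (chart \<Gamma> e t)"] int_affine_imp_pieces[OF len_pos[OF that(1)] that(2)]
    by blast
  ultimately show ?thesis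
    unfolding rational_functions_def continuous_map_curve_euclidean integral_pl_def by auto
qed

lemma integral_pl_imp_continuous: "integral_pl f \<Longrightarrow> continuous_map (curve_top \<Gamma>) euclidean f"
  by (simp add: integral_pl_def continuous_map_curve_euclidean)

lemma integral_pl_const: "integral_pl (\<lambda>x. ereal c)"
  by (simp add: integral_pl_def int_affine_const)

lemma integral_pl_uminus: "integral_pl f \<Longrightarrow> integral_pl (\<lambda>x. - f x)"
  unfolding integral_pl_def
  by (auto intro: int_affine_uminus continuous_on_compose2[OF continuous_uminus_ereal[of UNIV]])

lemma integral_pl_max: "integral_pl f \<Longrightarrow> integral_pl g \<Longrightarrow> integral_pl (\<lambda>x. max (f x) (g x))"
  unfolding integral_pl_def
  by (intro conjI ballI int_affine_max continuous_on_max) (auto split: split_max)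

lemma integral_pl_add_const: 
  assumes "integral_pl f" shows "integral_pl (\<lambda>x. f x + ereal c)"
proof -
  have "continuous_on {0..len \<Gamma> e} (\<lambda>t. f (chart \<Gamma> e t) + ereal c)" if "e \<in> E" for e
    using assms that unfolding integral_pl_def continuous_on_def
    by (auto intro!: tendsto_add_ereal_general tendsto_const)
  then show ?thesis
    using assms unfolding integral_pl_def
    by (auto intro!: int_affine_add int_affine_const)
qed

text \<open>
  The finite points are dense.
\<close>

lemma agree_on_fin_points:
  assumes f: "continuous_map (curve_top \<Gamma>) euclidean (f :: 'p \<Rightarrow> ereal)"
    and g: "continuous_map (curve_top \<Gamma>) euclidean g"
    and eq: "\<And>x. x \<in> fin_points \<Gamma> \<Longrightarrow> f x = g x" and x: "x \<in> points \<Gamma>"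
  shows "f x = g x"
proof (cases "x \<in> fin_points \<Gamma>")
  case False
  then obtain e where e: "e \<in> E" "len \<Gamma> e = \<infinity>" "x = chart \<Gamma> e \<infinity>"
    using x inf_pointsE by (auto simp: fin_points_def)
  have lim: "((\<lambda>t. h (chart \<Gamma> e (ereal t))) \<longlongrightarrow> h x) at_top"
    if "continuous_map (curve_top \<Gamma>) euclidean h" for h :: "'p \<Rightarrow> ereal"
  proof -
    have "continuous_on {0..\<infinity>} (\<lambda>t. h (chart \<Gamma> e t))"
      using that e by (auto simp: continuous_map_curve_euclidean)
    then have "((\<lambda>t. h (chart \<Gamma> e t)) \<longlongrightarrow> h x) (at \<infinity> within {0..\<infinity>})"
      unfolding continuous_on_def e(3) by (rule bspec) simp
    then have "((\<lambda>t. h (chart \<Gamma> e t)) \<longlongrightarrow> h x) (at_left \<infinity>)"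
      by (simp add: at_within_Icc_at_left)
    then show ?thesis by (simp add: at_left_PInf filterlim_filtermap)
  qed
  have ev: "\<forall>\<^sub>F t in at_top. f (chart \<Gamma> e (ereal t)) = g (chart \<Gamma> e (ereal t))"
    using eventually_ge_at_top[of 0]
    by eventually_elim (use e in \<open>auto intro!: eq simp: chart_fin_iff\<close>)
  have "((\<lambda>t. f (chart \<Gamma> e (ereal t))) \<longlongrightarrow> g x) at_top"
    using lim[OF g] by (simp add: tendsto_cong[OF ev])
  then show ?thesis
    by (rule tendsto_unique[OF trivial_limit_at_top_linorder lim[OF f]])
qed (rule eq)

lemma cont_ext_eq:
  assumes "h \<in> extensional (points \<Gamma>)" "continuous_map (curve_top \<Gamma>) euclidean h"
    and "\<And>x. x \<in> fin_points \<Gamma> \<Longrightarrow> h x = u x"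
  shows "cont_ext \<Gamma> u = h"
  unfolding cont_ext_def
proof (rule the_equality)
  fix k assume k: "k \<in> extensional (points \<Gamma>) \<and> continuous_map (curve_top \<Gamma>) euclidean k \<and> (\<forall>x\<in>fin_points \<Gamma>. k x = u x)"
  show "k = h"
  proof (rule extensionalityI[of _ "points \<Gamma>"])
    fix x assume "x \<in> points \<Gamma>"
    then show "k x = h x"
      using agree_on_fin_points[of k h x] k assms by auto
  qed (use k assms in auto)
qed (use assms in auto)

text \<open>
  At a point at infinity, the pointwise sum may be of the form \<open>\<infinity> - \<infinity>\<close>; but along the end the sum of
  two functions is eventually affine, so that it has a limit there.
\<close>

lemma integral_pl_sum_ext:
  assumes f: "integral_pl f" and g: "integral_pl g"
  obtains h where "h \<in> extensional (points \<Gamma>)" "integral_pl h" "\<And>x. x \<in> fin_points \<Gamma> \<Longrightarrow> h x = f x + g x"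
proof -
  let ?u = "\<lambda>e t. f (chart \<Gamma> e (ereal t)) + g (chart \<Gamma> e (ereal t))"
  have germs: "int_affine \<Phi> (?u e)" if "e \<in> E" "\<Phi> \<in> germ_filters (len \<Gamma> e)" for e \<Phi>
    using f g that unfolding integral_pl_def by (auto intro: int_affine_add)
  \<comment> \<open>Only one edge ends at a given point at infinity, so a common limit \<open>l\<close> exists.\<close>
  define lim where "lim x = (SOME l. \<forall>e\<in>E. len \<Gamma> e = \<infinity> \<and> tgt \<Gamma> e = x \<longrightarrow> (?u e \<longlongrightarrow> l) at_top)" for x
  define h where "h = (\<lambda>x\<in>points \<Gamma>. if x \<in> inf_points \<Gamma> then lim x else f x + g x)"
  have lim: "(?u e \<longlongrightarrow> lim (tgt \<Gamma> e)) at_top" if e: "e \<in> E" "len \<Gamma> e = \<infinity>" for e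
  proof -
    have "int_affine at_top (?u e)"
      using germs e by (auto simp: germ_filters_def)
    then obtain l where l: "(?u e \<longlongrightarrow> l) at_top" by (rule eventually_affine_tendsto)
    have "e' = e" if "e' \<in> E" "tgt \<Gamma> e' = tgt \<Gamma> e" for e'
      using infinite_end[OF e that(1), of "len \<Gamma> e'"] that(2) len_pos[OF that(1)] by (simp add: tgt_def)
    then have "\<exists>l. \<forall>e'\<in>E. len \<Gamma> e' = \<infinity> \<and> tgt \<Gamma> e' = tgt \<Gamma> e \<longrightarrow> (?u e' \<longlongrightarrow> l) at_top"
      using l by blast
    from someI_ex[OF this] show ?thesis using e unfolding lim_def by blast
  qed
  have chart: "h (chart \<Gamma> e (ereal t)) = ?u e t" if "e \<in> E" "0 \<le> t" "ereal t \<le> len \<Gamma> e" for e t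
    using that chart_in_points[of e \<Gamma> "ereal t"] by (simp add: h_def chart_inf_iff)
  show ?thesis
  proof (rule that)
    show "h \<in> extensional (points \<Gamma>)" by (simp add: h_def)
    show fin: "h x = f x + g x" if "x \<in> fin_points \<Gamma>" for x
      using that by (simp add: h_def fin_points_def)
    show "integral_pl h"
      unfolding integral_pl_def
    proof (intro conjI ballI)
      fix x assume x: "x \<in> fin_points \<Gamma>"
      then show "\<bar>h x\<bar> \<noteq> \<infinity>"
        using integral_pl_finite[OF f x] integral_pl_finite[OF g x] fin[OF x]
        by (cases "f x"; cases "g x") auto
    next
      fix e assume e: "e \<in> E"
      show "continuous_on {0..len \<Gamma> e} (\<lambda>t. h (chart \<Gamma> e t))"
      proof (rule continuous_on_ereal_interval)
        let ?S = "{t. 0 \<le> t \<and> ereal t \<le> len \<Gamma> e}"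
        have c: "continuous_on ?S (\<lambda>t. k (chart \<Gamma> e (ereal t)))" if "integral_pl k" for k
          using that e unfolding integral_pl_def
          by (intro continuous_on_compose2[of "{0..len \<Gamma> e}" "\<lambda>t. k (chart \<Gamma> e t)" _ ereal])
             (auto intro: continuous_intros)
        have "continuous_on ?S (?u e)"
          unfolding continuous_on_def
        proof (intro ballI tendsto_add_ereal)
          fix t assume t: "t \<in> ?S"
          then have "chart \<Gamma> e (ereal t) \<in> fin_points \<Gamma>" using e by (auto simp: chart_fin_iff)
          then show "\<bar>f (chart \<Gamma> e (ereal t))\<bar> \<noteq> \<infinity>" "\<bar>g (chart \<Gamma> e (ereal t))\<bar> \<noteq> \<infinity>"
            using integral_pl_finite f g by auto
        qed (use c[OF f] c[OF g] in \<open>auto simp: continuous_on_def\<close>)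
        then show "continuous_on ?S (\<lambda>t. h (chart \<Gamma> e (ereal t)))"
          by (rule continuous_on_cong[THEN iffD1, rotated -1]) (use chart e in auto)
      next
        assume inf: "len \<Gamma> e = \<infinity>"
        have "h (chart \<Gamma> e \<infinity>) = lim (tgt \<Gamma> e)"
          using chart_in_points[OF e, of \<infinity>] inf e by (auto simp: h_def chart_inf_iff tgt_def)
        moreover have ev: "\<forall>\<^sub>F t in at_top. h (chart \<Gamma> e (ereal t)) = ?u e t"
          using eventually_ge_at_top[of 0] by eventually_elim (use chart e inf in auto)
        ultimately show "((\<lambda>t. h (chart \<Gamma> e (ereal t))) \<longlongrightarrow> h (chart \<Gamma> e \<infinity>)) at_top"
          using lim[OF e inf] by (simp add: tendsto_cong[OF ev])
      qed
      fix \<Phi> assume \<Phi>: "\<Phi> \<in> germ_filters (len \<Gamma> e)"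
      have ev: "\<forall>\<^sub>F t in \<Phi>. h (chart \<Gamma> e (ereal t)) = ?u e t"
        using eventually_germ_filters[OF \<Phi>] by eventually_elim (use chart e in auto)
      show "int_affine \<Phi> (\<lambda>t. h (chart \<Gamma> e (ereal t)))"
        using germs[OF e \<Phi>] by (simp add: int_affine_cong[OF ev])
    qed
  qed
qed

end

section \<open>Enough rational functions\<close>

lemma Min_insert_image_induct:
  assumes "finite S" "P (\<lambda>t. c)" "\<And>s. s \<in> S \<Longrightarrow> P (F s)"
    and "\<And>g h. P g \<Longrightarrow> P h \<Longrightarrow> P (\<lambda>t. min (g t) (h t))"
  shows "P (\<lambda>t. Min (insert (c :: 'a::linorder) ((\<lambda>s. F s t) ` S)))"
  using assms(1,3)
proof (induction S rule: finite_induct)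
  case (insert s S)
  have "Min (insert c ((\<lambda>s. F s t) ` insert s S)) = min (F s t) (Min (insert c ((\<lambda>s. F s t) ` S)))" for t
  proof -
    have "insert c ((\<lambda>s. F s t) ` insert s S) = insert (F s t) (insert c ((\<lambda>s. F s t) ` S))" by auto
    then show ?thesis using insert(1) by (simp only:) (rule Min_insert, auto)
  qed
  then show ?case using insert assms(4) by auto
qed (use assms(2) in simp)

lemma int_affine_real: "int_affine \<Phi> (\<lambda>t. ereal (a + of_int b * t))"
  unfolding int_affine_def by (intro exI always_eventually) auto

lemma int_affine_abs_diff:
  assumes "\<Phi> \<in> germ_filters L"
  shows "int_affine \<Phi> (\<lambda>t. \<bar>ereal s - ereal t\<bar>)"
proof -
  have "\<bar>ereal s - ereal t\<bar> = max (ereal (s + of_int (- 1) * t)) (ereal (- s + of_int 1 * t))" for t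
    by (simp add: max_def abs_if)
  then show ?thesis
    using int_affine_max[OF assms int_affine_real int_affine_real] by presburger
qed

lemma continuous_on_abs_diff: "continuous_on S (\<lambda>t. \<bar>ereal s - t\<bar>)"
  unfolding continuous_on_def
  by (intro ballI tendsto_abs_ereal tendsto_diff_ereal_general tendsto_const tendsto_ident_at) auto

text \<open>
  The slope \<open>(F - c) / \<sigma>\<close> is continuous and takes finitely many values on a connected set.
\<close>

lemma finitely_many_slopes_imp_affine:
  fixes F :: "real \<Rightarrow> ereal" and K :: "int set"
  assumes "connected S" "S \<noteq> {}" "continuous_on S F" "continuous_on S \<sigma>" "finite K"
    and slope: "\<And>t. t \<in> S \<Longrightarrow> \<sigma> t \<noteq> 0 \<and> (\<exists>k\<in>K. F t = ereal (c + of_int k * \<sigma> t))"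
  shows "\<exists>k::int. \<forall>t\<in>S. F t = ereal (c + of_int k * \<sigma> t)"
proof -
  define q where "q t = (real_of_ereal (F t) - c) / \<sigma> t" for t
  have q: "\<exists>k\<in>K. q t = of_int k \<and> F t = ereal (c + of_int k * \<sigma> t)" if "t \<in> S" for t
    using slope[OF that] by (auto simp: q_def)
  have "continuous_on S (\<lambda>t. real_of_ereal (F t))"
    by (rule continuous_on_compose2[OF continuous_on_real assms(3)]) (use slope in force)
  then have "continuous_on S q"
    unfolding q_def by (intro continuous_intros assms(4)) (use slope in auto)
  moreover have "q ` S \<subseteq> of_int ` K" using q by auto
  then have "finite (q ` S)" using assms(5) finite_subset by blast
  ultimately have "q constant_on S"
    using assms(1) by (intro continuous_finite_range_constant)
  then obtain d where d: "\<And>t. t \<in> S \<Longrightarrow> q t = d" by (auto simp: constant_on_def)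
  obtain t0 where "t0 \<in> S" using assms(2) by auto
  then obtain k where "d = of_int k" using q d by metis
  then have "F t = ereal (c + of_int k * \<sigma> t)" if "t \<in> S" for t
    using q[OF that] d[OF that] by auto
  then show ?thesis by blast
qed

context tropical
begin

text \<open>
  The truncation at a star radius \<open>R\<close> makes the distance from \<open>a\<close> depend on the star of \<open>a\<close> only.
\<close>

definition tent :: "'p \<Rightarrow> real \<Rightarrow> 'p \<Rightarrow> ereal" where
  "tent a R x = min (ereal R) (cdist \<Gamma> a x)"

lemma integral_pl_tent:
  assumes a: "a \<in> fin_points \<Gamma>" and R: "star_radius a R"
  shows "integral_pl (tent a R)"
  unfolding integral_pl_def
proof (intro conjI ballI)
  fix x
  have "0 \<le> tent a R x" "tent a R x \<le> ereal R"
    using R cdist_nonneg[of \<Gamma> a x] by (auto simp: tent_def star_radius_def)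
  then show "\<bar>tent a R x\<bar> \<noteq> \<infinity>" by auto
next
  fix e assume e: "e \<in> E"
  have chart: "tent a R (chart \<Gamma> e t) = Min (insert (ereal R) ((\<lambda>s. \<bar>s - t\<bar>) ` fibre e a))"
    if "t \<in> {0..len \<Gamma> e}" for t
    unfolding tent_def by (rule min_cdist_chart[OF a R e that])
  have fin: "finite (fibre e a)" by (rule finite_fibre[OF e])
  have "continuous_on {0..len \<Gamma> e} (\<lambda>t. Min (insert (ereal R) ((\<lambda>s. \<bar>s - t\<bar>) ` fibre e a)))"
    by (rule Min_insert_image_induct[OF fin])
       (use fibre_finite_point[OF a e] in \<open>auto intro: continuous_on_abs_diff continuous_on_min\<close>)
  then show "continuous_on {0..len \<Gamma> e} (\<lambda>t. tent a R (chart \<Gamma> e t))"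
    by (rule continuous_on_cong[OF HOL.refl, THEN iffD1, rotated]) (simp only: chart)
  fix \<Phi> assume \<Phi>: "\<Phi> \<in> germ_filters (len \<Gamma> e)"
  have ev: "\<forall>\<^sub>F t in \<Phi>. tent a R (chart \<Gamma> e (ereal t)) = Min (insert (ereal R) ((\<lambda>s. \<bar>s - ereal t\<bar>) ` fibre e a))"
    using eventually_germ_filters[OF \<Phi>] by eventually_elim (intro chart, simp)
  have "int_affine \<Phi> (\<lambda>t. Min (insert (ereal R) ((\<lambda>s. \<bar>s - ereal t\<bar>) ` fibre e a)))"
    by (rule Min_insert_image_induct[OF fin])
       (use fibre_finite_point[OF a e] in \<open>auto intro: int_affine_const int_affine_abs_diff[OF \<Phi>] int_affine_min[OF \<Phi>]\<close>)
  then show "int_affine \<Phi> (\<lambda>t. tent a R (chart \<Gamma> e (ereal t)))"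
    by (simp add: int_affine_cong[OF ev])
qed

text \<open>
  The coordinate on an edge of infinite length, which vanishes at the finite end of the edge and is
  extended by zero.  It takes the value \<open>\<infinity>\<close> at the end of this edge.
\<close>

definition end_coord :: "'e \<Rightarrow> 'p \<Rightarrow> ereal" where
  "end_coord e x = (if x \<in> edge_set \<Gamma> e then THE t. t \<in> {0..\<infinity>} \<and> chart \<Gamma> e t = x else 0)"

lemma end_coord_chart:
  assumes "e \<in> E" "len \<Gamma> e = \<infinity>" "0 \<le> t"
  shows "end_coord e (chart \<Gamma> e t) = t"
proof -
  have "(THE u. u \<in> {0..\<infinity>} \<and> chart \<Gamma> e u = chart \<Gamma> e t) = t"
    using infinite_edge_inj[OF assms(1,2)] assms(3) by (intro the_equality) auto
  moreover have "chart \<Gamma> e t \<in> edge_set \<Gamma> e" using assms by (auto simp: edge_set_def)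
  ultimately show ?thesis by (simp add: end_coord_def)
qed

lemma end_coord_other:
  assumes "e \<in> E" "len \<Gamma> e = \<infinity>" "e' \<in> E" "e' \<noteq> e" "t \<in> {0..len \<Gamma> e'}"
  shows "end_coord e (chart \<Gamma> e' t) = 0"
proof (cases "chart \<Gamma> e' t \<in> edge_set \<Gamma> e")
  case True
  then obtain u where u: "u \<in> {0..len \<Gamma> e}" "chart \<Gamma> e' t = chart \<Gamma> e u"
    unfolding edge_set_def by auto
  have "u \<noteq> \<infinity>" using infinite_end[OF assms(1,2,3,5)] u(2) assms(2,4) by (auto simp: tgt_def)
  then have "u = 0"
    using assms(2,4) by (cases rule: chart_eq_cases[OF assms(3,5) assms(1) u]) auto
  then show ?thesis using end_coord_chart[OF assms(1,2), of u] u by simp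
qed (simp add: end_coord_def)

lemma integral_pl_end_coord:
  assumes e: "e \<in> E" "len \<Gamma> e = \<infinity>"
  shows "integral_pl (end_coord e)"
  unfolding integral_pl_def
proof (intro conjI ballI)
  fix x assume x: "x \<in> fin_points \<Gamma>"
  show "\<bar>end_coord e x\<bar> \<noteq> \<infinity>"
  proof (cases "x \<in> edge_set \<Gamma> e")
    case True
    then obtain t where t: "t \<in> {0..len \<Gamma> e}" "x = chart \<Gamma> e t" unfolding edge_set_def by auto
    then have "t \<noteq> \<infinity>" using x chart_fin_iff e by blast
    then show ?thesis using t end_coord_chart[OF e] by auto
  qed (simp add: end_coord_def)
next
  fix e' assume e': "e' \<in> E"
  have *: "continuous_on {0..len \<Gamma> e'} (\<lambda>t. end_coord e (chart \<Gamma> e' t)) \<and>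
    (\<forall>\<Phi>\<in>germ_filters (len \<Gamma> e'). int_affine \<Phi> (\<lambda>t. end_coord e (chart \<Gamma> e' (ereal t))))"
    if g: "\<And>t. t \<in> {0..len \<Gamma> e'} \<Longrightarrow> end_coord e (chart \<Gamma> e' t) = g t"
      "continuous_on {0..len \<Gamma> e'} g" "\<And>\<Phi>. int_affine \<Phi> (\<lambda>t. g (ereal t))" for g
  proof (intro conjI ballI)
    show "continuous_on {0..len \<Gamma> e'} (\<lambda>t. end_coord e (chart \<Gamma> e' t))"
      using g(2) by (rule continuous_on_cong[OF HOL.refl, THEN iffD1, rotated]) (simp only: g(1))
    fix \<Phi> assume \<Phi>: "\<Phi> \<in> germ_filters (len \<Gamma> e')"
    have ev: "\<forall>\<^sub>F t in \<Phi>. end_coord e (chart \<Gamma> e' (ereal t)) = g (ereal t)"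
      using eventually_germ_filters[OF \<Phi>] by eventually_elim (intro g(1), simp)
    show "int_affine \<Phi> (\<lambda>t. end_coord e (chart \<Gamma> e' (ereal t)))"
      using g(3) by (simp add: int_affine_cong[OF ev])
  qed
  have "continuous_on {0..len \<Gamma> e'} (\<lambda>t. end_coord e (chart \<Gamma> e' t)) \<and>
    (\<forall>\<Phi>\<in>germ_filters (len \<Gamma> e'). int_affine \<Phi> (\<lambda>t. end_coord e (chart \<Gamma> e' (ereal t))))"
  proof (cases "e' = e")
    case True
    have "int_affine \<Phi> (\<lambda>t. ereal t)" for \<Phi>
      using int_affine_real[of \<Phi> 0 1] by simp
    then show ?thesis
      using end_coord_chart[OF e] True by (intro *[of "\<lambda>t. t"]) (auto intro: continuous_intros)
  next
    case False
    have "int_affine \<Phi> (\<lambda>t. 0)" for \<Phi>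
      using int_affine_const[of \<Phi> 0] by (simp add: zero_ereal_def)
    then show ?thesis
      using end_coord_other[OF e e' False] by (intro *[of "\<lambda>t. 0"]) auto
  qed
  then show "continuous_on {0..len \<Gamma> e'} (\<lambda>t. end_coord e (chart \<Gamma> e' t))"
    "\<And>\<Phi>. \<Phi> \<in> germ_filters (len \<Gamma> e') \<Longrightarrow> int_affine \<Phi> (\<lambda>t. end_coord e (chart \<Gamma> e' (ereal t)))"
    by blast+
qed

lemma end_coord_walk:
  assumes e: "e \<in> E" "len \<Gamma> e = \<infinity>" and w: "walk \<Gamma> x d y"
  shows "end_coord e y \<le> end_coord e x + d"
  using w
proof (induction rule: walk.induct)
  case (step x d e1 s t)
  have st: "0 \<le> s" "0 \<le> t" using step by auto
  have "end_coord e (chart \<Gamma> e1 t) \<le> end_coord e (chart \<Gamma> e1 s) + \<bar>s - t\<bar>"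
  proof (cases "e1 = e")
    case True
    have "t \<le> s + \<bar>s - t\<bar>" using st by (cases s; cases t) auto
    then show ?thesis using True end_coord_chart[OF e] st by simp
  next
    case False
    then show ?thesis using end_coord_other[OF e step.hyps(2)] step.hyps by simp
  qed
  also have "\<dots> \<le> end_coord e x + d + \<bar>s - t\<bar>" using step.IH by (rule add_right_mono)
  finally show ?case by (simp add: add.assoc)
qed simp

text \<open>
  Ends allow no short cuts: the coordinate of an end changes along a walk by at most the length of the
  walk.
\<close>

lemma cdist_infinite_edge:
  assumes e: "e \<in> E" "len \<Gamma> e = \<infinity>" and "0 \<le> s" "0 \<le> t"
  shows "cdist \<Gamma> (chart \<Gamma> e (ereal s)) (chart \<Gamma> e (ereal t)) = ereal \<bar>s - t\<bar>"
proof (rule antisym)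
  show "cdist \<Gamma> (chart \<Gamma> e (ereal s)) (chart \<Gamma> e (ereal t)) \<le> ereal \<bar>s - t\<bar>"
    using cdist_segment[of e \<Gamma> "ereal s" "ereal t"] assms by simp
  have "ereal \<bar>s - t\<bar> \<le> d" if "walk \<Gamma> (chart \<Gamma> e (ereal s)) d (chart \<Gamma> e (ereal t))" for d
  proof -
    have "ereal t \<le> ereal s + d" "ereal s \<le> ereal t + d"
      using end_coord_walk[OF e that] end_coord_walk[OF e walk_sym[OF that]] end_coord_chart[OF e] assms
      by auto
    then show ?thesis by (cases d) auto
  qed
  then show "ereal \<bar>s - t\<bar> \<le> cdist \<Gamma> (chart \<Gamma> e (ereal s)) (chart \<Gamma> e (ereal t))"
    unfolding cdist_def by (auto intro: Inf_greatest)
qed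

lemma neighbourhood_of_end:
  assumes e: "e \<in> E" "len \<Gamma> e = \<infinity>" and U: "openin (curve_top \<Gamma>) U" "chart \<Gamma> e \<infinity> \<in> U"
  obtains N where "0 \<le> N" "\<And>t. ereal N < t \<Longrightarrow> chart \<Gamma> e t \<in> U"
proof -
  obtain W where W: "open W" "{t \<in> {0..len \<Gamma> e}. chart \<Gamma> e t \<in> U} = {0..len \<Gamma> e} \<inter> W"
    using U(1) e unfolding openin_curve_top openin_open by blast
  have "\<infinity> \<in> {t \<in> {0..len \<Gamma> e}. chart \<Gamma> e t \<in> U}" using U(2) e(2) by simp
  then have "\<infinity> \<in> W" unfolding W(2) by blast
  then obtain N where N: "{ereal N<..} \<subseteq> W" using W(1) open_PInfty by auto
  show ?thesis
  proof (rule that[of "max N 0"])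
    fix t assume "ereal (max N 0) < t"
    then have "t \<in> {0..len \<Gamma> e} \<inter> W" using N e by (cases t) auto
    then show "chart \<Gamma> e t \<in> U" using W(2) by blast
  qed simp
qed

text \<open>
  At a finite point take \<open>r\<close> minus the truncated distance, at a point at infinity the coordinate of its
  end minus a constant.
\<close>

lemma rational_urysohn:
  assumes x: "x \<in> points \<Gamma>" and U: "openin (curve_top \<Gamma>) U" "x \<in> U"
  obtains f where "integral_pl f" "0 < f x" "\<And>y. y \<in> points \<Gamma> \<Longrightarrow> y \<notin> U \<Longrightarrow> f y \<le> 0"
proof (cases "x \<in> fin_points \<Gamma>")
  case True
  obtain r where r: "0 < r" "star_radius x r" "\<And>y. cdist \<Gamma> x y < ereal r \<Longrightarrow> y \<in> U"
    using ball_in_open[OF True U] by blast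
  show ?thesis
  proof (rule that)
    show "integral_pl (\<lambda>y. - tent x r y + ereal r)"
      by (intro integral_pl_add_const integral_pl_uminus integral_pl_tent True r)
    show "0 < - tent x r x + ereal r" using r(1) x by (simp add: tent_def cdist_refl)
    show "- tent x r y + ereal r \<le> 0" if "y \<notin> U" for y
    proof -
      have "\<not> cdist \<Gamma> x y < ereal r" using r(3)[of y] that by blast
      then have "tent x r y = ereal r" by (simp add: tent_def not_less)
      then show ?thesis by simp
    qed
  qed
next
  case False
  then obtain e where e: "e \<in> E" "len \<Gamma> e = \<infinity>" "x = chart \<Gamma> e \<infinity>"
    using x inf_pointsE by (auto simp: fin_points_def)
  obtain N where N: "0 \<le> N" "\<And>t. ereal N < t \<Longrightarrow> chart \<Gamma> e t \<in> U"
    using neighbourhood_of_end[OF e(1,2) U(1)] U(2) e(3) by blast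
  show ?thesis
  proof (rule that)
    show "integral_pl (\<lambda>y. end_coord e y + ereal (- N))"
      by (intro integral_pl_add_const integral_pl_end_coord e)
    show "0 < end_coord e x + ereal (- N)" using e end_coord_chart by simp
    fix y assume y: "y \<in> points \<Gamma>" "y \<notin> U"
    have "end_coord e y \<le> ereal N"
    proof (cases "y \<in> edge_set \<Gamma> e")
      case True
      then obtain t where t: "t \<in> {0..len \<Gamma> e}" "y = chart \<Gamma> e t" unfolding edge_set_def by auto
      then have "\<not> ereal N < t" using N(2)[of t] y(2) by blast
      then show ?thesis using t end_coord_chart[OF e(1,2), of t] by simp
    next
      case False
      then show ?thesis using N by (simp add: end_coord_def)
    qed
    then show "end_coord e y + ereal (- N) \<le> 0"
      by (cases "end_coord e y") auto
  qed
qed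

lemma integral_pl_separates:
  assumes "x \<in> points \<Gamma>" "y \<in> points \<Gamma>" "x \<noteq> y"
  obtains f where "integral_pl f" "f y < f x"
proof -
  obtain f where "integral_pl f" "0 < f x" "f y \<le> 0"
    using rational_urysohn[OF assms(1) open_minus_point[of y]] assms by blast
  then show ?thesis using that by (meson le_less_trans)
qed

lemma Hausdorff_space_curve: "Hausdorff_space (curve_top \<Gamma>)"
  unfolding Hausdorff_space_def topspace_curve_top
proof (intro allI impI)
  fix x y assume xy: "x \<in> points \<Gamma> \<and> y \<in> points \<Gamma> \<and> x \<noteq> y"
  then obtain f where f: "integral_pl f" "f y < f x" using integral_pl_separates[of x y] by blast
  obtain c where c: "f y < c" "c < f x" using dense[OF f(2)] by auto
  have "openin (curve_top \<Gamma>) {z \<in> topspace (curve_top \<Gamma>). f z \<in> A}" if "open A" for A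
    using integral_pl_imp_continuous[OF f(1)] that
    by (intro openin_continuous_map_preimage[of _ euclidean]) auto
  from this[of "{c<..}"] this[of "{..<c}"]
  show "\<exists>U V. openin (curve_top \<Gamma>) U \<and> openin (curve_top \<Gamma>) V \<and> x \<in> U \<and> y \<in> V \<and> disjnt U V"
    using xy c
    by (intro exI[of _ "{z \<in> topspace (curve_top \<Gamma>). f z \<in> {c<..}}"] exI[of _ "{z \<in> topspace (curve_top \<Gamma>). f z \<in> {..<c}}"])
       (auto simp: topspace_curve_top disjnt_def)
qed

text \<open>
  The slopes of the finitely many germs at \<open>a\<close>, turned into a statement about the distance alone.
\<close>

lemma integral_pl_conical:
  assumes f: "integral_pl f" and a: "a \<in> fin_points \<Gamma>"
  shows "\<exists>\<rho> (K :: int set). 0 < \<rho> \<and> star_radius a \<rho> \<and> finite K \<and>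
    (\<forall>y. cdist \<Gamma> a y < ereal \<rho> \<longrightarrow> (\<exists>k\<in>K. f y = f a + ereal (of_int k) * cdist \<Gamma> a y))"
proof -
  let ?I = "Sigma E (\<lambda>e. fibre e a)"
  have fin: "finite ?I" using finite_edges finite_fibre by auto
  have "\<exists>K :: int set. finite K \<and> (\<exists>\<delta>>0. \<forall>t\<in>{0..len \<Gamma> e}. \<bar>s - t\<bar> < ereal \<delta> \<longrightarrow>
      (\<exists>k\<in>K. f (chart \<Gamma> e t) = f a + ereal (of_int k) * \<bar>s - t\<bar>))"
    if e: "e \<in> E" and s: "s \<in> fibre e a" for e s
  proof -
    obtain x where x: "0 \<le> x" "s = ereal x" "ereal x \<le> len \<Gamma> e"
      using fibre_finite_point[OF a e s] by auto
    have fa: "f (chart \<Gamma> e (ereal x)) = f a" using s x by (simp add: fibre_def)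
    then obtain c where c: "f a = ereal c" using integral_pl_finite[OF f a] by (cases "f a") auto
    have cont: "continuous_on {0..len \<Gamma> e} (\<lambda>t. f (chart \<Gamma> e t))"
      using f e by (simp add: integral_pl_def)
    have germ: "int_affine \<Phi> (\<lambda>t. f (chart \<Gamma> e (ereal t)))" if "\<Phi> \<in> germ_filters (len \<Gamma> e)" for \<Phi>
      using f e that by (simp add: integral_pl_def)
    have r: "\<exists>d>0. \<exists>k::int. \<forall>t. x \<le> t \<longrightarrow> ereal t \<le> len \<Gamma> e \<longrightarrow> t < x + d \<longrightarrow>
        f (chart \<Gamma> e (ereal t)) = ereal (c + of_int k * (t - x))"
    proof (cases "ereal x < len \<Gamma> e")
      case True
      then have "at_right x \<in> germ_filters (len \<Gamma> e)" using x by (auto simp: germ_filters_def)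
      from int_affine_at_rightE[OF cont x(1) True germ[OF this]] show ?thesis
        using fa c by (metis real_of_ereal.simps(1))
    next
      case False
      then have len: "len \<Gamma> e = ereal x" using x(3) by simp
      have "f (chart \<Gamma> e (ereal t)) = ereal (c + of_int 0 * (t - x))"
        if "x \<le> t" "ereal t \<le> len \<Gamma> e" for t
      proof -
        have "t = x" using that unfolding len by simp
        then show ?thesis using fa c by simp
      qed
      then show ?thesis by (intro exI[of _ 1] conjI exI[of _ 0]) auto
    qed
    have l: "\<exists>d>0. \<exists>k::int. \<forall>t. 0 \<le> t \<longrightarrow> t \<le> x \<longrightarrow> x - d < t \<longrightarrow>
        f (chart \<Gamma> e (ereal t)) = ereal (c + of_int k * (t - x))"
    proof (cases "0 < x")
      case True
      then have "at_left x \<in> germ_filters (len \<Gamma> e)" using x by (auto simp: germ_filters_def)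
      from int_affine_at_leftE[OF cont True x(3) germ[OF this]] show ?thesis
        using fa c by (metis real_of_ereal.simps(1))
    next
      case False
      then have "x = 0" using x by simp
      then have "f (chart \<Gamma> e (ereal t)) = ereal (c + of_int 0 * (t - x))" if "0 \<le> t" "t \<le> x" for t
        using that fa c by simp
      then show ?thesis by (intro exI[of _ 1] conjI exI[of _ 0]) auto
    qed
    obtain d1 k1 where 1: "0 < d1" "\<And>t. x \<le> t \<Longrightarrow> ereal t \<le> len \<Gamma> e \<Longrightarrow> t < x + d1 \<Longrightarrow>
        f (chart \<Gamma> e (ereal t)) = ereal (c + of_int k1 * (t - x))" using r by blast
    obtain d2 k2 where 2: "0 < d2" "\<And>t. 0 \<le> t \<Longrightarrow> t \<le> x \<Longrightarrow> x - d2 < t \<Longrightarrow>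
        f (chart \<Gamma> e (ereal t)) = ereal (c + of_int k2 * (t - x))" using l by blast
    have "\<exists>k\<in>{k1, - k2}. f (chart \<Gamma> e t) = f a + ereal (of_int k) * \<bar>s - t\<bar>"
      if t: "t \<in> {0..len \<Gamma> e}" "\<bar>s - t\<bar> < ereal (min d1 d2)" for t
    proof -
      obtain u where u: "t = ereal u" "0 \<le> u" "ereal u \<le> len \<Gamma> e" using t x by (cases t) auto
      then have "\<bar>x - u\<bar> < d1" "\<bar>x - u\<bar> < d2" using t x by auto
      then show ?thesis
        using 1(2)[of u] 2(2)[of u] u x c by (cases "x \<le> u") (auto simp: algebra_simps)
    qed
    then show ?thesis
      using 1(1) 2(1) by (intro exI[of _ "{k1, - k2}"] conjI exI[of _ "min d1 d2"]) auto
  qed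
  then obtain K :: "'e \<Rightarrow> ereal \<Rightarrow> int set" where K: "\<And>e s. e \<in> E \<Longrightarrow> s \<in> fibre e a \<Longrightarrow>
      finite (K e s) \<and> (\<exists>\<delta>>0. \<forall>t\<in>{0..len \<Gamma> e}. \<bar>s - t\<bar> < ereal \<delta> \<longrightarrow>
      (\<exists>k\<in>K e s. f (chart \<Gamma> e t) = f a + ereal (of_int k) * \<bar>s - t\<bar>))" by metis
  \<comment> \<open>The slope \<open>0\<close> makes the formula hold at \<open>a\<close> itself even if \<open>a\<close> lies on no edge.\<close>
  define K' where "K' = insert 0 (\<Union>(e, s)\<in>?I. K e s)"
  have "finite K'" using fin K by (auto simp: K'_def)
  have "\<exists>\<delta>>0. \<forall>t\<in>{0..len \<Gamma> e}. \<bar>s - t\<bar> < ereal \<delta> \<longrightarrow>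
      (\<exists>k\<in>K'. f (chart \<Gamma> e t) = f a + ereal (of_int k) * \<bar>s - t\<bar>)" if "e \<in> E" "s \<in> fibre e a" for e s
  proof -
    have "K e s \<subseteq> K'" using that by (auto simp: K'_def)
    then show ?thesis using K[OF that] by blast
  qed
  moreover have "\<exists>k\<in>K'. f a = f a + ereal (of_int k) * 0" by (auto simp: K'_def)
  ultimately obtain r where "0 < r" "star_radius a r"
      "\<And>y. cdist \<Gamma> a y < ereal r \<Longrightarrow> \<exists>k\<in>K'. f y = f a + ereal (of_int k) * cdist \<Gamma> a y"
    using eventually_in_star[of a "\<lambda>y d. \<exists>k\<in>K'. f y = f a + ereal (of_int k) * d", OF a] by blast
  then show ?thesis using \<open>finite K'\<close> by blast
qed

section \<open>Isometries preserve rational functions\<close>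

text \<open>
  All distances from a point at infinity to other points are \<open>\<infinity>\<close>, so preserving distances says nothing
  about which end is mapped where; the topology does.
\<close>

definition isometry :: "('p \<Rightarrow> 'p) \<Rightarrow> bool" where
  "isometry \<phi> \<longleftrightarrow> homeomorphic_map (curve_top \<Gamma>) (curve_top \<Gamma>) \<phi> \<and>
     (\<forall>x\<in>points \<Gamma>. \<forall>y\<in>points \<Gamma>. cdist \<Gamma> (\<phi> x) (\<phi> y) = cdist \<Gamma> x y)"

lemma on_some_edge:
  assumes x: "x \<in> points \<Gamma>" and z: "z \<in> points \<Gamma>" "z \<noteq> x"
  obtains e t where "e \<in> E" "t \<in> {0..len \<Gamma> e}" "x = chart \<Gamma> e t"
proof -
  have vert: "\<exists>e\<in>E. x = src \<Gamma> e \<or> x = tgt \<Gamma> e" if xV: "x \<in> V"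
  proof -
    obtain w where w: "w \<in> V" "w \<noteq> x \<or> (\<exists>e\<in>E. x = src \<Gamma> e)"
      using z(1)
    proof (cases rule: pointsE)
      case 1
      then show ?thesis using that z by blast
    next
      case (2 e t)
      then show ?thesis using that[of "src \<Gamma> e"] src_vert by blast
    qed
    show ?thesis
    proof (cases "w = x")
      case False
      have "(x, w) \<in> (adjacent \<Gamma>)\<^sup>*" by (rule connected[OF xV w(1)])
      then obtain y where "(x, y) \<in> adjacent \<Gamma>"
        using False by (auto elim: converse_rtranclE)
      then show ?thesis by (auto simp: adjacent_def)
    qed (use w in blast)
  qed
  from x show thesis
  proof (cases rule: pointsE)
    case 1
    then obtain e where e: "e \<in> E" "x = src \<Gamma> e \<or> x = tgt \<Gamma> e" using vert by blast
    then show thesis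
      using that[of e 0] that[of e "len \<Gamma> e"] len_pos[OF e(1)] by (auto simp: src_def tgt_def)
  qed (rule that)
qed

text \<open>
  The distance knows the points at infinity, except on a curve with one point, which is finite.
\<close>

lemma inf_points_iff_isolated:
  assumes x: "x \<in> points \<Gamma>" and z: "z \<in> points \<Gamma>" "z \<noteq> x"
  shows "x \<in> inf_points \<Gamma> \<longleftrightarrow> (\<forall>y\<in>points \<Gamma>. y \<noteq> x \<longrightarrow> cdist \<Gamma> x y = \<infinity>)"
proof
  assume iso: "\<forall>y\<in>points \<Gamma>. y \<noteq> x \<longrightarrow> cdist \<Gamma> x y = \<infinity>"
  show "x \<in> inf_points \<Gamma>"
  proof (rule ccontr)
    assume nx: "x \<notin> inf_points \<Gamma>"
    obtain e t where e: "e \<in> E" "t \<in> {0..len \<Gamma> e}" "x = chart \<Gamma> e t"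
      using on_some_edge[OF x z] by blast
    then obtain s where s: "t = ereal s" "0 \<le> s" "ereal s \<le> len \<Gamma> e"
      using nx chart_inf_iff[OF e(1,2)] by (cases t) auto
    obtain \<rho> where \<rho>: "0 < \<rho>" "\<And>t. 0 \<le> t \<Longrightarrow> ereal t \<le> len \<Gamma> e \<Longrightarrow> \<bar>s - t\<bar> < \<rho> \<Longrightarrow>
      cdist \<Gamma> (chart \<Gamma> e (ereal s)) (chart \<Gamma> e (ereal t)) = ereal \<bar>s - t\<bar>"
      using cdist_eq_nearby[OF e(1) s(2,3)] by blast
    obtain u where u: "0 \<le> u" "ereal u \<le> len \<Gamma> e" "\<bar>s - u\<bar> < \<rho>" "u \<noteq> s"
    proof (cases "s = 0")
      case True
      have "0 < min (ereal \<rho>) (len \<Gamma> e)" using \<rho>(1) len_pos[OF e(1)] by simp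
      then obtain u where "0 < ereal u" "ereal u < min (ereal \<rho>) (len \<Gamma> e)"
        using ereal_dense2 by blast
      then show ?thesis using that[of u] True by (auto simp: less_imp_le)
    next
      case False
      define u where "u = max (s - \<rho> / 2) 0"
      have u: "0 \<le> u" "u < s" "\<bar>s - u\<bar> < \<rho>" using False s(2) \<rho>(1) by (auto simp: u_def)
      then have "ereal u \<le> ereal s" by simp
      then have "ereal u \<le> len \<Gamma> e" using s(3) by (rule order.trans)
      then show ?thesis using that[of u] u by simp
    qed
    have d: "cdist \<Gamma> x (chart \<Gamma> e (ereal u)) = ereal \<bar>s - u\<bar>" using \<rho>(2)[OF u(1-3)] e(3) s(1) by simp
    then have "chart \<Gamma> e (ereal u) \<noteq> x" using u(4) x cdist_refl[of x \<Gamma>] by auto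
    moreover have "chart \<Gamma> e (ereal u) \<in> points \<Gamma>" using chart_in_points[of e \<Gamma> "ereal u"] e(1) u by simp
    ultimately show False using iso d by auto
  qed
next
  assume "x \<in> inf_points \<Gamma>"
  then show "\<forall>y\<in>points \<Gamma>. y \<noteq> x \<longrightarrow> cdist \<Gamma> x y = \<infinity>"
    using cdist_infinite[of x] by auto
qed

lemma isometry_bij: "isometry \<phi> \<Longrightarrow> bij_betw \<phi> (points \<Gamma>) (points \<Gamma>)"
  unfolding isometry_def bij_betw_def
  using homeomorphic_imp_injective_map homeomorphic_imp_surjective_map
  by (metis topspace_curve_top)

lemma isometry_inf_points:
  assumes \<phi>: "isometry \<phi>" and x: "x \<in> points \<Gamma>"
  shows "\<phi> x \<in> inf_points \<Gamma> \<longleftrightarrow> x \<in> inf_points \<Gamma>"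
proof (cases "points \<Gamma> = {x}")
  case True
  then show ?thesis using isometry_bij[OF \<phi>] by (auto simp: bij_betw_def)
next
  case False
  then obtain z where z: "z \<in> points \<Gamma>" "z \<noteq> x" using x by auto
  have inj: "inj_on \<phi> (points \<Gamma>)" and im: "\<phi> ` points \<Gamma> = points \<Gamma>"
    using isometry_bij[OF \<phi>] by (auto simp: bij_betw_def)
  have z': "\<phi> z \<in> points \<Gamma>" "\<phi> z \<noteq> \<phi> x" "\<phi> x \<in> points \<Gamma>"
    using imageI[OF z(1), of \<phi>] imageI[OF x, of \<phi>] inj_on_eq_iff[OF inj z(1) x] z(2) im by simp_all
  have "(\<forall>y\<in>points \<Gamma>. y \<noteq> \<phi> x \<longrightarrow> cdist \<Gamma> (\<phi> x) y = \<infinity>) \<longleftrightarrow>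
      (\<forall>y\<in>points \<Gamma>. \<phi> y \<noteq> \<phi> x \<longrightarrow> cdist \<Gamma> (\<phi> x) (\<phi> y) = \<infinity>)"
    by (subst im[symmetric]) blast
  also have "\<dots> \<longleftrightarrow> (\<forall>y\<in>points \<Gamma>. y \<noteq> x \<longrightarrow> cdist \<Gamma> x y = \<infinity>)"
  proof (rule ball_cong[OF HOL.refl])
    fix y assume y: "y \<in> points \<Gamma>"
    have "cdist \<Gamma> (\<phi> x) (\<phi> y) = cdist \<Gamma> x y" using \<phi> x y by (simp add: isometry_def)
    then show "(\<phi> y \<noteq> \<phi> x \<longrightarrow> cdist \<Gamma> (\<phi> x) (\<phi> y) = \<infinity>) \<longleftrightarrow> (y \<noteq> x \<longrightarrow> cdist \<Gamma> x y = \<infinity>)"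
      using inj_on_eq_iff[OF inj y x] by simp
  qed
  finally show ?thesis
    unfolding inf_points_iff_isolated[OF x z] inf_points_iff_isolated[OF z'(3,1,2)] .
qed

lemma isometry_fin_points:
  "isometry \<phi> \<Longrightarrow> x \<in> points \<Gamma> \<Longrightarrow> \<phi> x \<in> fin_points \<Gamma> \<longleftrightarrow> x \<in> fin_points \<Gamma>"
  using isometry_inf_points bij_betwE[OF isometry_bij] by (auto simp: fin_points_def)

text \<open>
  The slope of \<open>f \<circ> \<phi>\<close> on a branch at \<open>a\<close>, measured from \<open>a\<close>, belongs to the finite set of slopes of \<open>f\<close>
  at \<open>\<phi> a\<close>, and it is constant by continuity.  This avoids describing how \<open>\<phi>\<close> permutes branches.
\<close>

lemma isometry_germ:
  assumes f: "integral_pl f" and \<phi>: "isometry \<phi>" and e: "e \<in> E" and x: "0 \<le> x" "ereal x \<le> len \<Gamma> e"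
    and side: "\<Phi> = at_right x \<and> ereal x < len \<Gamma> e \<or> \<Phi> = at_left x \<and> 0 < x"
  shows "int_affine \<Phi> (\<lambda>t. f (\<phi> (chart \<Gamma> e (ereal t))))"
proof -
  let ?F = "\<lambda>t. f (\<phi> (chart \<Gamma> e (ereal t)))" and ?a = "chart \<Gamma> e (ereal x)"
  have a: "?a \<in> fin_points \<Gamma>" "?a \<in> points \<Gamma>"
    using e x chart_fin_iff[of e "ereal x"] fin_points_subset by auto
  have fa: "\<phi> ?a \<in> fin_points \<Gamma>" using isometry_fin_points[OF \<phi> a(2)] a(1) by simp
  then obtain c where c: "f (\<phi> ?a) = ereal c" using integral_pl_finite[OF f] by (metis abs_neq_infinity_cases)
  obtain \<rho>1 where \<rho>1: "0 < \<rho>1" "\<And>t. 0 \<le> t \<Longrightarrow> ereal t \<le> len \<Gamma> e \<Longrightarrow> \<bar>x - t\<bar> < \<rho>1 \<Longrightarrow>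
      cdist \<Gamma> ?a (chart \<Gamma> e (ereal t)) = ereal \<bar>x - t\<bar>"
    using cdist_eq_nearby[OF e x] by blast
  obtain \<rho>2 and K :: "int set" where K: "0 < \<rho>2" "finite K"
    "\<forall>y. cdist \<Gamma> (\<phi> ?a) y < ereal \<rho>2 \<longrightarrow> (\<exists>k\<in>K. f y = f (\<phi> ?a) + ereal (of_int k) * cdist \<Gamma> (\<phi> ?a) y)"
    using integral_pl_conical[OF f fa] by (elim exE conjE)
  define \<rho> where "\<rho> = min \<rho>1 \<rho>2"
  have \<rho>: "0 < \<rho>" using \<rho>1 K by (simp add: \<rho>_def)
  have val: "\<exists>k\<in>K. ?F t = ereal (c + of_int k * \<bar>x - t\<bar>)"
    if t: "0 \<le> t" "ereal t \<le> len \<Gamma> e" "\<bar>x - t\<bar> < \<rho>" for t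
  proof -
    have y: "chart \<Gamma> e (ereal t) \<in> points \<Gamma>" using chart_in_points[of e \<Gamma> "ereal t"] e t by simp
    have "cdist \<Gamma> (\<phi> ?a) (\<phi> (chart \<Gamma> e (ereal t))) = cdist \<Gamma> ?a (chart \<Gamma> e (ereal t))"
      using \<phi> a(2) y by (simp add: isometry_def)
    also have "\<dots> = ereal \<bar>x - t\<bar>" using \<rho>1(2)[OF t(1,2)] t(3) by (simp add: \<rho>_def)
    finally have d: "cdist \<Gamma> (\<phi> ?a) (\<phi> (chart \<Gamma> e (ereal t))) = ereal \<bar>x - t\<bar>" .
    moreover have "\<bar>x - t\<bar> < \<rho>2" using t by (simp add: \<rho>_def)
    ultimately show ?thesis using K(3)[rule_format, of "\<phi> (chart \<Gamma> e (ereal t))"] c by auto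
  qed
  have "continuous_map (curve_top \<Gamma>) (curve_top \<Gamma>) \<phi>"
    using \<phi> homeomorphic_imp_continuous_map by (auto simp: isometry_def)
  then have "continuous_map (curve_top \<Gamma>) euclidean (f \<circ> \<phi>)"
    using integral_pl_imp_continuous[OF f] by (rule continuous_map_compose)
  then have "continuous_on {0..len \<Gamma> e} (\<lambda>t. f (\<phi> (chart \<Gamma> e t)))"
    using e by (simp add: continuous_map_curve_euclidean)
  then have cont: "continuous_on {t. 0 \<le> t \<and> ereal t \<le> len \<Gamma> e} ?F"
    by (rule continuous_on_compose2) (auto intro: continuous_intros)
  obtain S and \<tau> :: int where S: "connected S" "S \<noteq> {}" "S \<subseteq> {t. 0 \<le> t \<and> ereal t \<le> len \<Gamma> e \<and> \<bar>x - t\<bar> < \<rho> \<and> t \<noteq> x}"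
    "\<forall>\<^sub>F t in \<Phi>. t \<in> S" and \<tau>: "\<And>t. t \<in> S \<Longrightarrow> \<bar>x - t\<bar> = of_int \<tau> * (t - x)"
    using side
  proof (elim disjE conjE)
    assume r: "\<Phi> = at_right x" "ereal x < len \<Gamma> e"
    then have "ereal x < min (len \<Gamma> e) (ereal (x + \<rho>))" using \<rho> by simp
    then obtain b where b: "ereal x < ereal b" "ereal b < min (len \<Gamma> e) (ereal (x + \<rho>))"
      using ereal_dense2 by blast
    have "\<forall>\<^sub>F t in at_right x. t \<in> {x<..<b}"
      using b(1) by (auto simp: eventually_at_right_field)
    moreover have "ereal t \<le> len \<Gamma> e" if "t < b" for t
    proof -
      have "ereal t < ereal b" using that by simp
      also have "\<dots> < len \<Gamma> e" using b(2) by simp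
      finally show ?thesis by simp
    qed
    ultimately show ?thesis
      using b x r by (intro that[of "{x<..<b}" 1]) auto
  next
    assume l: "\<Phi> = at_left x" "0 < x"
    have "\<forall>\<^sub>F t in at_left x. t \<in> {max 0 (x - \<rho>)<..<x}"
      using l(2) \<rho> by (auto simp: eventually_at_left_field intro!: exI[of _ "max 0 (x - \<rho>)"])
    moreover have "ereal t \<le> len \<Gamma> e" if "t < x" for t
    proof -
      have "ereal t < ereal x" using that by simp
      also have "\<dots> \<le> len \<Gamma> e" using x(2) by simp
      finally show ?thesis by simp
    qed
    ultimately show ?thesis
      using l \<rho> by (intro that[of "{max 0 (x - \<rho>)<..<x}" "- 1"]) auto
  qed
  have "\<exists>k::int. \<forall>t\<in>S. ?F t = ereal (c + of_int k * \<bar>x - t\<bar>)"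
  proof (rule finitely_many_slopes_imp_affine[OF S(1,2) _ _ K(2)])
    show "continuous_on S ?F" using S(3) by (intro continuous_on_subset[OF cont]) auto
    show "continuous_on S (\<lambda>t. \<bar>x - t\<bar>)" by (intro continuous_intros)
    show "\<bar>x - t\<bar> \<noteq> 0 \<and> (\<exists>k\<in>K. ?F t = ereal (c + of_int k * \<bar>x - t\<bar>))" if "t \<in> S" for t
      using val that S(3) by auto
  qed
  then obtain k :: int where k: "\<And>t. t \<in> S \<Longrightarrow> ?F t = ereal (c + of_int k * \<bar>x - t\<bar>)"
    by (elim exE) (rule that, blast)
  have "?F t = ereal ((c - of_int (k * \<tau>) * x) + of_int (k * \<tau>) * t)" if "t \<in> S" for t
    using k[OF that] \<tau>[OF that] by (simp add: algebra_simps)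
  then have "\<forall>\<^sub>F t in \<Phi>. ?F t = ereal ((c - of_int (k * \<tau>) * x) + of_int (k * \<tau>) * t)"
    using S(4) by (auto elim: eventually_mono)
  then show ?thesis unfolding int_affine_def by blast
qed

text \<open>
  The same idea at an end.  The end is mapped into an end, on which \<open>f\<close> has slope \<open>b\<close>, so the slope of
  \<open>f \<circ> \<phi>\<close> is \<open>b\<close> or \<open>- b\<close> at each point.
\<close>

lemma isometry_germ_end:
  assumes f: "integral_pl f" and \<phi>: "isometry \<phi>" and e: "e \<in> E" "len \<Gamma> e = \<infinity>"
  shows "int_affine at_top (\<lambda>t. f (\<phi> (chart \<Gamma> e (ereal t))))"
proof -
  let ?F = "\<lambda>t. f (\<phi> (chart \<Gamma> e (ereal t)))"
  have hom: "continuous_map (curve_top \<Gamma>) (curve_top \<Gamma>) \<phi>"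
    using \<phi> homeomorphic_imp_continuous_map by (auto simp: isometry_def)
  have "continuous_map (curve_top \<Gamma>) euclidean (f \<circ> \<phi>)"
    using hom integral_pl_imp_continuous[OF f] by (rule continuous_map_compose)
  then have "continuous_on {0..len \<Gamma> e} (\<lambda>t. f (\<phi> (chart \<Gamma> e t)))"
    using e(1) by (simp add: continuous_map_curve_euclidean)
  then have cont: "continuous_on {t. 0 \<le> t \<and> ereal t \<le> len \<Gamma> e} ?F"
    by (rule continuous_on_compose2) (auto intro: continuous_intros)
  have pts: "chart \<Gamma> e t \<in> points \<Gamma>" if "0 \<le> t" for t
    using chart_in_points[OF e(1), of t] e(2) that by simp
  have "\<phi> (chart \<Gamma> e \<infinity>) \<in> inf_points \<Gamma>"
    using isometry_inf_points[OF \<phi> pts[of \<infinity>]] chart_inf_iff[OF e(1), of \<infinity>] e(2) by simp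
  then obtain e' where e': "e' \<in> E" "len \<Gamma> e' = \<infinity>" "\<phi> (chart \<Gamma> e \<infinity>) = chart \<Gamma> e' \<infinity>"
    by (rule inf_pointsE)
  have "int_affine at_top (\<lambda>t. f (chart \<Gamma> e' (ereal t)))"
    using f e' by (auto simp: integral_pl_def germ_filters_def)
  then obtain a b N where N: "\<And>t. N \<le> t \<Longrightarrow> f (chart \<Gamma> e' (ereal t)) = ereal (a + of_int b * t)"
    by (auto simp: int_affine_def eventually_at_top_linorder)
  \<comment> \<open>Beyond \<open>max N 0\<close> on the end of \<open>e'\<close> the formula for \<open>f\<close> holds, and the coordinate is not the default \<open>0\<close>.\<close>
  define U where "U = {y \<in> points \<Gamma>. ereal (max N 0) < end_coord e' y}"
  have "openin (curve_top \<Gamma>) {y \<in> topspace (curve_top \<Gamma>). end_coord e' y \<in> {ereal (max N 0)<..}}"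
    using integral_pl_imp_continuous[OF integral_pl_end_coord[OF e'(1,2)]]
    by (intro openin_continuous_map_preimage[of _ euclidean]) auto
  then have U: "openin (curve_top \<Gamma>) U" by (simp add: U_def topspace_curve_top)
  have UE: "\<exists>u. y = chart \<Gamma> e' (ereal u) \<and> max N 0 < u" if y: "y \<in> U" "y \<in> fin_points \<Gamma>" for y
  proof -
    have "y \<in> edge_set \<Gamma> e'" using y(1) by (auto simp: U_def end_coord_def split: if_splits)
    then obtain t where t: "t \<in> {0..len \<Gamma> e'}" "y = chart \<Gamma> e' t" by (auto simp: edge_set_def)
    then obtain u where "t = ereal u" using y(2) chart_fin_iff[OF e'(1)] by (cases t) auto
    then show ?thesis using t y(1) end_coord_chart[OF e'(1,2), of t] by (auto simp: U_def)
  qed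
  have "openin (curve_top \<Gamma>) {x \<in> topspace (curve_top \<Gamma>). \<phi> x \<in> U}"
    using hom U by (rule openin_continuous_map_preimage)
  moreover have "chart \<Gamma> e' \<infinity> \<in> U"
    using end_coord_chart[OF e'(1,2), of \<infinity>] chart_in_points[OF e'(1), of \<infinity>] e'(2) by (simp add: U_def)
  ultimately obtain M where M: "0 \<le> M" "\<And>t. ereal M < t \<Longrightarrow> chart \<Gamma> e t \<in> {x \<in> topspace (curve_top \<Gamma>). \<phi> x \<in> U}"
    using neighbourhood_of_end[OF e, of "{x \<in> topspace (curve_top \<Gamma>). \<phi> x \<in> U}"] pts[of \<infinity>] e'(3)
    by (auto simp: topspace_curve_top)
  have img: "\<exists>u. \<phi> (chart \<Gamma> e (ereal t)) = chart \<Gamma> e' (ereal u) \<and> max N 0 < u" if "M < t" for t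
  proof (rule UE)
    show "\<phi> (chart \<Gamma> e (ereal t)) \<in> U" using M(2)[of "ereal t"] that by simp
    show "\<phi> (chart \<Gamma> e (ereal t)) \<in> fin_points \<Gamma>"
      using isometry_fin_points[OF \<phi> pts] chart_fin_iff[OF e(1)] e(2) that M(1) by simp
  qed
  \<comment> \<open>A base point on the end of \<open>e\<close> from which distances are measured.\<close>
  define m where "m = M + 1"
  obtain u0 where u0: "\<phi> (chart \<Gamma> e (ereal m)) = chart \<Gamma> e' (ereal u0)" "max N 0 < u0"
    using img[of m] by (auto simp: m_def)
  have val: "\<exists>k\<in>{b, - b}. ?F t = ereal ((a + of_int b * u0) + of_int k * (t - m))" if t: "m < t" for t
  proof -
    obtain u where u: "\<phi> (chart \<Gamma> e (ereal t)) = chart \<Gamma> e' (ereal u)" "max N 0 < u"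
      using img[of t] t by (auto simp: m_def)
    have "ereal \<bar>u0 - u\<bar> = cdist \<Gamma> (chart \<Gamma> e' (ereal u0)) (chart \<Gamma> e' (ereal u))"
      using cdist_infinite_edge[OF e'(1,2), of u0 u] u u0 by simp
    also have "\<dots> = cdist \<Gamma> (\<phi> (chart \<Gamma> e (ereal m))) (\<phi> (chart \<Gamma> e (ereal t)))"
      using u u0 by simp
    also have "\<dots> = cdist \<Gamma> (chart \<Gamma> e (ereal m)) (chart \<Gamma> e (ereal t))"
      using \<phi> pts[of "ereal m"] pts[of "ereal t"] t M(1) by (simp add: isometry_def m_def)
    also have "\<dots> = ereal \<bar>m - t\<bar>"
      using cdist_infinite_edge[OF e, of m t] t M(1) by (simp add: m_def)
    finally have "u = u0 + (t - m) \<or> u = u0 - (t - m)" using t by auto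
    then show ?thesis
    proof
      assume eq: "u = u0 + (t - m)"
      have "a + of_int b * u = a + of_int b * u0 + of_int b * (t - m)"
        unfolding eq by (simp add: algebra_simps)
      then show ?thesis using N[of u] u by simp
    next
      assume eq: "u = u0 - (t - m)"
      have "a + of_int b * u = a + of_int b * u0 + of_int (- b) * (t - m)"
        unfolding eq by (simp add: algebra_simps)
      then show ?thesis using N[of u] u by simp
    qed
  qed
  have "\<exists>k::int. \<forall>t\<in>{m<..}. ?F t = ereal ((a + of_int b * u0) + of_int k * (t - m))"
  proof (rule finitely_many_slopes_imp_affine[of "{m<..}" ?F "\<lambda>t. t - m" "{b, - b}"])
    show "continuous_on {m<..} ?F"
      using M(1) e(2) by (intro continuous_on_subset[OF cont]) (auto simp: m_def)
    show "continuous_on {m<..} (\<lambda>t. t - m)" by (intro continuous_intros)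
    show "t - m \<noteq> 0 \<and> (\<exists>k\<in>{b, - b}. ?F t = ereal (a + of_int b * u0 + of_int k * (t - m)))"
      if "t \<in> {m<..}" for t
      using val[of t] that by auto
  qed auto
  then obtain k :: int where k: "\<And>t. t \<in> {m<..} \<Longrightarrow> ?F t = ereal ((a + of_int b * u0) + of_int k * (t - m))"
    by (elim exE) (rule that, blast)
  have "\<forall>\<^sub>F t in at_top. ?F t = ereal ((a + of_int b * u0 - of_int k * m) + of_int k * t)"
    using eventually_gt_at_top[of m] by eventually_elim (use k in \<open>auto simp: algebra_simps\<close>)
  then show ?thesis unfolding int_affine_def by blast
qed

lemma integral_pl_isometry:
  assumes f: "integral_pl f" and \<phi>: "isometry \<phi>"
  shows "integral_pl (f \<circ> \<phi>)"
  unfolding integral_pl_def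
proof (intro conjI ballI)
  fix x assume "x \<in> fin_points \<Gamma>"
  then show "\<bar>(f \<circ> \<phi>) x\<bar> \<noteq> \<infinity>"
    using isometry_fin_points[OF \<phi> fin_points_subset] integral_pl_finite[OF f] by simp
next
  fix e assume e: "e \<in> E"
  have "continuous_map (curve_top \<Gamma>) (curve_top \<Gamma>) \<phi>"
    using \<phi> homeomorphic_imp_continuous_map by (auto simp: isometry_def)
  then have "continuous_map (curve_top \<Gamma>) euclidean (f \<circ> \<phi>)"
    using integral_pl_imp_continuous[OF f] by (rule continuous_map_compose)
  then show "continuous_on {0..len \<Gamma> e} (\<lambda>t. (f \<circ> \<phi>) (chart \<Gamma> e t))"
    using e by (simp add: continuous_map_curve_euclidean)
  fix \<Phi> assume "\<Phi> \<in> germ_filters (len \<Gamma> e)"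
  then consider (r) x where "\<Phi> = at_right x" "0 \<le> x" "ereal x < len \<Gamma> e"
    | (l) x where "\<Phi> = at_left x" "0 < x" "ereal x \<le> len \<Gamma> e" | (t) "\<Phi> = at_top" "len \<Gamma> e = \<infinity>"
    by (auto simp: germ_filters_def split: if_splits)
  then show "int_affine \<Phi> (\<lambda>t. (f \<circ> \<phi>) (chart \<Gamma> e (ereal t)))"
    unfolding comp_apply
  proof cases
    case r
    then show "int_affine \<Phi> (\<lambda>t. f (\<phi> (chart \<Gamma> e (ereal t))))"
      by (intro isometry_germ[OF f \<phi> e, of x]) auto
  next
    case l
    then show "int_affine \<Phi> (\<lambda>t. f (\<phi> (chart \<Gamma> e (ereal t))))"
      by (intro isometry_germ[OF f \<phi> e, of x]) auto
  next
    case t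
    then show "int_affine \<Phi> (\<lambda>t. f (\<phi> (chart \<Gamma> e (ereal t))))"
      using isometry_germ_end[OF f \<phi> e] by simp
  qed
qed

section \<open>The semifield of rational functions and its automorphism group\<close>

definition pl_functions :: "('p \<Rightarrow> ereal) set" where
  "pl_functions = {f \<in> extensional (points \<Gamma>). integral_pl f}"

abbreviation zero_fun :: "'p \<Rightarrow> ereal" where
  "zero_fun \<equiv> const_fun \<Gamma> (- \<infinity>)"

lemma carrier_Rat: "carrier (Rat \<Gamma>) = insert zero_fun pl_functions"
  by (simp add: Rat_def rational_functions_eq pl_functions_def)

lemma zero_fun_not_pl: "zero_fun \<notin> pl_functions"
proof
  assume *: "zero_fun \<in> pl_functions"
  obtain x where x: "x \<in> fin_points \<Gamma>" using fin_points_nonempty by auto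
  then show False
    using * integral_pl_finite[of zero_fun x] fin_points_subset by (auto simp: pl_functions_def const_fun_def)
qed

lemma restrict_pl: "integral_pl f \<Longrightarrow> restrict f (points \<Gamma>) \<in> pl_functions"
  by (simp add: pl_functions_def)

lemma const_fun_pl: "const_fun \<Gamma> (ereal c) \<in> pl_functions"
  unfolding const_fun_def by (rule restrict_pl) (rule integral_pl_const)

lemma const_fun_carrier: "t \<noteq> \<infinity> \<Longrightarrow> const_fun \<Gamma> t \<in> carrier (Rat \<Gamma>)"
  by (cases t) (auto simp: carrier_Rat const_fun_pl)

lemma carrier_extensional: "f \<in> carrier (Rat \<Gamma>) \<Longrightarrow> f \<in> extensional (points \<Gamma>)"
  by (auto simp: carrier_Rat pl_functions_def const_fun_def)

lemma carrier_continuous: "f \<in> carrier (Rat \<Gamma>) \<Longrightarrow> continuous_map (curve_top \<Gamma>) euclidean f"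
proof -
  have "continuous_map (curve_top \<Gamma>) euclidean zero_fun"
    by (rule continuous_map_eq[of _ _ "\<lambda>x. - \<infinity>"]) (auto simp: const_fun_def topspace_curve_top)
  then show "f \<in> carrier (Rat \<Gamma>) \<Longrightarrow> ?thesis"
    by (auto simp: carrier_Rat pl_functions_def intro: integral_pl_imp_continuous)
qed

lemma Rat_add:
  assumes "f \<in> carrier (Rat \<Gamma>)" "g \<in> carrier (Rat \<Gamma>)"
  shows "f \<oplus>\<^bsub>Rat \<Gamma>\<^esub> g = (\<lambda>x\<in>points \<Gamma>. max (f x) (g x))"
proof -
  have "continuous_map (curve_top \<Gamma>) euclidean (\<lambda>x. max (f x) (g x))"
    using carrier_continuous[OF assms(1)] carrier_continuous[OF assms(2)]
    unfolding continuous_map_curve_euclidean by (auto intro: continuous_on_max)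
  then have "continuous_map (curve_top \<Gamma>) euclidean (\<lambda>x\<in>points \<Gamma>. max (f x) (g x))"
    by (rule continuous_map_eq) (auto simp: topspace_curve_top)
  then have "cont_ext \<Gamma> (\<lambda>x. max (f x) (g x)) = (\<lambda>x\<in>points \<Gamma>. max (f x) (g x))"
    by (intro cont_ext_eq) (auto simp: fin_points_subset)
  then show ?thesis by (simp add: Rat_def)
qed

lemma Rat_add_pl:
  "f \<in> pl_functions \<Longrightarrow> g \<in> pl_functions \<Longrightarrow> (\<lambda>x\<in>points \<Gamma>. max (f x) (g x)) \<in> pl_functions"
  by (rule restrict_pl) (auto simp: pl_functions_def intro: integral_pl_max)

lemma Rat_add_closed:
  assumes "f \<in> carrier (Rat \<Gamma>)" "g \<in> carrier (Rat \<Gamma>)"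
  shows "f \<oplus>\<^bsub>Rat \<Gamma>\<^esub> g \<in> carrier (Rat \<Gamma>)"
proof -
  have z: "(\<lambda>x\<in>points \<Gamma>. max (f x) (g x)) \<in> carrier (Rat \<Gamma>)"
    if "f = zero_fun" "g \<in> carrier (Rat \<Gamma>)" for f g :: "'p \<Rightarrow> ereal"
  proof -
    have "(\<lambda>x\<in>points \<Gamma>. max (f x) (g x)) = g"
      using that(1) carrier_extensional[OF that(2)] by (auto simp: const_fun_def extensional_def restrict_def fun_eq_iff)
    then show ?thesis using that by simp
  qed
  show ?thesis
    unfolding Rat_add[OF assms]
    using assms z[of f g] z[of g f] Rat_add_pl[of f g]
    by (auto simp: carrier_Rat max.commute)
qed

lemma Rat_mult_eqI:
  assumes "h \<in> carrier (Rat \<Gamma>)" "\<And>x. x \<in> fin_points \<Gamma> \<Longrightarrow> h x = f x + g x"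
  shows "f \<otimes>\<^bsub>Rat \<Gamma>\<^esub> g = h"
proof -
  have "cont_ext \<Gamma> (\<lambda>x. f x + g x) = h"
    using assms by (intro cont_ext_eq carrier_extensional carrier_continuous)
  then show ?thesis by (simp add: Rat_def)
qed

lemma Rat_mult_ex:
  assumes "f \<in> carrier (Rat \<Gamma>)" "g \<in> carrier (Rat \<Gamma>)"
  shows "\<exists>h\<in>carrier (Rat \<Gamma>). \<forall>x\<in>fin_points \<Gamma>. h x = f x + g x"
proof -
  have fin: "f x \<noteq> \<infinity>" if "f \<in> carrier (Rat \<Gamma>)" "x \<in> fin_points \<Gamma>" for f x
    using that integral_pl_finite[of f x] fin_points_subset[of x]
    by (auto simp: carrier_Rat pl_functions_def const_fun_def)
  show ?thesis
  proof (cases "f \<in> pl_functions \<and> g \<in> pl_functions")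
    case True
    then obtain h where "h \<in> extensional (points \<Gamma>)" "integral_pl h" "\<And>x. x \<in> fin_points \<Gamma> \<Longrightarrow> h x = f x + g x"
      using integral_pl_sum_ext[of f g] by (auto simp: pl_functions_def)
    then show ?thesis by (intro bexI[of _ h]) (auto simp: carrier_Rat pl_functions_def)
  next
    case False
    then have "f = zero_fun \<or> g = zero_fun" using assms by (auto simp: carrier_Rat)
    then have "zero_fun x = f x + g x" if "x \<in> fin_points \<Gamma>" for x
      using fin[OF assms(1) that] fin[OF assms(2) that] fin_points_subset[OF that]
      by (auto simp: const_fun_def)
    then show ?thesis by (intro bexI[of _ zero_fun]) (auto simp: carrier_Rat)
  qed
qed

lemma Rat_mult:
  assumes "f \<in> carrier (Rat \<Gamma>)" "g \<in> carrier (Rat \<Gamma>)"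
  shows "f \<otimes>\<^bsub>Rat \<Gamma>\<^esub> g \<in> carrier (Rat \<Gamma>)"
    and "x \<in> fin_points \<Gamma> \<Longrightarrow> (f \<otimes>\<^bsub>Rat \<Gamma>\<^esub> g) x = f x + g x"
proof -
  obtain h where h: "h \<in> carrier (Rat \<Gamma>)" "\<forall>x\<in>fin_points \<Gamma>. h x = f x + g x"
    using Rat_mult_ex[OF assms] by blast
  then have "f \<otimes>\<^bsub>Rat \<Gamma>\<^esub> g = h" by (intro Rat_mult_eqI) auto
  then show "f \<otimes>\<^bsub>Rat \<Gamma>\<^esub> g \<in> carrier (Rat \<Gamma>)"
    "x \<in> fin_points \<Gamma> \<Longrightarrow> (f \<otimes>\<^bsub>Rat \<Gamma>\<^esub> g) x = f x + g x" using h by auto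
qed

lemma Rat_one: "\<one>\<^bsub>Rat \<Gamma>\<^esub> = const_fun \<Gamma> 0" and Rat_zero: "\<zero>\<^bsub>Rat \<Gamma>\<^esub> = zero_fun"
  by (simp_all add: Rat_def)

end

text \<open>
  The inverse of a bijective homomorphism is a homomorphism because the carrier is closed under the
  operations.
\<close>

lemma group_alg_aut:
  fixes R (structure)
  assumes one: "\<one> \<in> carrier R" and zero: "\<zero> \<in> carrier R"
    and mult: "\<And>a b. a \<in> carrier R \<Longrightarrow> b \<in> carrier R \<Longrightarrow> a \<otimes> b \<in> carrier R"
    and add: "\<And>a b. a \<in> carrier R \<Longrightarrow> b \<in> carrier R \<Longrightarrow> a \<oplus> b \<in> carrier R"
    and \<iota>: "\<And>t. t \<in> carrier T \<Longrightarrow> \<iota> t \<in> carrier R"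
  shows "group (alg_aut T R \<iota>)"
proof (rule groupI)
  let ?G = "alg_aut T R \<iota>"
  have hom: "h \<in> semiring_hom R R \<longleftrightarrow> h \<in> carrier R \<rightarrow> carrier R \<and> h \<one> = \<one> \<and> h \<zero> = \<zero> \<and>
      (\<forall>a\<in>carrier R. \<forall>b\<in>carrier R. h (a \<otimes> b) = h a \<otimes> h b \<and> h (a \<oplus> b) = h a \<oplus> h b)" for h
    by (auto simp: semiring_hom_def ring_hom_def)
  have carrier: "h \<in> carrier ?G \<longleftrightarrow> h \<in> semiring_hom R R \<and> h \<in> extensional (carrier R) \<and>
      bij_betw h (carrier R) (carrier R) \<and> (\<forall>t\<in>carrier T. h (\<iota> t) = \<iota> t)" for h
    by (auto simp: alg_aut_def)
  note [simp] = alg_aut_def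
  fix x y assume x: "x \<in> carrier ?G" and y: "y \<in> carrier ?G"
  have "x a \<in> carrier R" "y a \<in> carrier R" if "a \<in> carrier R" for a
    using x y that unfolding carrier hom by auto
  then show "x \<otimes>\<^bsub>?G\<^esub> y \<in> carrier ?G"
    using x y unfolding carrier hom
    by (auto simp: compose_eq one zero mult add \<iota> intro!: compose_extensional bij_betw_compose)
next
  let ?G = "alg_aut T R \<iota>"
  show "\<one>\<^bsub>?G\<^esub> \<in> carrier ?G"
    by (auto simp: alg_aut_def semiring_hom_def ring_hom_def one zero mult add \<iota> bij_betw_def inj_on_def)
  fix x assume x: "x \<in> carrier ?G"
  show "\<one>\<^bsub>?G\<^esub> \<otimes>\<^bsub>?G\<^esub> x = x"
    using x by (auto simp: alg_aut_def semiring_hom_def ring_hom_def Id_compose)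
  define y where "y = restrict (inv_into (carrier R) x) (carrier R)"
  have bij: "bij_betw x (carrier R) (carrier R)" using x by (auto simp: alg_aut_def)
  then have bij': "bij_betw y (carrier R) (carrier R)"
    unfolding y_def by (simp add: bij_betw_inv_into)
  have xc: "x a \<in> carrier R" and yc: "y a \<in> carrier R" and xy: "x (y a) = a" and yx: "y (x a) = a"
    if "a \<in> carrier R" for a
    using that bij bij' bij_betw_inv_into_right[OF bij that] bij_betw_inv_into_left[OF bij that]
    by (auto simp: y_def dest: bij_betwE)
  have hx: "x \<one> = \<one>" "x \<zero> = \<zero>" "\<And>a b. a \<in> carrier R \<Longrightarrow> b \<in> carrier R \<Longrightarrow> x (a \<otimes> b) = x a \<otimes> x b"
    "\<And>a b. a \<in> carrier R \<Longrightarrow> b \<in> carrier R \<Longrightarrow> x (a \<oplus> b) = x a \<oplus> x b"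
    "\<And>t. t \<in> carrier T \<Longrightarrow> x (\<iota> t) = \<iota> t"
    using x by (auto simp: alg_aut_def semiring_hom_def ring_hom_def)
  have "y \<one> = \<one>" "y \<zero> = \<zero>" using yx[OF one] yx[OF zero] hx by auto
  moreover have "y (a \<otimes> b) = y a \<otimes> y b" "y (a \<oplus> b) = y a \<oplus> y b" if "a \<in> carrier R" "b \<in> carrier R" for a b
    using yx[OF mult[OF yc yc]] yx[OF add[OF yc yc]] hx(3,4)[OF yc yc] xy that by metis+
  moreover have "y (\<iota> t) = \<iota> t" if "t \<in> carrier T" for t using yx[OF \<iota>[OF that]] hx(5)[OF that] by simp
  ultimately have "y \<in> carrier ?G"
    using bij' yc by (auto simp: alg_aut_def semiring_hom_def ring_hom_def y_def)
  moreover have "compose (carrier R) y x = (\<lambda>f\<in>carrier R. f)"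
    using yx by (auto simp: compose_def restrict_def fun_eq_iff)
  ultimately show "\<exists>y\<in>carrier ?G. y \<otimes>\<^bsub>?G\<^esub> x = \<one>\<^bsub>?G\<^esub>"
    by (auto simp: alg_aut_def)
next
  let ?G = "alg_aut T R \<iota>"
  fix x y z assume "x \<in> carrier ?G" "y \<in> carrier ?G" "z \<in> carrier ?G"
  then show "x \<otimes>\<^bsub>?G\<^esub> y \<otimes>\<^bsub>?G\<^esub> z = x \<otimes>\<^bsub>?G\<^esub> (y \<otimes>\<^bsub>?G\<^esub> z)"
    by (auto simp: alg_aut_def semiring_hom_def ring_hom_def intro!: compose_assoc[symmetric])
qed

context tropical
begin

lemma group_rat_aut: "group (rat_aut \<Gamma>)"
  unfolding rat_aut_def
  by (rule group_alg_aut)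
     (auto simp: Rat_one Rat_zero Rat_mult(1) Rat_add_closed tropical_semifield_def const_fun_carrier)

lemma rat_aut_iff:
  "\<psi> \<in> carrier (rat_aut \<Gamma>) \<longleftrightarrow> \<psi> \<in> extensional (carrier (Rat \<Gamma>)) \<and>
     bij_betw \<psi> (carrier (Rat \<Gamma>)) (carrier (Rat \<Gamma>)) \<and>
     (\<forall>f\<in>carrier (Rat \<Gamma>). \<forall>g\<in>carrier (Rat \<Gamma>). \<psi> (f \<otimes>\<^bsub>Rat \<Gamma>\<^esub> g) = \<psi> f \<otimes>\<^bsub>Rat \<Gamma>\<^esub> \<psi> g \<and>
        \<psi> (f \<oplus>\<^bsub>Rat \<Gamma>\<^esub> g) = \<psi> f \<oplus>\<^bsub>Rat \<Gamma>\<^esub> \<psi> g) \<and>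
     (\<forall>t. t \<noteq> \<infinity> \<longrightarrow> \<psi> (const_fun \<Gamma> t) = const_fun \<Gamma> t)"
proof -
  have "\<psi> \<in> carrier (Rat \<Gamma>) \<rightarrow> carrier (Rat \<Gamma>)" if "bij_betw \<psi> (carrier (Rat \<Gamma>)) (carrier (Rat \<Gamma>))"
    using that bij_betw_imp_funcset by auto
  then show ?thesis
    by (auto simp: rat_aut_def alg_aut_def semiring_hom_def ring_hom_def tropical_semifield_def Rat_one Rat_zero)
qed

section \<open>Automorphisms are compositions with isometries\<close>

context
  fixes \<psi> assumes \<psi>: "\<psi> \<in> carrier (rat_aut \<Gamma>)"
begin

lemma aut_closed: "f \<in> carrier (Rat \<Gamma>) \<Longrightarrow> \<psi> f \<in> carrier (Rat \<Gamma>)"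
  using \<psi> by (auto simp: rat_aut_iff dest: bij_betwE)

lemma aut_const: "t \<noteq> \<infinity> \<Longrightarrow> \<psi> (const_fun \<Gamma> t) = const_fun \<Gamma> t"
  using \<psi> by (auto simp: rat_aut_iff)

lemma aut_max:
  assumes "f \<in> carrier (Rat \<Gamma>)" "g \<in> carrier (Rat \<Gamma>)" "x \<in> points \<Gamma>"
  shows "\<psi> (\<lambda>x\<in>points \<Gamma>. max (f x) (g x)) x = max (\<psi> f x) (\<psi> g x)"
proof -
  have "\<psi> (f \<oplus>\<^bsub>Rat \<Gamma>\<^esub> g) = \<psi> f \<oplus>\<^bsub>Rat \<Gamma>\<^esub> \<psi> g"
    using \<psi> assms by (auto simp: rat_aut_iff)
  then show ?thesis
    using Rat_add[OF assms(1,2)] Rat_add[OF aut_closed[OF assms(1)] aut_closed[OF assms(2)]] assms(3)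
    by simp
qed

text \<open>
  The order is algebraic: \<open>f \<le> g\<close> means \<open>f \<oplus> g = g\<close>.
\<close>

lemma aut_mono:
  assumes "f \<in> carrier (Rat \<Gamma>)" "g \<in> carrier (Rat \<Gamma>)" "\<And>x. x \<in> points \<Gamma> \<Longrightarrow> f x \<le> g x" "x \<in> points \<Gamma>"
  shows "\<psi> f x \<le> \<psi> g x"
proof -
  have "(\<lambda>x\<in>points \<Gamma>. max (f x) (g x)) = g"
    using assms(3) carrier_extensional[OF assms(2)]
    by (auto simp: fun_eq_iff restrict_def extensional_def max_def)
  then show ?thesis using aut_max[OF assms(1,2,4)] by (metis max.cobounded1)
qed

lemma aut_sum:
  assumes "f \<in> carrier (Rat \<Gamma>)" "g \<in> carrier (Rat \<Gamma>)" "h \<in> carrier (Rat \<Gamma>)"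
    and "\<And>x. x \<in> fin_points \<Gamma> \<Longrightarrow> h x = f x + g x" and x: "x \<in> fin_points \<Gamma>"
  shows "\<psi> h x = \<psi> f x + \<psi> g x"
proof -
  have "h = f \<otimes>\<^bsub>Rat \<Gamma>\<^esub> g" using Rat_mult_eqI[OF assms(3,4)] by simp
  then have "\<psi> h = \<psi> f \<otimes>\<^bsub>Rat \<Gamma>\<^esub> \<psi> g"
    using \<psi> assms by (auto simp: rat_aut_iff)
  then show ?thesis
    using Rat_mult(2)[OF aut_closed[OF assms(1)] aut_closed[OF assms(2)] x] by simp
qed

lemma aut_pl: 
  assumes "f \<in> pl_functions" shows "\<psi> f \<in> pl_functions"
proof -
  have "inj_on \<psi> (carrier (Rat \<Gamma>))" using \<psi> by (auto simp: rat_aut_iff bij_betw_def)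
  moreover have "f \<noteq> zero_fun" using assms zero_fun_not_pl by auto
  moreover have "\<psi> zero_fun = zero_fun" by (rule aut_const) simp
  ultimately have "\<psi> f \<noteq> zero_fun"
    using assms by (metis carrier_Rat inj_onD insertCI)
  then show ?thesis using aut_closed[of f] assms by (auto simp: carrier_Rat)
qed

lemma aut_add_const:
  assumes f: "f \<in> pl_functions" and x: "x \<in> points \<Gamma>"
  shows "\<psi> (\<lambda>x\<in>points \<Gamma>. f x + ereal c) x = \<psi> f x + ereal c"
proof (rule agree_on_fin_points[OF _ _ _ x])
  let ?h = "\<lambda>x\<in>points \<Gamma>. f x + ereal c"
  have h: "?h \<in> pl_functions" using f by (intro restrict_pl integral_pl_add_const) (simp add: pl_functions_def)
  then show "continuous_map (curve_top \<Gamma>) euclidean (\<psi> ?h)"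
    by (intro carrier_continuous) (simp add: carrier_Rat aut_pl)
  show "continuous_map (curve_top \<Gamma>) euclidean (\<lambda>x. \<psi> f x + ereal c)"
    using aut_pl[OF f] by (intro integral_pl_imp_continuous integral_pl_add_const) (simp add: pl_functions_def)
  fix y assume y: "y \<in> fin_points \<Gamma>"
  have "\<psi> ?h y = \<psi> f y + \<psi> (const_fun \<Gamma> (ereal c)) y"
  proof (rule aut_sum)
    show "const_fun \<Gamma> (ereal c) \<in> carrier (Rat \<Gamma>)" by (rule const_fun_carrier) simp
  qed (use f h y in \<open>auto simp: carrier_Rat const_fun_def fin_points_subset\<close>)
  also have "\<psi> (const_fun \<Gamma> (ereal c)) y = ereal c"
    using aut_const[of "ereal c"] y by (simp add: const_fun_def fin_points_subset)
  finally show "\<psi> ?h y = \<psi> f y + ereal c" .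
qed

text \<open>
  Negation is the multiplicative inverse; it is first compared at finite points, where the product is the
  pointwise sum.
\<close>

lemma aut_uminus:
  assumes f: "f \<in> pl_functions" and x: "x \<in> points \<Gamma>"
  shows "\<psi> (\<lambda>x\<in>points \<Gamma>. - f x) x = - \<psi> f x"
proof (rule agree_on_fin_points[OF _ _ _ x])
  let ?h = "\<lambda>x\<in>points \<Gamma>. - f x"
  have h: "?h \<in> pl_functions" using f by (intro restrict_pl integral_pl_uminus) (simp add: pl_functions_def)
  then show "continuous_map (curve_top \<Gamma>) euclidean (\<psi> ?h)"
    by (intro carrier_continuous) (simp add: carrier_Rat aut_pl)
  show "continuous_map (curve_top \<Gamma>) euclidean (\<lambda>x. - \<psi> f x)"
    using aut_pl[OF f] by (intro integral_pl_imp_continuous integral_pl_uminus) (simp add: pl_functions_def)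
  fix y assume y: "y \<in> fin_points \<Gamma>"
  have fin: "\<bar>k y\<bar> \<noteq> \<infinity>" if "k \<in> pl_functions" for k
    using that y integral_pl_finite by (auto simp: pl_functions_def)
  have "\<psi> (const_fun \<Gamma> 0) y = \<psi> f y + \<psi> ?h y"
  proof (rule aut_sum)
    fix z assume z: "z \<in> fin_points \<Gamma>"
    then have "\<bar>f z\<bar> \<noteq> \<infinity>" using f integral_pl_finite by (auto simp: pl_functions_def)
    then show "const_fun \<Gamma> 0 z = f z + ?h z"
      using z fin_points_subset[OF z] by (cases "f z") (auto simp: const_fun_def)
  qed (use f h y const_fun_pl[of 0] in \<open>auto simp: carrier_Rat zero_ereal_def\<close>)
  also have "\<psi> (const_fun \<Gamma> 0) y = 0"
    using aut_const[of 0] y by (simp add: const_fun_def fin_points_subset)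
  finally have sum: "0 = \<psi> f y + \<psi> ?h y" .
  have "v = - u" if "0 = u + v" "\<bar>u\<bar> \<noteq> \<infinity>" "\<bar>v\<bar> \<noteq> \<infinity>" for u v :: ereal
    using that by (cases u; cases v) auto
  from this[OF sum fin[OF aut_pl[OF f]] fin[OF aut_pl[OF h]]] show "\<psi> ?h y = - \<psi> f y" .
qed

lemma separating_function:
  assumes f: "f \<in> carrier (Rat \<Gamma>)" and ne: "\<psi> f x \<noteq> f y" and x: "x \<in> points \<Gamma>" and y: "y \<in> points \<Gamma>"
  shows "\<exists>g\<in>pl_functions. 0 < g y \<and> \<psi> g x < 0"
proof -
  have "f \<noteq> zero_fun" using ne aut_const[of "- \<infinity>"] x y by (auto simp: const_fun_def)
  then have f: "f \<in> pl_functions" using f by (auto simp: carrier_Rat)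
  then have pl: "integral_pl f" by (simp add: pl_functions_def)
  consider "\<psi> f x < f y" | "f y < \<psi> f x" using ne by (meson linorder_neqE)
  then show ?thesis
  proof cases
    case 1
    then obtain c where c: "\<psi> f x < ereal c" "ereal c < f y" using ereal_dense2 by blast
    let ?g = "\<lambda>x\<in>points \<Gamma>. f x + ereal (- c)"
    have "?g \<in> pl_functions" by (intro restrict_pl integral_pl_add_const pl)
    moreover have "0 < ?g y" using c(2) y by (cases "f y") auto
    moreover have "\<psi> ?g x < 0" using c(1) aut_add_const[OF f x] by (cases "\<psi> f x") auto
    ultimately show ?thesis by blast
  next
    case 2
    then obtain c where c: "f y < ereal c" "ereal c < \<psi> f x" using ereal_dense2 by blast
    let ?h = "\<lambda>x\<in>points \<Gamma>. - f x"
    have h: "?h \<in> pl_functions" by (intro restrict_pl integral_pl_uminus pl)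
    let ?g = "\<lambda>x\<in>points \<Gamma>. ?h x + ereal c"
    have "?g \<in> pl_functions"
      by (intro restrict_pl integral_pl_add_const) (use h in \<open>simp only: pl_functions_def mem_Collect_eq\<close>)
    moreover have "0 < ?g y" using c(1) y by (cases "f y") auto
    moreover have "\<psi> ?g x < 0" using c(2) aut_add_const[OF h x] aut_uminus[OF f x] by (cases "\<psi> f x") auto
    ultimately show ?thesis by blast
  qed
qed

text \<open>
  Compactness turns the failure at every single \<open>y\<close> into one function that contradicts monotonicity.
\<close>

lemma aut_eval:
  assumes x: "x \<in> points \<Gamma>"
  shows "\<exists>y\<in>points \<Gamma>. \<forall>f\<in>carrier (Rat \<Gamma>). \<psi> f x = f y"
proof (rule ccontr)
  assume "\<not> ?thesis"
  then have "\<forall>y\<in>points \<Gamma>. \<exists>g\<in>pl_functions. 0 < g y \<and> \<psi> g x < 0"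
    using separating_function x by meson
  then obtain G where G: "\<And>y. y \<in> points \<Gamma> \<Longrightarrow> G y \<in> pl_functions \<and> 0 < G y y \<and> \<psi> (G y) x < 0"
    by metis
  let ?U = "\<lambda>y. {z \<in> topspace (curve_top \<Gamma>). G y z \<in> {0<..}}"
  have "openin (curve_top \<Gamma>) (?U y)" if "y \<in> points \<Gamma>" for y
    using G[OF that] by (intro openin_continuous_map_preimage[OF integral_pl_imp_continuous]) (auto simp: pl_functions_def)
  moreover have "points \<Gamma> \<subseteq> \<Union> (?U ` points \<Gamma>)"
    using G by (auto simp: topspace_curve_top)
  ultimately obtain \<F> where "finite \<F>" "\<F> \<subseteq> ?U ` points \<Gamma>" "points \<Gamma> \<subseteq> \<Union> \<F>"
    using compact_space_curve unfolding compact_space_alt topspace_curve_top by (metis (no_types, lifting) imageE)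
  then obtain Y where Y: "finite Y" "Y \<subseteq> points \<Gamma>" "points \<Gamma> \<subseteq> \<Union> (?U ` Y)"
    by (metis (no_types, lifting) finite_subset_image)
  then have "Y \<noteq> {}" using x by auto
  from Y(1) this Y(2) have "\<exists>h\<in>pl_functions. (\<forall>y\<in>Y. \<forall>z\<in>points \<Gamma>. G y z \<le> h z) \<and> \<psi> h x < 0"
  proof (induction Y rule: finite_ne_induct)
    case (singleton y)
    then show ?case using G[of y] by auto
  next
    case (insert y Y)
    then obtain h where h: "h \<in> pl_functions" "\<forall>y\<in>Y. \<forall>z\<in>points \<Gamma>. G y z \<le> h z" "\<psi> h x < 0" by auto
    have y: "G y \<in> pl_functions" "\<psi> (G y) x < 0" using G[of y] insert.prems by auto
    let ?k = "\<lambda>z\<in>points \<Gamma>. max (G y z) (h z)"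
    have "?k \<in> pl_functions" using y h by (intro Rat_add_pl)
    moreover have "\<psi> ?k x < 0"
      using aut_max[of "G y" h x] y h x by (simp add: carrier_Rat)
    moreover have "\<forall>u\<in>insert y Y. \<forall>z\<in>points \<Gamma>. G u z \<le> ?k z"
      using h(2) by (auto simp: le_max_iff_disj)
    ultimately show ?case by blast
  qed
  then obtain h where h: "h \<in> pl_functions" "\<forall>y\<in>Y. \<forall>z\<in>points \<Gamma>. G y z \<le> h z" "\<psi> h x < 0" by blast
  have "const_fun \<Gamma> 0 z \<le> h z" if z: "z \<in> points \<Gamma>" for z
  proof -
    obtain y where "y \<in> Y" "0 < G y z" using Y(3) z by (auto simp: topspace_curve_top)
    then have "0 < h z" using h(2) z by (meson less_le_trans)
    then show ?thesis using z by (simp add: const_fun_def)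
  qed
  then have "\<psi> (const_fun \<Gamma> 0) x \<le> \<psi> h x"
    using h(1) x const_fun_carrier[of 0] by (intro aut_mono) (auto simp: carrier_Rat)
  then show False using h(3) aut_const[of 0] x by (simp add: const_fun_def)
qed

end

definition pulls_back :: "(('p \<Rightarrow> ereal) \<Rightarrow> ('p \<Rightarrow> ereal)) \<Rightarrow> ('p \<Rightarrow> 'p) \<Rightarrow> bool" where
  "pulls_back \<psi> \<theta> \<longleftrightarrow> \<theta> \<in> points \<Gamma> \<rightarrow> points \<Gamma> \<and> (\<forall>f\<in>carrier (Rat \<Gamma>). \<forall>x\<in>points \<Gamma>. \<psi> f x = f (\<theta> x))"

lemma aut_pulls_back:
  assumes "\<psi> \<in> carrier (rat_aut \<Gamma>)"
  obtains \<theta> where "pulls_back \<psi> \<theta>"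
proof -
  obtain \<theta> where "\<forall>x\<in>points \<Gamma>. \<theta> x \<in> points \<Gamma> \<and> (\<forall>f\<in>carrier (Rat \<Gamma>). \<psi> f x = f (\<theta> x))"
    using aut_eval[OF assms] by metis
  then show ?thesis using that by (auto simp: pulls_back_def)
qed

lemma pulls_back_continuous:
  assumes \<psi>: "\<psi> \<in> carrier (rat_aut \<Gamma>)" and \<theta>: "pulls_back \<psi> \<theta>"
  shows "continuous_map (curve_top \<Gamma>) (curve_top \<Gamma>) \<theta>"
  unfolding continuous_map_def topspace_curve_top
proof (intro conjI allI impI)
  show "\<theta> \<in> points \<Gamma> \<rightarrow> points \<Gamma>" using \<theta> by (simp add: pulls_back_def)
  fix U assume U: "openin (curve_top \<Gamma>) U"
  show "openin (curve_top \<Gamma>) {x \<in> points \<Gamma>. \<theta> x \<in> U}"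
  proof (subst openin_subopen, intro ballI)
    fix x assume "x \<in> {x \<in> points \<Gamma>. \<theta> x \<in> U}"
    then have x: "x \<in> points \<Gamma>" "\<theta> x \<in> U" "\<theta> x \<in> points \<Gamma>" using \<theta> by (auto simp: pulls_back_def)
    obtain f where f: "integral_pl f" "0 < f (\<theta> x)" "\<And>y. y \<in> points \<Gamma> \<Longrightarrow> y \<notin> U \<Longrightarrow> f y \<le> 0"
      using rational_urysohn[OF x(3) U x(2)] by blast
    let ?g = "restrict f (points \<Gamma>)"
    have g: "?g \<in> pl_functions" using f(1) by (rule restrict_pl)
    then have gc: "?g \<in> carrier (Rat \<Gamma>)" by (simp add: carrier_Rat)
    have eq: "\<psi> ?g z = f (\<theta> z)" if "z \<in> points \<Gamma>" for z
      using \<theta> gc that by (auto simp: pulls_back_def)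
    have "openin (curve_top \<Gamma>) {z \<in> topspace (curve_top \<Gamma>). \<psi> ?g z \<in> {0<..}}"
      by (intro openin_continuous_map_preimage[OF carrier_continuous[OF aut_closed[OF \<psi> gc]]]) auto
    moreover have "{z \<in> topspace (curve_top \<Gamma>). \<psi> ?g z \<in> {0<..}} \<subseteq> {x \<in> points \<Gamma>. \<theta> x \<in> U}"
    proof
      fix z assume "z \<in> {z \<in> topspace (curve_top \<Gamma>). \<psi> ?g z \<in> {0<..}}"
      then have z: "z \<in> points \<Gamma>" "0 < f (\<theta> z)" using eq by (auto simp: topspace_curve_top)
      then have "\<theta> z \<in> U" using f(3)[of "\<theta> z"] \<theta> by (fastforce simp: pulls_back_def)
      then show "z \<in> {x \<in> points \<Gamma>. \<theta> x \<in> U}" using z by simp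
    qed
    moreover have "x \<in> {z \<in> topspace (curve_top \<Gamma>). \<psi> ?g z \<in> {0<..}}"
      using x f(2) eq by (simp add: topspace_curve_top)
    ultimately show "\<exists>T. openin (curve_top \<Gamma>) T \<and> x \<in> T \<and> T \<subseteq> {x \<in> points \<Gamma>. \<theta> x \<in> U}" by blast
  qed
qed

text \<open>
  A point is at infinity if and only if some rational function takes the value \<open>\<infinity>\<close> there.
\<close>

lemma pulls_back_fin:
  assumes \<psi>: "\<psi> \<in> carrier (rat_aut \<Gamma>)" and \<theta>: "pulls_back \<psi> \<theta>" and x: "x \<in> fin_points \<Gamma>"
  shows "\<theta> x \<in> fin_points \<Gamma>"
proof (rule ccontr)
  assume "\<theta> x \<notin> fin_points \<Gamma>"
  then have "\<theta> x \<in> inf_points \<Gamma>" using \<theta> x fin_points_subset by (auto simp: pulls_back_def fin_points_def)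
  then obtain e where e: "e \<in> E" "len \<Gamma> e = \<infinity>" "\<theta> x = chart \<Gamma> e \<infinity>" by (rule inf_pointsE)
  let ?f = "restrict (end_coord e) (points \<Gamma>)"
  have f: "?f \<in> pl_functions" by (intro restrict_pl integral_pl_end_coord e)
  then have "\<psi> ?f x = end_coord e (\<theta> x)"
    using \<theta> fin_points_subset[OF x] by (auto simp: pulls_back_def carrier_Rat)
  then have "\<psi> ?f x = \<infinity>" using e end_coord_chart by simp
  then show False
    using aut_pl[OF \<psi> f] integral_pl_finite[OF _ x, of "\<psi> ?f"] by (simp add: pl_functions_def)
qed

lemma pulls_back_inverse:
  assumes \<psi>: "\<psi> \<in> carrier (rat_aut \<Gamma>)" and \<psi>': "\<psi>' \<in> carrier (rat_aut \<Gamma>)"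
    and \<theta>: "pulls_back \<psi> \<theta>" and \<theta>': "pulls_back \<psi>' \<theta>'"
    and inv: "\<And>f. f \<in> carrier (Rat \<Gamma>) \<Longrightarrow> \<psi>' (\<psi> f) = f" and x: "x \<in> points \<Gamma>"
  shows "\<theta> (\<theta>' x) = x"
proof (rule ccontr)
  assume ne: "\<theta> (\<theta>' x) \<noteq> x"
  have pts: "\<theta>' x \<in> points \<Gamma>" "\<theta> (\<theta>' x) \<in> points \<Gamma>" using \<theta> \<theta>' x by (auto simp: pulls_back_def)
  obtain f where f: "integral_pl f" "f x < f (\<theta> (\<theta>' x))"
    using integral_pl_separates[OF pts(2) x ne] by blast
  let ?g = "restrict f (points \<Gamma>)"
  have g: "?g \<in> carrier (Rat \<Gamma>)" using restrict_pl[OF f(1)] by (simp add: carrier_Rat)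
  have "?g x = \<psi>' (\<psi> ?g) x" using inv[OF g] by simp
  also have "\<dots> = \<psi> ?g (\<theta>' x)" using \<theta>' aut_closed[OF \<psi> g] x by (auto simp: pulls_back_def)
  also have "\<dots> = ?g (\<theta> (\<theta>' x))" using \<theta> g pts by (auto simp: pulls_back_def)
  finally show False using f(2) x pts by simp
qed

text \<open>
  Let \<open>b = \<theta> a\<close>.  The function \<open>g = tent a R \<circ> \<theta>'\<close> is rational, vanishes at \<open>b\<close> and is positive
  elsewhere; so near \<open>b\<close> it has positive integer slopes, and \<open>g \<ge> dist(b, _)\<close>.  Evaluating at \<open>\<theta> x\<close>
  compares the distances of \<open>x\<close> from \<open>a\<close> and of \<open>\<theta> x\<close> from \<open>b\<close>.
\<close>

lemma locally_nonexpanding: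
  assumes cont: "continuous_map (curve_top \<Gamma>) (curve_top \<Gamma>) \<theta>"
    and fin: "\<And>x. x \<in> fin_points \<Gamma> \<Longrightarrow> \<theta> x \<in> fin_points \<Gamma>"
    and maps: "\<theta>' \<in> points \<Gamma> \<rightarrow> points \<Gamma>"
    and inv: "\<And>x. x \<in> points \<Gamma> \<Longrightarrow> \<theta> (\<theta>' x) = x" "\<And>x. x \<in> points \<Gamma> \<Longrightarrow> \<theta>' (\<theta> x) = x"
    and pl: "\<And>f. integral_pl f \<Longrightarrow> integral_pl (f \<circ> \<theta>')"
    and a: "a \<in> fin_points \<Gamma>"
  shows "\<exists>r>0. \<forall>x\<in>points \<Gamma>. cdist \<Gamma> a x < ereal r \<longrightarrow> cdist \<Gamma> (\<theta> a) (\<theta> x) \<le> cdist \<Gamma> a x"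
proof -
  have a': "a \<in> points \<Gamma>" using a by (rule fin_points_subset)
  obtain R where R: "star_radius a R" by (rule star_radius_exists)
  define b where "b = \<theta> a"
  have b: "b \<in> fin_points \<Gamma>" "b \<in> points \<Gamma>" using fin[OF a] fin_points_subset by (auto simp: b_def)
  let ?g = "tent a R \<circ> \<theta>'"
  have g: "integral_pl ?g" by (rule pl[OF integral_pl_tent[OF a R]])
  have "0 < R" using R by (simp add: star_radius_def)
  have gb: "?g b = 0" using inv(2)[OF a'] cdist_refl[OF a'] \<open>0 < R\<close> by (simp add: b_def tent_def)
  have gpos: "0 < ?g y" if y: "y \<in> points \<Gamma>" "y \<noteq> b" for y
  proof -
    have "\<theta>' y \<in> points \<Gamma>" "\<theta>' y \<noteq> a" using y maps inv(1)[OF y(1)] by (auto simp: b_def)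
    then have "cdist \<Gamma> a (\<theta>' y) \<noteq> 0" using cdist_zero_imp_eq[OF a'] by metis
    then show ?thesis using cdist_nonneg[of \<Gamma> a "\<theta>' y"] \<open>0 < R\<close> by (simp add: tent_def)
  qed
  obtain \<rho> and K :: "int set" where \<rho>: "0 < \<rho>" "star_radius b \<rho>"
    and K: "\<forall>y. cdist \<Gamma> b y < ereal \<rho> \<longrightarrow> (\<exists>k\<in>K. ?g y = ?g b + ereal (of_int k) * cdist \<Gamma> b y)"
    using integral_pl_conical[OF g b(1)] by (elim exE conjE)
  have le: "cdist \<Gamma> b y \<le> ?g y" if y: "y \<in> points \<Gamma>" "cdist \<Gamma> b y < ereal \<rho>" for y
  proof (cases "y = b")
    case True
    then show ?thesis using gb cdist_refl[OF b(2)] by simp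
  next
    case False
    obtain k where k: "?g y = ereal (of_int k) * cdist \<Gamma> b y" using K y(2) gb by auto
    obtain d where d: "cdist \<Gamma> b y = ereal d" "0 \<le> d"
      using y(2) cdist_nonneg[of \<Gamma> b y] by (cases "cdist \<Gamma> b y") auto
    have "0 < of_int k * d" using gpos[OF y(1) False] k d by simp
    then have "1 \<le> k" using d(2) by (auto simp: zero_less_mult_iff)
    then have "1 * d \<le> of_int k * d" using d(2) by (intro mult_right_mono) auto
    then show ?thesis using k d by simp
  qed
  let ?U = "{y \<in> topspace (curve_top \<Gamma>). tent b \<rho> y \<in> {..<ereal \<rho>}}"
  have "openin (curve_top \<Gamma>) ?U"
    by (intro openin_continuous_map_preimage[OF integral_pl_imp_continuous[OF integral_pl_tent[OF b(1) \<rho>(2)]]]) auto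
  then have W: "openin (curve_top \<Gamma>) {x \<in> topspace (curve_top \<Gamma>). \<theta> x \<in> ?U}"
    by (rule openin_continuous_map_preimage[OF cont])
  have "a \<in> {x \<in> topspace (curve_top \<Gamma>). \<theta> x \<in> ?U}"
    using a' b(2) \<rho>(1) cdist_refl[OF b(2)] unfolding b_def by (simp add: topspace_curve_top tent_def)
  from ball_in_open[OF a W this] obtain r where r: "0 < r"
    "\<And>y. cdist \<Gamma> a y < ereal r \<Longrightarrow> y \<in> {x \<in> topspace (curve_top \<Gamma>). \<theta> x \<in> ?U}" by blast
  show ?thesis
  proof (intro exI[of _ r] conjI ballI impI r(1))
    fix x assume x: "x \<in> points \<Gamma>" "cdist \<Gamma> a x < ereal r"
    then have "\<theta> x \<in> ?U" using r(2) by blast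
    then have "\<theta> x \<in> points \<Gamma>" "cdist \<Gamma> b (\<theta> x) < ereal \<rho>"
      by (auto simp: topspace_curve_top tent_def min_less_iff_disj)
    then have "cdist \<Gamma> b (\<theta> x) \<le> tent a R x" using le[of "\<theta> x"] inv(2)[OF x(1)] by simp
    also have "\<dots> \<le> cdist \<Gamma> a x" by (simp add: tent_def)
    finally show "cdist \<Gamma> (\<theta> a) (\<theta> x) \<le> cdist \<Gamma> a x" by (simp add: b_def)
  qed
qed

text \<open>
  By bisection a path on an edge is cut into short pieces, each of which contains a point around which
  the local estimate holds on the whole piece.
\<close>

lemma locally_nonexpanding_imp_nonexpanding:
  assumes maps: "\<theta> \<in> points \<Gamma> \<rightarrow> points \<Gamma>"
    and local: "\<And>a. a \<in> fin_points \<Gamma> \<Longrightarrow>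
      \<exists>r>0. \<forall>x\<in>points \<Gamma>. cdist \<Gamma> a x < ereal r \<longrightarrow> cdist \<Gamma> (\<theta> a) (\<theta> x) \<le> cdist \<Gamma> a x"
  shows "cdist \<Gamma> (\<theta> x) (\<theta> y) \<le> cdist \<Gamma> x y"
proof (rule nonexpanding_if_on_edges[OF maps])
  fix e s t assume e: "e \<in> E" "s \<in> {0..len \<Gamma> e}" "t \<in> {0..len \<Gamma> e}"
  let ?c = "\<lambda>u. \<theta> (chart \<Gamma> e (ereal u))"
  have real: "cdist \<Gamma> (?c p) (?c q) \<le> ereal (q - p)" if pq: "0 \<le> p" "p \<le> q" "ereal q \<le> len \<Gamma> e" for p q
  proof -
    have "p \<le> p \<and> q \<le> q \<longrightarrow> cdist \<Gamma> (?c p) (?c q) \<le> ereal (q - p)"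
    proof (rule Bolzano[where P = "\<lambda>u v. p \<le> u \<and> v \<le> q \<longrightarrow> cdist \<Gamma> (?c u) (?c v) \<le> ereal (v - u)", OF pq(2)])
      fix u v w assume "p \<le> u \<and> v \<le> q \<longrightarrow> cdist \<Gamma> (?c u) (?c v) \<le> ereal (v - u)"
        "p \<le> v \<and> w \<le> q \<longrightarrow> cdist \<Gamma> (?c v) (?c w) \<le> ereal (w - v)" "u \<le> v" "v \<le> w"
      then have "cdist \<Gamma> (?c u) (?c v) + cdist \<Gamma> (?c v) (?c w) \<le> ereal (v - u) + ereal (w - v)"
        if "p \<le> u" "w \<le> q" using that by (intro add_mono) auto
      then show "p \<le> u \<and> w \<le> q \<longrightarrow> cdist \<Gamma> (?c u) (?c w) \<le> ereal (w - u)"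
        using cdist_triangle[of \<Gamma> "?c u" "?c w" "?c v"] by (auto intro: order.trans)
    next
      fix z assume z: "p \<le> z" "z \<le> q"
      have "ereal z \<le> ereal q" using z by simp
      then have zl: "ereal z \<in> {0..len \<Gamma> e}" using z pq order.trans[OF _ pq(3)] by simp
      then obtain r where r: "0 < r" "\<And>x. x \<in> points \<Gamma> \<Longrightarrow> cdist \<Gamma> (chart \<Gamma> e (ereal z)) x < ereal r \<Longrightarrow>
          cdist \<Gamma> (?c z) (\<theta> x) \<le> cdist \<Gamma> (chart \<Gamma> e (ereal z)) x"
        using local[of "chart \<Gamma> e (ereal z)"] chart_fin_iff[OF e(1) zl] by auto
      have near: "cdist \<Gamma> (?c z) (?c u) \<le> ereal \<bar>z - u\<bar>" if u: "p \<le> u" "u \<le> q" "\<bar>z - u\<bar> < r" for u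
      proof -
        have "ereal u \<le> ereal q" using u by simp
        then have ul: "ereal u \<in> {0..len \<Gamma> e}" using u pq order.trans[OF _ pq(3)] by simp
        have d: "cdist \<Gamma> (chart \<Gamma> e (ereal z)) (chart \<Gamma> e (ereal u)) \<le> ereal \<bar>z - u\<bar>"
          using cdist_segment[OF e(1) zl ul] by simp
        also have "\<dots> < ereal r" using u by simp
        finally show ?thesis
          using r(2)[OF chart_in_points[OF e(1) ul]] d by (blast intro: order.trans)
      qed
      show "\<exists>d>0. \<forall>u v. u \<le> z \<and> z \<le> v \<and> v - u < d \<longrightarrow> p \<le> u \<and> v \<le> q \<longrightarrow> cdist \<Gamma> (?c u) (?c v) \<le> ereal (v - u)"
      proof (intro exI[of _ r] conjI allI impI r(1))
        fix u v assume uv: "u \<le> z \<and> z \<le> v \<and> v - u < r" "p \<le> u \<and> v \<le> q"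
        have "cdist \<Gamma> (?c u) (?c v) \<le> cdist \<Gamma> (?c u) (?c z) + cdist \<Gamma> (?c z) (?c v)" by (rule cdist_triangle)
        also have "\<dots> \<le> ereal \<bar>z - u\<bar> + ereal \<bar>z - v\<bar>"
          using near[of u] near[of v] uv cdist_sym[of \<Gamma> "?c u"] by (intro add_mono) auto
        also have "\<dots> = ereal (v - u)" using uv by simp
        finally show "cdist \<Gamma> (?c u) (?c v) \<le> ereal (v - u)" .
      qed
    qed
    then show ?thesis by simp
  qed
  show "cdist \<Gamma> (\<theta> (chart \<Gamma> e s)) (\<theta> (chart \<Gamma> e t)) \<le> \<bar>s - t\<bar>"
  proof (cases "s = \<infinity> \<or> t = \<infinity>")
    case True
    then have "\<bar>s - t\<bar> = \<infinity>" using e by (cases s; cases t) auto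
    then show ?thesis by simp
  next
    case False
    then obtain p q where "s = ereal p" "t = ereal q" using e by (cases s; cases t) auto
    then show ?thesis
      using real[of p q] real[of q p] e cdist_sym[of \<Gamma> "?c p" "?c q"] by (cases "p \<le> q") auto
  qed
qed

lemma aut_induced_by_isometry:
  assumes \<psi>: "\<psi> \<in> carrier (rat_aut \<Gamma>)"
  obtains \<theta> where "isometry \<theta>" "pulls_back \<psi> \<theta>"
proof -
  interpret G: group "rat_aut \<Gamma>" by (rule group_rat_aut)
  define \<psi>' where "\<psi>' = inv\<^bsub>rat_aut \<Gamma>\<^esub> \<psi>"
  have \<psi>': "\<psi>' \<in> carrier (rat_aut \<Gamma>)" using \<psi> by (simp add: \<psi>'_def)
  have "compose (carrier (Rat \<Gamma>)) \<psi>' \<psi> = (\<lambda>f\<in>carrier (Rat \<Gamma>). f)"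
    "compose (carrier (Rat \<Gamma>)) \<psi> \<psi>' = (\<lambda>f\<in>carrier (Rat \<Gamma>). f)"
    using G.l_inv[OF \<psi>] G.r_inv[OF \<psi>] by (simp_all add: \<psi>'_def rat_aut_def alg_aut_def)
  then have inv: "\<psi>' (\<psi> f) = f" "\<psi> (\<psi>' f) = f" if "f \<in> carrier (Rat \<Gamma>)" for f
    using that by (metis compose_eq restrict_apply')+
  obtain \<theta> where \<theta>: "pulls_back \<psi> \<theta>" by (rule aut_pulls_back[OF \<psi>])
  obtain \<theta>' where \<theta>': "pulls_back \<psi>' \<theta>'" by (rule aut_pulls_back[OF \<psi>'])
  have i1: "\<theta> (\<theta>' x) = x" if "x \<in> points \<Gamma>" for x
    by (rule pulls_back_inverse[OF \<psi> \<psi>' \<theta> \<theta>' inv(1) that])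
  have i2: "\<theta>' (\<theta> x) = x" if "x \<in> points \<Gamma>" for x
    by (rule pulls_back_inverse[OF \<psi>' \<psi> \<theta>' \<theta> inv(2) that])
  have maps: "\<theta> \<in> points \<Gamma> \<rightarrow> points \<Gamma>" "\<theta>' \<in> points \<Gamma> \<rightarrow> points \<Gamma>"
    using \<theta> \<theta>' by (auto simp: pulls_back_def)
  have cont: "continuous_map (curve_top \<Gamma>) (curve_top \<Gamma>) \<theta>" "continuous_map (curve_top \<Gamma>) (curve_top \<Gamma>) \<theta>'"
    by (rule pulls_back_continuous[OF \<psi> \<theta>], rule pulls_back_continuous[OF \<psi>' \<theta>'])
  have pl: "integral_pl (f \<circ> \<theta>)" if "integral_pl f" "\<psi> \<in> carrier (rat_aut \<Gamma>)" "pulls_back \<psi> \<theta>" for f \<psi> \<theta>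
  proof -
    have f: "restrict f (points \<Gamma>) \<in> pl_functions" using that(1) by (rule restrict_pl)
    have "\<psi> (restrict f (points \<Gamma>)) x = (f \<circ> \<theta>) x" if x: "x \<in> points \<Gamma>" for x
      using \<open>pulls_back \<psi> \<theta>\<close> f x by (auto simp: pulls_back_def carrier_Rat)
    then show ?thesis
      using aut_pl[OF that(2) f] integral_pl_cong[of "\<psi> (restrict f (points \<Gamma>))" "f \<circ> \<theta>"]
      by (simp add: pl_functions_def)
  qed
  have ne: "cdist \<Gamma> (\<theta> x) (\<theta> y) \<le> cdist \<Gamma> x y" for x y
    by (rule locally_nonexpanding_imp_nonexpanding[OF maps(1)],
        rule locally_nonexpanding[OF cont(1) pulls_back_fin[OF \<psi> \<theta>] maps(2) i1 i2 pl[OF _ \<psi>' \<theta>']])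
  have ne': "cdist \<Gamma> (\<theta>' x) (\<theta>' y) \<le> cdist \<Gamma> x y" for x y
    by (rule locally_nonexpanding_imp_nonexpanding[OF maps(2)],
        rule locally_nonexpanding[OF cont(2) pulls_back_fin[OF \<psi>' \<theta>'] maps(1) i2 i1 pl[OF _ \<psi> \<theta>]])
  have "isometry \<theta>"
    unfolding isometry_def
  proof (intro conjI ballI antisym)
    show "homeomorphic_map (curve_top \<Gamma>) (curve_top \<Gamma>) \<theta>"
      using cont i1 i2 by (intro homeomorphic_maps_imp_map[of _ _ _ \<theta>']) (auto simp: homeomorphic_maps_def topspace_curve_top)
    fix x y assume "x \<in> points \<Gamma>" "y \<in> points \<Gamma>"
    then show "cdist \<Gamma> x y \<le> cdist \<Gamma> (\<theta> x) (\<theta> y)" using ne'[of "\<theta> x" "\<theta> y"] i2 by simp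
  qed (rule ne)
  then show ?thesis using that \<theta> by blast
qed

section \<open>Finite harmonic morphisms of degree one are isometries\<close>

lemma chart_in_edge_set: "t \<in> {0..len \<Gamma> e} \<Longrightarrow> chart \<Gamma> e t \<in> edge_set \<Gamma> e"
  unfolding edge_set_def by (rule imageI)

lemma ends_in_edge_set: "e \<in> E \<Longrightarrow> src \<Gamma> e \<in> edge_set \<Gamma> e \<and> tgt \<Gamma> e \<in> edge_set \<Gamma> e"
  using len_pos[of e] chart_in_edge_set[of 0 e] chart_in_edge_set[of "len \<Gamma> e" e]
  by (simp add: src_def tgt_def)

lemma edge_set_subset: "e \<in> E \<Longrightarrow> x \<in> edge_set \<Gamma> e \<Longrightarrow> x \<in> points \<Gamma>"
  unfolding points_def by blast

lemma vert_in_edge_set: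
  assumes "e \<in> E" "x \<in> edge_set \<Gamma> e" "x \<in> V"
  shows "x \<in> {src \<Gamma> e, tgt \<Gamma> e}"
  using assms chart_vert_iff[OF assms(1)] unfolding edge_set_def src_def tgt_def by auto

lemma in_some_edge_set:
  assumes "\<not> is_singleton (points \<Gamma>)" "x \<in> points \<Gamma>"
  obtains e where "e \<in> E" "x \<in> edge_set \<Gamma> e"
proof -
  have "points \<Gamma> \<noteq> {x}" using assms(1) by auto
  then obtain z where z: "z \<in> points \<Gamma>" "z \<noteq> x" using assms(2) by blast
  obtain e t where "e \<in> E" "t \<in> {0..len \<Gamma> e}" "x = chart \<Gamma> e t"
    by (rule on_some_edge[OF assms(2) z])
  then show ?thesis using that chart_in_edge_set by simp
qed

lemma edge_set_inj:
  assumes "e \<in> E" "e' \<in> E" "edge_set \<Gamma> e = edge_set \<Gamma> e'"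
  shows "e = e'"
proof -
  obtain t where t: "0 < t" "t < len \<Gamma> e" using dense[OF len_pos[OF assms(1)]] by blast
  then have ti: "t \<in> {0..len \<Gamma> e}" by auto
  then have "chart \<Gamma> e t \<in> edge_set \<Gamma> e'" using chart_in_edge_set assms(3) by auto
  then obtain s where s: "s \<in> {0..len \<Gamma> e'}" "chart \<Gamma> e t = chart \<Gamma> e' s" unfolding edge_set_def by blast
  show ?thesis
    by (cases rule: chart_eq_cases[OF assms(1) ti assms(2) s]) (use t in auto)
qed

end

lemma sum_nat_eq_1_singleton:
  fixes f :: "'a \<Rightarrow> nat"
  assumes "finite S" "sum f S = 1" "\<And>x. x \<in> S \<Longrightarrow> 1 \<le> f x"
  obtains a where "S = {a}" "f a = 1"
proof -
  have "card S \<le> 1"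
    using sum_mono[of S "\<lambda>_. 1" f] assms by simp
  moreover have "S \<noteq> {}" using assms(2) by auto
  ultimately have "card S = 1" using assms(1) by (simp add: card_gt_0_iff le_antisym Suc_leI)
  then obtain a where "S = {a}" by (auto simp: card_1_singleton_iff)
  then show ?thesis using that assms(2) by simp
qed

text \<open>
  A graph with one point has no edges, and then nothing would force the degree of its vertex to be
  positive.
\<close>

locale degree_one =
  G: tropical G + H: tropical H
  for G :: "('p, nat) curve" and H :: "('q, nat) curve" +
  fixes \<phi> :: "'p \<Rightarrow> 'q" and k :: "nat \<Rightarrow> nat" and m :: "'p \<Rightarrow> nat"
  assumes nontrivial: "\<not> is_singleton (points G)"
    and loopless: "loopless G"
    and harmonic: "harmonic_on_models G H \<phi> k m"
    and degree: "\<And>v'. v' \<in> verts H \<Longrightarrow> (\<Sum>v | v \<in> verts G \<and> \<phi> v = v'. m v) = 1"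
begin

lemma vert_image: "v \<in> verts G \<Longrightarrow> \<phi> v \<in> verts H"
  using harmonic by (auto simp: harmonic_on_models_def)

lemma edge_image:
  assumes "e \<in> edges G"
  obtains e' where "e' \<in> edges H" "\<phi> ` edge_set G e = edge_set H e'"
  using harmonic assms unfolding harmonic_on_models_def by blast

lemma edge_degree:
  assumes "e \<in> edges G"
  shows "0 < k e" and "x \<in> edge_set G e \<Longrightarrow> y \<in> edge_set G e \<Longrightarrow>
    cdist H (\<phi> x) (\<phi> y) = ereal (real (k e)) * cdist G x y"
  using harmonic assms unfolding harmonic_on_models_def by blast+

lemma vertex_degree:
  assumes "v \<in> verts G" "e' \<in> edges H" "\<phi> v \<in> {src H e', tgt H e'}"
  shows "(\<Sum>e | e \<in> edges G \<and> \<phi> ` edge_set G e = edge_set H e' \<and> v \<in> edge_set G e. k e) = m v"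
  using harmonic assms unfolding harmonic_on_models_def by blast

lemma inj_on_edge: 
  assumes "e \<in> edges G" shows "inj_on \<phi> (edge_set G e)"
proof (rule inj_onI)
  fix x y assume xy: "x \<in> edge_set G e" "y \<in> edge_set G e" "\<phi> x = \<phi> y"
  then have p: "x \<in> points G" "y \<in> points G" using G.edge_set_subset[OF assms] by auto
  obtain e' where e': "e' \<in> edges H" "\<phi> ` edge_set G e = edge_set H e'" by (rule edge_image[OF assms])
  then have "\<phi> y \<in> points H" using H.edge_set_subset[OF e'(1)] xy by blast
  then have "ereal (real (k e)) * cdist G x y = 0"
    using edge_degree(2)[OF assms xy(1,2)] xy(3) by (simp add: cdist_refl)
  then have "cdist G x y = 0" using edge_degree(1)[OF assms] by simp
  then show "x = y" by (rule G.cdist_zero_imp_eq[OF p])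
qed

lemma vertex_on_image_edge:
  assumes "e \<in> edges G" "\<phi> ` edge_set G e = edge_set H e'" "e' \<in> edges H" "v \<in> edge_set G e" "v \<in> verts G"
  shows "\<phi> v \<in> {src H e', tgt H e'}"
  using H.vert_in_edge_set[OF assms(3) _ vert_image[OF assms(5)]] assms by blast

text \<open>
  An edge of a loopless graph has two different ends.  They are mapped injectively to vertices on the
  image edge, hence to both of its ends; so no inner point is left to be mapped to a vertex.
\<close>

lemma vertex_lift:
  assumes e: "e \<in> edges G" and e': "\<phi> ` edge_set G e = edge_set H e'" "e' \<in> edges H"
    and x: "x \<in> edge_set G e" "\<phi> x \<in> verts H"
  shows "x \<in> verts G"
proof -
  have ne: "src G e \<noteq> tgt G e" using loopless e by (auto simp: loopless_def)
  have ends: "src G e \<in> edge_set G e" "tgt G e \<in> edge_set G e" using G.ends_in_edge_set[OF e] by auto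
  have V: "src G e \<in> verts G" "tgt G e \<in> verts G" using G.src_vert[OF e] G.tgt_vert[OF e] by auto
  have "\<phi> (src G e) \<noteq> \<phi> (tgt G e)" using ne inj_onD[OF inj_on_edge[OF e] _ ends] by blast
  moreover have "\<phi> (src G e) \<in> {src H e', tgt H e'}" "\<phi> (tgt G e) \<in> {src H e', tgt H e'}"
    using vertex_on_image_edge[OF e e'] ends V by auto
  moreover have "\<phi> x \<in> {src H e', tgt H e'}" using H.vert_in_edge_set[OF e'(2) _ x(2)] x(1) e'(1) by blast
  ultimately have "\<phi> x = \<phi> (src G e) \<or> \<phi> x = \<phi> (tgt G e)" by auto
  then have "x = src G e \<or> x = tgt G e" using inj_onD[OF inj_on_edge[OF e] _ x(1)] ends by blast
  then show ?thesis using V by auto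
qed

text \<open>
  Every vertex lies on an edge, which contributes its positive degree.
\<close>

lemma vertex_degree_pos:
  assumes v: "v \<in> verts G" shows "1 \<le> m v"
proof -
  obtain e where e: "e \<in> edges G" "v \<in> edge_set G e"
    using G.in_some_edge_set[OF nontrivial] v G.verts_subset by blast
  obtain e' where e': "e' \<in> edges H" "\<phi> ` edge_set G e = edge_set H e'" by (rule edge_image[OF e(1)])
  let ?S = "{e \<in> edges G. \<phi> ` edge_set G e = edge_set H e' \<and> v \<in> edge_set G e}"
  have "k e \<le> sum k ?S" using e e' G.finite_edges by (intro member_le_sum) auto
  also have "sum k ?S = m v" using vertex_degree[OF v e'(1) vertex_on_image_edge[OF e(1) e'(2,1) e(2) v]] by simp
  finally show ?thesis using edge_degree(1)[OF e(1)] by simp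
qed

lemma vertex_fibre:
  assumes "v' \<in> verts H"
  obtains v where "{v \<in> verts G. \<phi> v = v'} = {v}" "m v = 1"
  using sum_nat_eq_1_singleton[of "{v \<in> verts G. \<phi> v = v'}" m] degree[OF assms] vertex_degree_pos G.finite_verts
  by auto

lemma vertex_degree_1: "v \<in> verts G \<Longrightarrow> m v = 1"
  using vertex_fibre[OF vert_image[of v]] by (metis (mono_tags, lifting) mem_Collect_eq singletonD)

lemma edge_fibre:
  assumes e': "e' \<in> edges H" and v: "v \<in> verts G" "\<phi> v \<in> {src H e', tgt H e'}"
  obtains e where "{e \<in> edges G. \<phi> ` edge_set G e = edge_set H e' \<and> v \<in> edge_set G e} = {e}" "k e = 1"
proof -
  let ?S = "{e \<in> edges G. \<phi> ` edge_set G e = edge_set H e' \<and> v \<in> edge_set G e}"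
  have "finite ?S" using G.finite_edges by auto
  moreover have "sum k ?S = 1" using vertex_degree[OF v(1) e' v(2)] vertex_degree_1[OF v(1)] by simp
  moreover have "1 \<le> k e" if "e \<in> ?S" for e using edge_degree(1)[of e] that by simp
  ultimately show ?thesis using sum_nat_eq_1_singleton that by blast
qed

lemma edge_degree_1:
  assumes e: "e \<in> edges G" shows "k e = 1"
proof -
  obtain e' where e': "e' \<in> edges H" "\<phi> ` edge_set G e = edge_set H e'" by (rule edge_image[OF e])
  have v: "src G e \<in> verts G" "src G e \<in> edge_set G e" using G.src_vert[OF e] G.ends_in_edge_set[OF e] by auto
  obtain e2 where e2: "{f \<in> edges G. \<phi> ` edge_set G f = edge_set H e' \<and> src G e \<in> edge_set G f} = {e2}" "k e2 = 1"
    using edge_fibre[OF e'(1) v(1) vertex_on_image_edge[OF e e'(2,1) v(2,1)]] by blast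
  then have "e = e2" using e e' v by blast
  then show ?thesis using e2 by simp
qed

lemma edge_surj:
  assumes e': "e' \<in> edges H"
  obtains e where "e \<in> edges G" "\<phi> ` edge_set G e = edge_set H e'"
proof -
  obtain v where "{v \<in> verts G. \<phi> v = src H e'} = {v}" using vertex_fibre[OF H.src_vert[OF e']] by blast
  then have v: "v \<in> verts G" "\<phi> v = src H e'" by blast+
  then have "\<phi> v \<in> {src H e', tgt H e'}" by simp
  then obtain e where "{e \<in> edges G. \<phi> ` edge_set G e = edge_set H e' \<and> v \<in> edge_set G e} = {e}"
    by (rule edge_fibre[OF e' v(1)])
  then have "e \<in> {e \<in> edges G. \<phi> ` edge_set G e = edge_set H e' \<and> v \<in> edge_set G e}" by simp
  then show ?thesis using that by blast
qed

text \<open>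
  An edge above \<open>e'\<close> contains a point above \<open>src H e'\<close>, which must be the only vertex above it; and at
  this vertex there is only one edge above \<open>e'\<close>.
\<close>

lemma edge_inj:
  assumes e1: "e1 \<in> edges G" "\<phi> ` edge_set G e1 = edge_set H e'"
    and e2: "e2 \<in> edges G" "\<phi> ` edge_set G e2 = edge_set H e'" and e': "e' \<in> edges H"
  shows "e1 = e2"
proof -
  obtain v where V: "{v \<in> verts G. \<phi> v = src H e'} = {v}" using vertex_fibre[OF H.src_vert[OF e']] by blast
  then have v: "v \<in> verts G" "\<phi> v = src H e'" by blast+
  have on: "v \<in> edge_set G e" if "e \<in> edges G" "\<phi> ` edge_set G e = edge_set H e'" for e
  proof -
    have "src H e' \<in> \<phi> ` edge_set G e" using H.ends_in_edge_set[OF e'] that(2) by auto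
    then obtain w where w: "w \<in> edge_set G e" "\<phi> w = src H e'" by auto
    then have "w \<in> verts G" using vertex_lift[OF that(1,2) e' w(1)] H.src_vert[OF e'] by auto
    then have "w = v" using w(2) V by blast
    then show ?thesis using w(1) by simp
  qed
  have "\<phi> v \<in> {src H e', tgt H e'}" using v(2) by simp
  then obtain e where e: "{e \<in> edges G. \<phi> ` edge_set G e = edge_set H e' \<and> v \<in> edge_set G e} = {e}"
    by (rule edge_fibre[OF e' v(1)])
  have "e1 \<in> {e}" "e2 \<in> {e}" unfolding e[symmetric] using e1 e2 on by auto
  then show ?thesis by simp
qed

lemma bij: "bij_betw \<phi> (points G) (points H)"
proof (rule bij_betw_imageI[OF inj_onI subset_antisym[OF subsetI subsetI]])
  fix x y assume x: "x \<in> points G" and y: "y \<in> points G" and eq: "\<phi> x = \<phi> y"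
  obtain e1 where e1: "e1 \<in> edges G" "x \<in> edge_set G e1" by (rule G.in_some_edge_set[OF nontrivial x])
  obtain e2 where e2: "e2 \<in> edges G" "y \<in> edge_set G e2" by (rule G.in_some_edge_set[OF nontrivial y])
  obtain e1' where e1': "e1' \<in> edges H" "\<phi> ` edge_set G e1 = edge_set H e1'" by (rule edge_image[OF e1(1)])
  obtain e2' where e2': "e2' \<in> edges H" "\<phi> ` edge_set G e2 = edge_set H e2'" by (rule edge_image[OF e2(1)])
  show "x = y"
  proof (cases "\<phi> x \<in> verts H")
    case True
    then have "x \<in> verts G" "y \<in> verts G"
      using vertex_lift[OF e1(1) e1'(2,1) e1(2)] vertex_lift[OF e2(1) e2'(2,1) e2(2)] eq by auto
    then show ?thesis using vertex_fibre[OF True] eq by (metis (mono_tags, lifting) mem_Collect_eq singletonD)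
  next
    case False
    have "\<phi> x \<in> edge_set H e1'" "\<phi> x \<in> edge_set H e2'" using e1 e2 e1' e2' eq by blast+
    then obtain s t where st: "s \<in> {0..len H e1'}" "t \<in> {0..len H e2'}" "chart H e1' s = \<phi> x" "chart H e2' t = \<phi> x"
      unfolding edge_set_def by auto
    have "s \<notin> {0, len H e1'}" using H.chart_vert_iff[OF e1'(1) st(1)] st(3) False by simp
    then have "e1' = e2'"
      using H.chart_eq_cases[OF e1'(1) st(1) e2'(1) st(2)] st(3,4) by metis
    then have "e1 = e2" using edge_inj[OF e1(1) _ e2(1)] e1' e2' by blast
    then show ?thesis using inj_onD[OF inj_on_edge[OF e1(1)] eq] e1 e2 by blast
  qed
next
  fix y assume "y \<in> \<phi> ` points G"
  then obtain x where x: "x \<in> points G" "y = \<phi> x" by auto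
  obtain e where e: "e \<in> edges G" "x \<in> edge_set G e" by (rule G.in_some_edge_set[OF nontrivial x(1)])
  obtain e' where "e' \<in> edges H" "\<phi> ` edge_set G e = edge_set H e'" by (rule edge_image[OF e(1)])
  then show "y \<in> points H" using H.edge_set_subset x e by blast
next
  fix y assume y: "y \<in> points H"
  then show "y \<in> \<phi> ` points G"
  proof (cases rule: H.pointsE)
    case 1
    then obtain v where "{v \<in> verts G. \<phi> v = y} = {v}" using vertex_fibre by blast
    then have "v \<in> verts G" "\<phi> v = y" by blast+
    then show ?thesis using G.verts_subset by blast
  next
    case (2 e' t)
    obtain e where e: "e \<in> edges G" "\<phi> ` edge_set G e = edge_set H e'" by (rule edge_surj[OF 2(1)])
    then have "y \<in> \<phi> ` edge_set G e" using H.chart_in_edge_set 2 by simp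
    then show ?thesis using G.edge_set_subset[OF e(1)] by blast
  qed
qed

text \<open>
  The morphism preserves distances within each edge, and so does its inverse because every edge of the
  target is the image of one edge.
\<close>

lemma distance_preserving:
  assumes "x \<in> points G" "y \<in> points G"
  shows "cdist H (\<phi> x) (\<phi> y) = cdist G x y"
proof (rule antisym)
  have edge: "cdist H (\<phi> x) (\<phi> y) = cdist G x y"
    if "e \<in> edges G" "x \<in> edge_set G e" "y \<in> edge_set G e" for e x y
    using edge_degree(2)[OF that] edge_degree_1[OF that(1)] by (simp add: one_ereal_def[symmetric])
  show "cdist H (\<phi> x) (\<phi> y) \<le> cdist G x y"
  proof (rule nonexpanding_if_on_edges)
    show "\<phi> \<in> points G \<rightarrow> points H" using bij by (simp add: bij_betw_imp_funcset)
    fix e s t assume e: "e \<in> edges G" "s \<in> {0..len G e}" "t \<in> {0..len G e}"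
    then show "cdist H (\<phi> (chart G e s)) (\<phi> (chart G e t)) \<le> \<bar>s - t\<bar>"
      using edge[OF e(1) G.chart_in_edge_set[OF e(2)] G.chart_in_edge_set[OF e(3)]] cdist_segment[OF e] by simp
  qed
  let ?\<theta> = "inv_into (points G) \<phi>"
  have inv: "?\<theta> (\<phi> z) = z" if "z \<in> points G" for z
    using bij_betw_inv_into_left[OF bij that] .
  have "cdist G (?\<theta> (\<phi> x)) (?\<theta> (\<phi> y)) \<le> cdist H (\<phi> x) (\<phi> y)"
  proof (rule nonexpanding_if_on_edges)
    show "?\<theta> \<in> points H \<rightarrow> points G" using bij_betw_inv_into[OF bij] by (simp add: bij_betw_imp_funcset)
    fix e' s t assume e': "e' \<in> edges H" "s \<in> {0..len H e'}" "t \<in> {0..len H e'}"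
    obtain e where e: "e \<in> edges G" "\<phi> ` edge_set G e = edge_set H e'" by (rule edge_surj[OF e'(1)])
    obtain p q where pq: "p \<in> edge_set G e" "q \<in> edge_set G e" "chart H e' s = \<phi> p" "chart H e' t = \<phi> q"
      using H.chart_in_edge_set[OF e'(2)] H.chart_in_edge_set[OF e'(3)] e(2) by (metis imageE)
    have "cdist G (?\<theta> (chart H e' s)) (?\<theta> (chart H e' t)) = cdist G p q"
      using pq inv G.edge_set_subset[OF e(1)] by simp
    also have "\<dots> = cdist H (chart H e' s) (chart H e' t)" using edge[OF e(1) pq(1,2)] pq by simp
    also have "\<dots> \<le> \<bar>s - t\<bar>" by (rule cdist_segment[OF e'])
    finally show "cdist G (?\<theta> (chart H e' s)) (?\<theta> (chart H e' t)) \<le> \<bar>s - t\<bar>" .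
  qed
  then show "cdist G x y \<le> cdist H (\<phi> x) (\<phi> y)" using inv assms by simp
qed

end

context tropical
begin

text \<open>
  A continuous bijection from a compact space to a Hausdorff space is a homeomorphism.
\<close>

lemma finite_harmonic_imp_isometry:
  assumes "finite_harmonic \<Gamma> \<Gamma> \<phi> 1"
  shows "isometry \<phi>"
proof -
  have cont: "continuous_map (curve_top \<Gamma>) (curve_top \<Gamma>) \<phi>" using assms by (simp add: finite_harmonic_def)
  then have maps: "\<phi> \<in> points \<Gamma> \<rightarrow> points \<Gamma>" by (simp add: continuous_map_def topspace_curve_top)
  have "bij_betw \<phi> (points \<Gamma>) (points \<Gamma>) \<and> (\<forall>x\<in>points \<Gamma>. \<forall>y\<in>points \<Gamma>. cdist \<Gamma> (\<phi> x) (\<phi> y) = cdist \<Gamma> x y)"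
  proof (cases "is_singleton (points \<Gamma>)")
    case True
    then obtain a where a: "points \<Gamma> = {a}" by (rule is_singletonE)
    then have "\<phi> a = a" using maps by auto
    then show ?thesis using a by (auto simp: bij_betw_def)
  next
    case False
    then obtain G H k m where *: "model_for \<Gamma> G" "loopless G" "model_for \<Gamma> H" "harmonic_on_models G H \<phi> k m"
      "\<forall>v'\<in>verts H. (\<Sum>v | v \<in> verts G \<and> \<phi> v = v'. m v) = 1"
      using assms unfolding finite_harmonic_def by auto
    have G: "points G = points \<Gamma>" "\<And>x y. x \<in> points \<Gamma> \<Longrightarrow> y \<in> points \<Gamma> \<Longrightarrow> cdist G x y = cdist \<Gamma> x y"
      and H: "points H = points \<Gamma>" "\<And>x y. x \<in> points \<Gamma> \<Longrightarrow> y \<in> points \<Gamma> \<Longrightarrow> cdist H x y = cdist \<Gamma> x y"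
      using * by (auto simp: model_for_def)
    interpret degree_one G H \<phi> k m
      using * False G(1) by unfold_locales (auto simp: model_for_def)
    show ?thesis
      using bij distance_preserving maps unfolding G(1) H(1)
      by (auto simp: G(2) H(2) Pi_iff)
  qed
  then show ?thesis
    unfolding isometry_def bij_betw_def
    using continuous_imp_homeomorphic_map[OF cont compact_space_curve Hausdorff_space_curve]
    by (simp add: topspace_curve_top)
qed

section \<open>Isometries are finite harmonic morphisms of degree one\<close>

text \<open>
  An edge of infinite length has no midpoint and is cut at distance one instead.
\<close>

definition mid :: "'e \<Rightarrow> ereal" where
  "mid e = (if len \<Gamma> e = \<infinity> then 1 else len \<Gamma> e / 2)"

lemma mid_props:
  assumes "e \<in> E"
  shows "0 < mid e" "mid e < len \<Gamma> e" "\<bar>mid e\<bar> \<noteq> \<infinity>" "mid e + (len \<Gamma> e - mid e) = len \<Gamma> e" "0 < len \<Gamma> e - mid e"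
proof -
  have "0 < mid e \<and> mid e < len \<Gamma> e \<and> \<bar>mid e\<bar> \<noteq> \<infinity> \<and> mid e + (len \<Gamma> e - mid e) = len \<Gamma> e \<and> 0 < len \<Gamma> e - mid e"
    using len_pos[OF assms] by (cases "len \<Gamma> e") (auto simp: mid_def one_ereal_def)
  then show "0 < mid e" "mid e < len \<Gamma> e" "\<bar>mid e\<bar> \<noteq> \<infinity>" "mid e + (len \<Gamma> e - mid e) = len \<Gamma> e" "0 < len \<Gamma> e - mid e"
    by auto
qed

definition code :: "'e \<Rightarrow> nat" where "code = (SOME f. inj_on f E)"

lemma inj_code: "inj_on code E"
  unfolding code_def using finite_imp_inj_to_nat_seg[OF finite_edges] by (metis (mono_tags, lifting) someI_ex)

text \<open>
  The two halves of \<open>e\<close> are numbered \<open>2 * code e\<close> and \<open>2 * code e + 1\<close>.  The half of infinite length is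
  the odd one, so that its point at infinity remains its \<open>tgt\<close>.
\<close>

definition base :: "nat \<Rightarrow> 'e" where "base n = inv_into E code (n div 2)"
definition offset :: "nat \<Rightarrow> ereal" where "offset n = (if even n then 0 else mid (base n))"

definition subdivision :: "('p, nat) curve" where
  "subdivision = \<lparr>verts = V \<union> (\<lambda>e. chart \<Gamma> e (mid e)) ` E,
     edges = {n. n div 2 \<in> code ` E},
     len = (\<lambda>n. if even n then mid (base n) else len \<Gamma> (base n) - mid (base n)),
     chart = (\<lambda>n t. chart \<Gamma> (base n) (offset n + t))\<rparr>"

lemma base_edge: "n \<in> edges subdivision \<Longrightarrow> base n \<in> E"
  unfolding subdivision_def base_def by (auto intro: inv_into_into)

lemma subdivision_edge:
  assumes "n \<in> edges subdivision"
  obtains "offset n = 0" "offset n + len subdivision n = mid (base n)" "even n"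
  | "offset n = mid (base n)" "offset n + len subdivision n = len \<Gamma> (base n)" "odd n"
  using mid_props[OF base_edge[OF assms]] by (cases "even n") (auto simp: subdivision_def offset_def)

lemma subdivision_len: "n \<in> edges subdivision \<Longrightarrow> 0 < len subdivision n"
  using mid_props[OF base_edge] by (auto simp: subdivision_def)

lemma chart_subdivision: "chart subdivision n t = chart \<Gamma> (base n) (offset n + t)"
  by (simp add: subdivision_def)

lemma verts_subdivision: "verts subdivision = V \<union> (\<lambda>e. chart \<Gamma> e (mid e)) ` E"
  by (simp add: subdivision_def)

lemma offset_fin: "n \<in> edges subdivision \<Longrightarrow> 0 \<le> offset n \<and> \<bar>offset n\<bar> \<noteq> \<infinity>"
  using mid_props[OF base_edge, of n] by (auto simp: offset_def)

lemma offset_inj: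
  assumes "n \<in> edges subdivision" "offset n + s = offset n + t"
  shows "s = t"
  using offset_fin[OF assms(1)] assms(2) by (cases "offset n"; cases s; cases t) auto

lemma offset_diff:
  assumes "n \<in> edges subdivision" "0 \<le> s" "0 \<le> t"
  shows "\<bar>(offset n + s) - (offset n + t)\<bar> = \<bar>s - t\<bar>"
  using offset_fin[OF assms(1)] assms(2,3) by (cases "offset n"; cases s; cases t) auto

lemma offset_range:
  assumes n: "n \<in> edges subdivision" and t: "t \<in> {0..len subdivision n}"
  shows "offset n + t \<in> {0..len \<Gamma> (base n)}"
proof -
  have "offset n + t \<le> offset n + len subdivision n" using t by (intro add_left_mono) auto
  also have "\<dots> \<le> len \<Gamma> (base n)"
    using mid_props(2)[OF base_edge[OF n]] by (cases rule: subdivision_edge[OF n]) auto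
  finally show ?thesis using t offset_fin[OF n] by auto
qed

lemma offset_interior:
  assumes n: "n \<in> edges subdivision" and t: "t \<in> {0<..<len subdivision n}"
  shows "offset n < offset n + t" "offset n + t < offset n + len subdivision n"
    "0 < offset n + t" "offset n + t < len \<Gamma> (base n)" "offset n + t \<noteq> mid (base n)"
proof -
  show 1: "offset n < offset n + t" 
    using offset_fin[OF n] t by (cases "offset n"; cases t) auto
  show 2: "offset n + t < offset n + len subdivision n"
    using offset_fin[OF n] t by (cases "offset n"; cases t; cases "len subdivision n") auto
  show "0 < offset n + t" using offset_fin[OF n] 1 by (auto intro: le_less_trans)
  show "offset n + t < len \<Gamma> (base n)"
    using 2 mid_props(2)[OF base_edge[OF n]] by (cases rule: subdivision_edge[OF n]) auto
  show "offset n + t \<noteq> mid (base n)"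
    using 1 2 by (cases rule: subdivision_edge[OF n]) auto
qed

lemma edge_eqI:
  assumes "n \<in> edges subdivision" "n' \<in> edges subdivision" "base n = base n'" "even n \<longleftrightarrow> even n'"
  shows "n = n'"
proof -
  have "n div 2 \<in> code ` E" "n' div 2 \<in> code ` E" using assms by (auto simp: subdivision_def)
  then have "n div 2 = n' div 2" using assms(3) unfolding base_def by (metis f_inv_into_f)
  then show ?thesis using assms(4) by (metis div_mult_mod_eq even_iff_mod_2_eq_zero odd_iff_mod_2_eq_one)
qed

lemma halves:
  assumes "e \<in> E"
  obtains n n' where "n \<in> edges subdivision" "base n = e" "offset n = 0" "len subdivision n = mid e"
    "n' \<in> edges subdivision" "base n' = e" "offset n' = mid e" "len subdivision n' = len \<Gamma> e - mid e"
proof -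
  have b: "base (2 * code e) = e" "base (2 * code e + 1) = e"
    using inv_into_f_f[OF inj_code assms] by (auto simp: base_def)
  then show ?thesis
    using that[of "2 * code e" "2 * code e + 1"] assms by (auto simp: subdivision_def offset_def)
qed

lemma points_subdivision: "points subdivision = points \<Gamma>"
proof (intro subset_antisym subsetI)
  fix x assume "x \<in> points subdivision"
  then consider "x \<in> verts subdivision" | n t where "n \<in> edges subdivision" "t \<in> {0..len subdivision n}" "x = chart subdivision n t"
    unfolding points_def edge_set_def by blast
  then show "x \<in> points \<Gamma>"
  proof cases
    case 1
    then consider "x \<in> V" | e where "e \<in> E" "x = chart \<Gamma> e (mid e)" by (auto simp: verts_subdivision)
    then show ?thesis
    proof cases
      case 2
      then show ?thesis using chart_in_points[of e \<Gamma> "mid e"] mid_props(1,2)[OF 2(1)] by (simp add: less_imp_le)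
    qed (use verts_subset in auto)
  next
    case 2
    then show ?thesis using chart_in_points[OF base_edge[OF 2(1)] offset_range[OF 2(1,2)]] by (simp add: chart_subdivision)
  qed
next
  fix x assume "x \<in> points \<Gamma>"
  then show "x \<in> points subdivision"
  proof (cases rule: pointsE)
    case 1
    then show ?thesis by (auto simp: points_def verts_subdivision)
  next
    case (2 e t)
    obtain n n' where n: "n \<in> edges subdivision" "base n = e" "offset n = 0" "len subdivision n = mid e"
      "n' \<in> edges subdivision" "base n' = e" "offset n' = mid e" "len subdivision n' = len \<Gamma> e - mid e"
      using halves[OF 2(1)] .
    show ?thesis
    proof (cases "t \<le> mid e")
      case True
      then show ?thesis using chart_in_points[OF n(1), of t] n 2 by (simp add: chart_subdivision)
    next
      case False
      have "mid e + (t - mid e) = t" "t - mid e \<in> {0..len \<Gamma> e - mid e}"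
        using False mid_props[OF 2(1)] 2(2) by (cases t; cases "mid e"; cases "len \<Gamma> e"; auto)+
      then show ?thesis using chart_in_points[OF n(5), of "t - mid e"] n 2 by (simp add: chart_subdivision)
    qed
  qed
qed

lemma ends_subdivision:
  "src subdivision n = chart \<Gamma> (base n) (offset n)"
  "tgt subdivision n = chart \<Gamma> (base n) (offset n + len subdivision n)"
  by (simp_all add: src_def tgt_def chart_subdivision)

lemma connected_subdivision:
  assumes "u \<in> verts subdivision" "v \<in> verts subdivision"
  shows "(u, v) \<in> (adjacent subdivision)\<^sup>*"
proof -
  let ?A = "adjacent subdivision"
  have half: "(src \<Gamma> e, chart \<Gamma> e (mid e)) \<in> ?A" "(chart \<Gamma> e (mid e), src \<Gamma> e) \<in> ?A"
    "(tgt \<Gamma> e, chart \<Gamma> e (mid e)) \<in> ?A" "(chart \<Gamma> e (mid e), tgt \<Gamma> e) \<in> ?A" if e: "e \<in> E" for e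
  proof -
    obtain n n' where n: "n \<in> edges subdivision" "base n = e" "offset n = 0" "len subdivision n = mid e"
      "n' \<in> edges subdivision" "base n' = e" "offset n' = mid e" "len subdivision n' = len \<Gamma> e - mid e"
      using halves[OF e] .
    have "src subdivision n = src \<Gamma> e" "tgt subdivision n = chart \<Gamma> e (mid e)"
      "src subdivision n' = chart \<Gamma> e (mid e)" "tgt subdivision n' = tgt \<Gamma> e"
      using n mid_props(4)[OF e] by (simp_all add: ends_subdivision) (simp_all add: src_def tgt_def)
    then show "(src \<Gamma> e, chart \<Gamma> e (mid e)) \<in> ?A" "(chart \<Gamma> e (mid e), src \<Gamma> e) \<in> ?A"
      "(tgt \<Gamma> e, chart \<Gamma> e (mid e)) \<in> ?A" "(chart \<Gamma> e (mid e), tgt \<Gamma> e) \<in> ?A"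
      using n(1,5) unfolding adjacent_def by force+
  qed
  have "(src \<Gamma> e, tgt \<Gamma> e) \<in> ?A\<^sup>*" "(tgt \<Gamma> e, src \<Gamma> e) \<in> ?A\<^sup>*" if "e \<in> E" for e
    using rtrancl_trans[OF r_into_rtrancl[OF half(1)[OF that]] r_into_rtrancl[OF half(4)[OF that]]]
      rtrancl_trans[OF r_into_rtrancl[OF half(3)[OF that]] r_into_rtrancl[OF half(2)[OF that]]] by auto
  then have "adjacent \<Gamma> \<subseteq> ?A\<^sup>*"
    unfolding adjacent_def[of \<Gamma>] by blast
  then have sub: "(adjacent \<Gamma>)\<^sup>* \<subseteq> ?A\<^sup>*" by (rule rtrancl_subset_rtrancl)
  have near: "\<exists>w\<in>V. (u, w) \<in> ?A\<^sup>* \<and> (w, u) \<in> ?A\<^sup>*" if "u \<in> verts subdivision" for u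
    using that half src_vert unfolding verts_subdivision by blast
  obtain w w' where "w \<in> V" "(u, w) \<in> ?A\<^sup>*" "w' \<in> V" "(w', v) \<in> ?A\<^sup>*"
    using near assms by meson
  then show ?thesis using connected[of w w'] sub by (meson rtrancl_trans subsetD)
qed

lemma tropical_subdivision: "tropical_curve subdivision"
  unfolding tropical_curve_def
proof (intro conjI ballI impI)
  show "finite (verts subdivision)" using finite_verts finite_edges by (simp add: verts_subdivision)
  show "verts subdivision \<noteq> {}" using verts_nonempty by (simp add: verts_subdivision)
  have "edges subdivision \<subseteq> (\<lambda>i. 2 * i) ` code ` E \<union> (\<lambda>i. 2 * i + 1) ` code ` E"
  proof
    fix n assume "n \<in> edges subdivision"
    then have "n div 2 \<in> code ` E" by (simp add: subdivision_def)
    moreover have "n = 2 * (n div 2) \<or> n = 2 * (n div 2) + 1" by presburger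
    ultimately show "n \<in> (\<lambda>i. 2 * i) ` code ` E \<union> (\<lambda>i. 2 * i + 1) ` code ` E" by blast
  qed
  then show fin: "finite (edges subdivision)" using finite_edges by (auto intro: finite_subset)
  show "(u, v) \<in> (adjacent subdivision)\<^sup>*" if "u \<in> verts subdivision" "v \<in> verts subdivision" for u v
    using connected_subdivision that .
  fix n assume n: "n \<in> edges subdivision"
  note bn = base_edge[OF n]
  show "0 < len subdivision n" by (rule subdivision_len[OF n])
  have V: "src \<Gamma> (base n) = chart \<Gamma> (base n) 0" "tgt \<Gamma> (base n) = chart \<Gamma> (base n) (len \<Gamma> (base n))"
    by (simp_all add: src_def tgt_def)
  show "src subdivision n \<in> verts subdivision" "tgt subdivision n \<in> verts subdivision"
    using src_vert[OF bn] tgt_vert[OF bn] bn V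
    by (cases rule: subdivision_edge[OF n]; simp add: ends_subdivision verts_subdivision)+
  show "inj_on (chart subdivision n) {0<..<len subdivision n}"
  proof (rule inj_onI)
    fix s t assume st: "s \<in> {0<..<len subdivision n}" "t \<in> {0<..<len subdivision n}"
      "chart subdivision n s = chart subdivision n t"
    then have "offset n + s = offset n + t"
      using inj_onD[OF inj_interior[OF bn], of "offset n + s" "offset n + t"]
        offset_interior(3,4)[OF n st(1)] offset_interior(3,4)[OF n st(2)] by (simp add: chart_subdivision)
    then show "s = t" by (rule offset_inj[OF n])
  qed
  show "edge_interior subdivision n \<inter> verts subdivision = {}"
  proof (rule ccontr)
    assume "edge_interior subdivision n \<inter> verts subdivision \<noteq> {}"
    then obtain t where t: "t \<in> {0<..<len subdivision n}" "chart subdivision n t \<in> verts subdivision"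
      unfolding edge_interior_def by blast
    note o = offset_interior[OF n t(1)]
    have r: "offset n + t \<in> {0..len \<Gamma> (base n)}" using o by auto
    have "chart \<Gamma> (base n) (offset n + t) \<notin> V" using chart_vert_iff[OF bn r] o by auto
    then obtain e where e: "e \<in> E" "chart \<Gamma> (base n) (offset n + t) = chart \<Gamma> e (mid e)"
      using t(2) by (auto simp: chart_subdivision verts_subdivision)
    have m: "mid e \<in> {0..len \<Gamma> e}" using mid_props(1,2)[OF e(1)] by (simp add: less_imp_le)
    show False
      by (cases rule: chart_eq_cases[OF bn r e(1) m e(2)]) (use o in auto)
  qed
next
  fix n n' assume n: "n \<in> edges subdivision" and n': "n' \<in> edges subdivision" and ne: "n \<noteq> n'"
  show "edge_interior subdivision n \<inter> edge_interior subdivision n' = {}"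
  proof (rule ccontr)
    assume "edge_interior subdivision n \<inter> edge_interior subdivision n' \<noteq> {}"
    then obtain s t where st: "s \<in> {0<..<len subdivision n}" "t \<in> {0<..<len subdivision n'}"
      "chart subdivision n s = chart subdivision n' t"
      unfolding edge_interior_def by fastforce
    note o = offset_interior[OF n st(1)] and o' = offset_interior[OF n' st(2)]
    have r: "offset n + s \<in> {0..len \<Gamma> (base n)}" "offset n' + t \<in> {0..len \<Gamma> (base n')}" using o o' by auto
    have st': "chart \<Gamma> (base n) (offset n + s) = chart \<Gamma> (base n') (offset n' + t)"
      using st(3) by (simp add: chart_subdivision)
    have "base n = base n' \<and> offset n + s = offset n' + t"
      by (cases rule: chart_eq_cases[OF base_edge[OF n] r(1) base_edge[OF n'] r(2) st']) (use o in auto)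
    then have eq: "base n = base n'" "offset n + s = offset n' + t" by auto
    have "even n \<longleftrightarrow> even n'"
      using o(1,2) o'(1,2) eq
      by (cases rule: subdivision_edge[OF n]; cases rule: subdivision_edge[OF n']) auto
    then show False using edge_eqI[OF n n' eq(1)] ne by simp
  qed
next
  fix n assume n: "n \<in> edges subdivision" and inf: "len subdivision n = \<infinity>"
  have bn: "base n \<in> E" by (rule base_edge[OF n])
  have upper: "offset n = mid (base n)" "offset n + len subdivision n = len \<Gamma> (base n)"
  proof -
    have "offset n = mid (base n) \<and> offset n + len subdivision n = len \<Gamma> (base n)"
    proof (cases rule: subdivision_edge[OF n])
      case 1
      then have "mid (base n) = \<infinity>" using inf by simp
      then show ?thesis using mid_props(3)[OF bn] by simp
    qed simp
    then show "offset n = mid (base n)" "offset n + len subdivision n = len \<Gamma> (base n)" by blast+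
  qed
  have li: "len \<Gamma> (base n) = \<infinity>"
    using upper inf mid_props(3)[OF bn] by (cases "mid (base n)") auto
  have tgt: "tgt subdivision n = tgt \<Gamma> (base n)" unfolding ends_subdivision upper(2) by (simp add: tgt_def)
  have S: "{n' \<in> edges subdivision. src subdivision n' = tgt subdivision n} = {}"
  proof -
    have False if n': "n' \<in> edges subdivision" and eq: "src subdivision n' = tgt subdivision n" for n'
    proof -
      have "offset n' \<in> {0..len \<Gamma> (base n')}"
        using offset_range[OF n', of 0] subdivision_len[OF n'] by simp
      then have "offset n' = \<infinity>"
        using infinite_end[OF bn li base_edge[OF n']] eq tgt by (simp add: ends_subdivision)
      then show False using offset_fin[OF n'] by simp
    qed
    then show ?thesis by blast
  qed
  have T: "{n' \<in> edges subdivision. tgt subdivision n' = tgt subdivision n} = {n}"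
  proof -
    have "n' = n" if n': "n' \<in> edges subdivision" and eq: "tgt subdivision n' = tgt subdivision n" for n'
    proof -
      have r: "offset n' + len subdivision n' \<in> {0..len \<Gamma> (base n')}"
        using offset_range[OF n', of "len subdivision n'"] subdivision_len[OF n'] by simp
      have eq': "chart \<Gamma> (base n') (offset n' + len subdivision n') = tgt \<Gamma> (base n)"
        using eq tgt by (simp only: ends_subdivision)
      have *: "base n' = base n" "offset n' + len subdivision n' = \<infinity>"
        using infinite_end[OF bn li base_edge[OF n'] r eq'] by blast+
      have "odd n'" using *(2) mid_props(3)[OF base_edge[OF n']] by (cases rule: subdivision_edge[OF n']) auto
      moreover have "odd n"
        using upper(1) mid_props(1)[OF bn] by (cases rule: subdivision_edge[OF n]) auto
      ultimately show ?thesis using edge_eqI[OF n' n *(1)] by simp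
    qed
    then show ?thesis using n by blast
  qed
  show "valence subdivision (tgt subdivision n) = 1" unfolding valence_def S T by simp
qed

lemma loopless_subdivision: "loopless subdivision"
  unfolding loopless_def
proof
  fix n assume n: "n \<in> edges subdivision"
  note bn = base_edge[OF n]
  show "src subdivision n \<noteq> tgt subdivision n"
  proof
    assume eq: "src subdivision n = tgt subdivision n"
    have r: "offset n \<in> {0..len \<Gamma> (base n)}" "offset n + len subdivision n \<in> {0..len \<Gamma> (base n)}"
      using offset_range[OF n, of 0] offset_range[OF n, of "len subdivision n"] subdivision_len[OF n] by simp_all
    have ne: "offset n \<noteq> offset n + len subdivision n"
      using offset_inj[OF n, of 0 "len subdivision n"] subdivision_len[OF n] by auto
    have eq': "chart \<Gamma> (base n) (offset n) = chart \<Gamma> (base n) (offset n + len subdivision n)"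
      using eq by (simp add: ends_subdivision)
    have "offset n \<in> {0, len \<Gamma> (base n)} \<and> offset n + len subdivision n \<in> {0, len \<Gamma> (base n)}"
      by (cases rule: chart_eq_cases[OF bn r(1) bn r(2) eq']) (use ne in auto)
    then show False using mid_props(1,2)[OF bn] by (cases rule: subdivision_edge[OF n]) auto
  qed
qed

text \<open>
  Segments of the subdivision are segments of the curve; a segment of the curve that contains a midpoint
  is split there.
\<close>

lemma cdist_subdivision: "cdist subdivision x y = cdist \<Gamma> x y"
proof (rule antisym)
  have "cdist \<Gamma> ((\<lambda>x. x) x) ((\<lambda>x. x) y) \<le> cdist subdivision x y"
  proof (rule nonexpanding_if_on_edges)
    fix n s t assume n: "n \<in> edges subdivision" and st: "s \<in> {0..len subdivision n}" "t \<in> {0..len subdivision n}"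
    show "cdist \<Gamma> (chart subdivision n s) (chart subdivision n t) \<le> \<bar>s - t\<bar>"
      using cdist_segment[OF base_edge[OF n] offset_range[OF n st(1)] offset_range[OF n st(2)]]
        offset_diff[OF n, of s t] st by (simp add: chart_subdivision)
  qed (simp add: points_subdivision)
  then show "cdist \<Gamma> x y \<le> cdist subdivision x y" by simp
  have "cdist subdivision ((\<lambda>x. x) x) ((\<lambda>x. x) y) \<le> cdist \<Gamma> x y"
  proof (rule nonexpanding_if_on_edges)
    fix e s t assume e: "e \<in> E" and st: "s \<in> {0..len \<Gamma> e}" "t \<in> {0..len \<Gamma> e}"
    obtain n n' where n: "n \<in> edges subdivision" "base n = e" "offset n = 0" "len subdivision n = mid e"
      "n' \<in> edges subdivision" "base n' = e" "offset n' = mid e" "len subdivision n' = len \<Gamma> e - mid e"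
      using halves[OF e] .
    let ?d = "\<lambda>s t. cdist subdivision (chart \<Gamma> e s) (chart \<Gamma> e t)"
    have low: "?d s t \<le> \<bar>s - t\<bar>" if "0 \<le> s" "s \<le> mid e" "0 \<le> t" "t \<le> mid e" for s t
      using cdist_segment[OF n(1), of s t] that n by (simp add: chart_subdivision)
    have up: "?d s t \<le> \<bar>s - t\<bar>" if "mid e \<le> s" "s \<le> len \<Gamma> e" "mid e \<le> t" "t \<le> len \<Gamma> e" for s t
    proof -
      have "mid e + (u - mid e) = u \<and> u - mid e \<in> {0..len \<Gamma> e - mid e}" if "mid e \<le> u" "u \<le> len \<Gamma> e" for u
        using that mid_props[OF e] by (cases u; cases "mid e"; cases "len \<Gamma> e") auto
      then have "?d s t \<le> \<bar>(s - mid e) - (t - mid e)\<bar>"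
        using cdist_segment[OF n(5), of "s - mid e" "t - mid e"] that n by (simp add: chart_subdivision)
      also have "\<dots> = \<bar>s - t\<bar>" using that mid_props(1,3)[OF e] by (cases s; cases t; cases "mid e") auto
      finally show ?thesis .
    qed
    have across: "?d s t \<le> \<bar>s - t\<bar>" if "0 \<le> s" "s \<le> mid e" "mid e \<le> t" "t \<le> len \<Gamma> e" for s t
    proof -
      have "?d s t \<le> ?d s (mid e) + ?d (mid e) t" by (rule cdist_triangle)
      also have "\<dots> \<le> \<bar>s - mid e\<bar> + \<bar>mid e - t\<bar>"
        using low[of s "mid e"] up[of "mid e" t] that mid_props(1,2)[OF e] by (intro add_mono) auto
      also have "\<dots> = \<bar>s - t\<bar>" using that mid_props(1,3)[OF e] by (cases s; cases t; cases "mid e") auto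
      finally show ?thesis .
    qed
    show "?d s t \<le> \<bar>s - t\<bar>"
      using low[of s t] up[of s t] across[of s t] across[of t s] st
        cdist_sym[of subdivision "chart \<Gamma> e s"] ereal_abs_minus_commute[of s t]
      by (cases "s \<le> mid e"; cases "t \<le> mid e") auto
  qed (simp add: points_subdivision)
  then show "cdist subdivision x y \<le> cdist \<Gamma> x y" by simp
qed

text \<open>
  The identity is continuous from the subdivision, since its charts are restrictions of the old ones;
  by compactness it is a homeomorphism.
\<close>

lemma curve_top_subdivision: "curve_top subdivision = curve_top \<Gamma>"
proof -
  interpret S: tropical subdivision by unfold_locales (rule tropical_subdivision)
  have "continuous_map (curve_top subdivision) (curve_top \<Gamma>) id"
    unfolding continuous_map_curve[of subdivision]
  proof (intro conjI ballI)
    fix n assume n: "n \<in> edges subdivision"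
    have "continuous_on {0..len subdivision n} (\<lambda>t. offset n + t)"
      unfolding continuous_on_def
      by (intro ballI tendsto_add_ereal_general tendsto_const tendsto_ident_at) (use offset_fin[OF n] in auto)
    then have "continuous_map (top_of_set {0..len subdivision n}) (top_of_set {0..len \<Gamma> (base n)}) (\<lambda>t. offset n + t)"
      using offset_range[OF n] by auto
    from continuous_map_compose[OF this continuous_map_chart[OF base_edge[OF n]]]
    show "continuous_map (top_of_set {0..len subdivision n}) (curve_top \<Gamma>) (\<lambda>t. id (chart subdivision n t))"
      by (simp add: comp_def chart_subdivision)
  qed (auto simp: points_subdivision topspace_curve_top)
  then have "homeomorphic_map (curve_top subdivision) (curve_top \<Gamma>) id"
    by (rule continuous_imp_homeomorphic_map[OF _ S.compact_space_curve Hausdorff_space_curve])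
       (simp_all add: topspace_curve_top points_subdivision)
  then show ?thesis by simp
qed

lemma model_subdivision: "model_for \<Gamma> subdivision"
  using tropical_subdivision points_subdivision curve_top_subdivision cdist_subdivision
  by (simp add: model_for_def)

end

text \<open>
  Relative to a graph \<open>G\<close> on the source and its image \<open>push \<phi> G\<close> on the target, an isometry \<open>\<phi>\<close> is
  the identity on edges, with all degrees equal to one.
\<close>

definition push :: "('p \<Rightarrow> 'p) \<Rightarrow> ('p, 'e) curve \<Rightarrow> ('p, 'e) curve" where
  "push \<phi> G = \<lparr>verts = \<phi> ` verts G, edges = edges G, len = len G, chart = (\<lambda>e t. \<phi> (chart G e t))\<rparr>"

lemma push_simps [simp]:
  "verts (push \<phi> G) = \<phi> ` verts G" "edges (push \<phi> G) = edges G" "len (push \<phi> G) = len G"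
  "chart (push \<phi> G) e = (\<lambda>t. \<phi> (chart G e t))"
  "src (push \<phi> G) e = \<phi> (src G e)" "tgt (push \<phi> G) e = \<phi> (tgt G e)"
  "edge_set (push \<phi> G) e = \<phi> ` edge_set G e" "edge_interior (push \<phi> G) e = \<phi> ` edge_interior G e"
  by (auto simp: push_def src_def tgt_def edge_set_def edge_interior_def)

lemma points_push: "points (push \<phi> G) = \<phi> ` points G"
  by (auto simp: points_def)

context tropical
begin

lemma edge_interior_subset: "e \<in> E \<Longrightarrow> edge_interior \<Gamma> e \<subseteq> points \<Gamma>"
  using chart_in_points[of e \<Gamma>] by (auto simp: edge_interior_def less_imp_le)

lemma tropical_push:
  assumes inj: "inj_on \<phi> (points \<Gamma>)"
  shows "tropical_curve (push \<phi> \<Gamma>)"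
proof -
  have disj: "\<phi> ` A \<inter> \<phi> ` B = {}" if "A \<subseteq> points \<Gamma>" "B \<subseteq> points \<Gamma>" "A \<inter> B = {}" for A B
    using inj_on_image_Int[OF inj that(1,2)] that(3) by simp
  have conn: "(\<phi> u, \<phi> v) \<in> (adjacent (push \<phi> \<Gamma>))\<^sup>*" if "(u, v) \<in> (adjacent \<Gamma>)\<^sup>*" for u v
    using that
  proof (induction rule: rtrancl_induct)
    case (step y z)
    then have "(\<phi> y, \<phi> z) \<in> adjacent (push \<phi> \<Gamma>)" by (auto simp: adjacent_def)
    then show ?case using step by (meson rtrancl.rtrancl_into_rtrancl)
  qed simp
  have val: "valence (push \<phi> \<Gamma>) (\<phi> v) = valence \<Gamma> v" if v: "v \<in> points \<Gamma>" for v
  proof -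
    have "\<phi> (src \<Gamma> e) = \<phi> v \<longleftrightarrow> src \<Gamma> e = v" "\<phi> (tgt \<Gamma> e) = \<phi> v \<longleftrightarrow> tgt \<Gamma> e = v" if "e \<in> E" for e
      using inj_on_eq_iff[OF inj _ v] src_vert[OF that] tgt_vert[OF that] verts_subset by blast+
    then have "{e \<in> E. \<phi> (src \<Gamma> e) = \<phi> v} = {e \<in> E. src \<Gamma> e = v}" "{e \<in> E. \<phi> (tgt \<Gamma> e) = \<phi> v} = {e \<in> E. tgt \<Gamma> e = v}"
      by auto
    then show ?thesis by (simp add: valence_def)
  qed
  show ?thesis
    unfolding tropical_curve_def push_simps
  proof (intro conjI ballI impI)
    fix u v assume "u \<in> \<phi> ` V" "v \<in> \<phi> ` V"
    then show "(u, v) \<in> (adjacent (push \<phi> \<Gamma>))\<^sup>*" using conn connected by auto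
  next
    fix e assume e: "e \<in> E"
    show "inj_on (\<lambda>t. \<phi> (chart \<Gamma> e t)) {0<..<len \<Gamma> e}"
    proof (rule inj_onI)
      fix s t assume st: "s \<in> {0<..<len \<Gamma> e}" "t \<in> {0<..<len \<Gamma> e}"
        "\<phi> (chart \<Gamma> e s) = \<phi> (chart \<Gamma> e t)"
      then have "chart \<Gamma> e s \<in> points \<Gamma>" "chart \<Gamma> e t \<in> points \<Gamma>"
        using chart_in_points[OF e] by (auto simp: less_imp_le)
      then have "chart \<Gamma> e s = chart \<Gamma> e t" using st(3) inj_onD[OF inj] by simp
      then show "s = t" using inj_onD[OF inj_interior[OF e]] st by blast
    qed
    show "\<phi> ` edge_interior \<Gamma> e \<inter> \<phi> ` V = {}"
      by (rule disj[OF edge_interior_subset[OF e] verts_subset interior_verts[OF e]])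
  next
    fix e e' assume e: "e \<in> E" "e' \<in> E" "e \<noteq> e'"
    show "\<phi> ` edge_interior \<Gamma> e \<inter> \<phi> ` edge_interior \<Gamma> e' = {}"
      by (rule disj[OF edge_interior_subset[OF e(1)] edge_interior_subset[OF e(2)] interior_disjoint[OF e]])
  next
    fix e assume e: "e \<in> E" "len \<Gamma> e = \<infinity>"
    show "valence (push \<phi> \<Gamma>) (\<phi> (tgt \<Gamma> e)) = 1"
      using val[of "tgt \<Gamma> e"] valence_infinite[OF e] tgt_vert[OF e(1)] verts_subset by auto
  qed (use finite_verts verts_nonempty finite_edges len_pos src_vert tgt_vert in auto)
qed

lemma cdist_push:
  assumes inj: "inj_on \<phi> (points \<Gamma>)" and x: "x \<in> points \<Gamma>" and y: "y \<in> points \<Gamma>"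
  shows "cdist (push \<phi> \<Gamma>) (\<phi> x) (\<phi> y) = cdist \<Gamma> x y"
proof (rule antisym)
  show "cdist (push \<phi> \<Gamma>) (\<phi> x) (\<phi> y) \<le> cdist \<Gamma> x y"
  proof (rule nonexpanding_if_on_edges)
    fix e s t assume "e \<in> E" "s \<in> {0..len \<Gamma> e}" "t \<in> {0..len \<Gamma> e}"
    then show "cdist (push \<phi> \<Gamma>) (\<phi> (chart \<Gamma> e s)) (\<phi> (chart \<Gamma> e t)) \<le> \<bar>s - t\<bar>"
      using cdist_segment[of e "push \<phi> \<Gamma>" s t] by simp
  qed (auto simp: points_push)
  let ?\<theta> = "inv_into (points \<Gamma>) \<phi>"
  have inv: "?\<theta> (\<phi> z) = z" if "z \<in> points \<Gamma>" for z
    by (rule inv_into_f_f[OF inj that])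
  have "cdist \<Gamma> (?\<theta> (\<phi> x)) (?\<theta> (\<phi> y)) \<le> cdist (push \<phi> \<Gamma>) (\<phi> x) (\<phi> y)"
  proof (rule nonexpanding_if_on_edges)
    fix e s t assume "e \<in> edges (push \<phi> \<Gamma>)" "s \<in> {0..len (push \<phi> \<Gamma>) e}" "t \<in> {0..len (push \<phi> \<Gamma>) e}"
    then have e: "e \<in> E" "s \<in> {0..len \<Gamma> e}" "t \<in> {0..len \<Gamma> e}" by simp_all
    then show "cdist \<Gamma> (?\<theta> (chart (push \<phi> \<Gamma>) e s)) (?\<theta> (chart (push \<phi> \<Gamma>) e t)) \<le> \<bar>s - t\<bar>"
      using cdist_segment[OF e] inv[OF chart_in_points[OF e(1,2)]] inv[OF chart_in_points[OF e(1,3)]] by simp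
  qed (auto simp: points_push inv)
  then show "cdist \<Gamma> x y \<le> cdist (push \<phi> \<Gamma>) (\<phi> x) (\<phi> y)" using inv x y by simp
qed

lemma openin_push:
  assumes "U \<subseteq> \<phi> ` points \<Gamma>"
  shows "openin (curve_top (push \<phi> \<Gamma>)) U \<longleftrightarrow> openin (curve_top \<Gamma>) {x \<in> points \<Gamma>. \<phi> x \<in> U}"
proof -
  have "{t \<in> {0..len \<Gamma> e}. \<phi> (chart \<Gamma> e t) \<in> U} = {t \<in> {0..len \<Gamma> e}. chart \<Gamma> e t \<in> {x \<in> points \<Gamma>. \<phi> x \<in> U}}"
    if "e \<in> E" for e
    using chart_in_points[OF that] by auto
  then show ?thesis
    using assms unfolding openin_curve_top push_simps points_push by auto
qed

lemma model_push:
  assumes G: "model_for \<Gamma> G" and \<phi>: "isometry \<phi>"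
  shows "model_for \<Gamma> (push \<phi> G)"
proof -
  interpret G: tropical G using G by unfold_locales (simp add: model_for_def)
  have P: "points G = points \<Gamma>" and top: "curve_top G = curve_top \<Gamma>"
    and d: "\<And>x y. x \<in> points \<Gamma> \<Longrightarrow> y \<in> points \<Gamma> \<Longrightarrow> cdist G x y = cdist \<Gamma> x y"
    using G by (auto simp: model_for_def)
  have inj: "inj_on \<phi> (points \<Gamma>)" and im: "\<phi> ` points \<Gamma> = points \<Gamma>"
    using isometry_bij[OF \<phi>] by (auto simp: bij_betw_def)
  show ?thesis
    unfolding model_for_def
  proof (intro conjI ballI)
    show "tropical_curve (push \<phi> G)" using G.tropical_push inj P by simp
    show pts: "points (push \<phi> G) = points \<Gamma>" by (simp add: points_push P im)
    show "curve_top (push \<phi> G) = curve_top \<Gamma>"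
      unfolding topology_eq
    proof
      fix U
      show "openin (curve_top (push \<phi> G)) U \<longleftrightarrow> openin (curve_top \<Gamma>) U"
      proof (cases "U \<subseteq> points \<Gamma>")
        case True
        have "homeomorphic_map (curve_top \<Gamma>) (curve_top \<Gamma>) \<phi>" using \<phi> by (simp add: isometry_def)
        then have "openin (curve_top \<Gamma>) (\<phi> ` {x \<in> points \<Gamma>. \<phi> x \<in> U}) \<longleftrightarrow> openin (curve_top \<Gamma>) {x \<in> points \<Gamma>. \<phi> x \<in> U}"
          by (rule homeomorphic_map_openness) (auto simp: topspace_curve_top)
        moreover have "\<phi> ` {x \<in> points \<Gamma>. \<phi> x \<in> U} = \<phi> ` points \<Gamma> \<inter> U" by auto
        moreover have "\<phi> ` points \<Gamma> \<inter> U = U" unfolding im using True by auto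
        ultimately show ?thesis using G.openin_push[of U \<phi>] True by (simp add: P im top)
      next
        case False
        then show ?thesis using openin_subset[of "curve_top (push \<phi> G)" U] openin_subset[of "curve_top \<Gamma>" U] pts
          by (auto simp: topspace_curve_top)
      qed
    qed
    fix x y assume "x \<in> points \<Gamma>" "y \<in> points \<Gamma>"
    then have "x \<in> \<phi> ` points \<Gamma>" "y \<in> \<phi> ` points \<Gamma>" using im by simp_all
    then obtain p q where pq: "p \<in> points \<Gamma>" "q \<in> points \<Gamma>" "x = \<phi> p" "y = \<phi> q" by auto
    then show "cdist (push \<phi> G) x y = cdist \<Gamma> x y"
      using G.cdist_push[of \<phi> p q] inj P d[OF pq(1,2)] \<phi> by (simp add: isometry_def)
  qed
qed

lemma isometry_imp_finite_harmonic:
  assumes \<phi>: "isometry \<phi>"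
  shows "finite_harmonic \<Gamma> \<Gamma> \<phi> 1"
proof -
  let ?G = subdivision
  let ?H = "push \<phi> ?G"
  have inj: "inj_on \<phi> (points \<Gamma>)" and im: "\<phi> ` points \<Gamma> = points \<Gamma>"
    using isometry_bij[OF \<phi>] by (auto simp: bij_betw_def)
  note G = model_subdivision
  interpret G: tropical ?G by unfold_locales (rule tropical_subdivision)
  have pts: "points ?G = points \<Gamma>" by (rule points_subdivision)
  have H: "model_for \<Gamma> ?H" by (rule model_push[OF G \<phi>])
  have ends: "src ?G e \<in> points \<Gamma>" "tgt ?G e \<in> points \<Gamma>" if "e \<in> edges ?G" for e
    using G.src_vert[OF that] G.tgt_vert[OF that] G.verts_subset pts by auto
  have ll: "loopless ?H"
    using loopless_subdivision inj_on_eq_iff[OF inj] ends by (simp add: loopless_def)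
  have harm: "harmonic_on_models ?G ?H \<phi> (\<lambda>_. 1) (\<lambda>_. 1)"
    unfolding harmonic_on_models_def
  proof (intro conjI ballI impI)
    fix e assume e: "e \<in> edges ?G"
    show "\<exists>e'\<in>edges ?H. \<phi> ` edge_set ?G e = edge_set ?H e'" using e by auto
    fix x y assume "x \<in> edge_set ?G e" "y \<in> edge_set ?G e"
    then have "x \<in> points ?G" "y \<in> points ?G" using G.edge_set_subset[OF e] by auto
    then show "cdist ?H (\<phi> x) (\<phi> y) = ereal (real 1) * cdist ?G x y"
      using G.cdist_push[of \<phi> x y] inj pts by (simp add: one_ereal_def[symmetric])
  next
    fix v e' assume v: "v \<in> verts ?G" and e': "e' \<in> edges ?H" and ev: "\<phi> v \<in> {src ?H e', tgt ?H e'}"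
    have e'': "e' \<in> edges ?G" using e' by simp
    have "v \<in> points \<Gamma>" using v G.verts_subset pts by auto
    then have "v \<in> {src ?G e', tgt ?G e'}" using ev inj_on_eq_iff[OF inj] ends[OF e''] by simp
    then have on: "v \<in> edge_set ?G e'" using G.ends_in_edge_set[OF e''] by auto
    have "e = e'" if "e \<in> edges ?G" "\<phi> ` edge_set ?G e = edge_set ?H e'" for e
    proof (rule G.edge_set_inj[OF that(1) e''])
      have "edge_set ?G e \<subseteq> points \<Gamma>" "edge_set ?G e' \<subseteq> points \<Gamma>"
        using G.edge_set_subset that(1) e'' pts by auto
      then show "edge_set ?G e = edge_set ?G e'"
        using inj_on_image_eq_iff[OF inj] that(2) by simp
    qed
    then have "{e \<in> edges ?G. \<phi> ` edge_set ?G e = edge_set ?H e' \<and> v \<in> edge_set ?G e} = {e'}"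
      using e'' on by auto
    then show "(\<Sum>e | e \<in> edges ?G \<and> \<phi> ` edge_set ?G e = edge_set ?H e' \<and> v \<in> edge_set ?G e. 1) = 1" by simp
  qed auto
  have deg: "\<forall>v'\<in>verts ?H. (\<Sum>v | v \<in> verts ?G \<and> \<phi> v = v'. 1) = 1"
  proof
    fix v' assume "v' \<in> verts ?H"
    then obtain v where v: "v \<in> verts ?G" "v' = \<phi> v" by auto
    have "{w \<in> verts ?G. \<phi> w = v'} = {v}"
      using v inj_on_eq_iff[OF inj] G.verts_subset pts by auto
    then show "(\<Sum>v | v \<in> verts ?G \<and> \<phi> v = v'. 1) = 1" by simp
  qed
  have cont: "continuous_map (curve_top \<Gamma>) (curve_top \<Gamma>) \<phi>"
    using \<phi> homeomorphic_imp_continuous_map by (auto simp: isometry_def)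
  have "\<exists>G G' k m. model_for \<Gamma> G \<and> loopless G \<and> model_for \<Gamma> G' \<and> loopless G' \<and>
      harmonic_on_models G G' \<phi> k m \<and> (\<forall>v'\<in>verts G'. (\<Sum>v | v \<in> verts G \<and> \<phi> v = v'. m v) = 1)"
    using G loopless_subdivision H ll harm deg by (intro exI conjI)
  then show ?thesis
    unfolding finite_harmonic_def using cont by simp
qed

section \<open>The isomorphism\<close>

lemma curve_aut_carrier: "carrier (curve_aut \<Gamma>) = {\<phi> \<in> extensional (points \<Gamma>). isometry \<phi>}"
  using finite_harmonic_imp_isometry isometry_imp_finite_harmonic by (auto simp: curve_aut_def)

lemma curve_aut_mult: "\<phi> \<otimes>\<^bsub>curve_aut \<Gamma>\<^esub> \<phi>' = compose (points \<Gamma>) \<phi> \<phi>'"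
  and curve_aut_one: "\<one>\<^bsub>curve_aut \<Gamma>\<^esub> = (\<lambda>x\<in>points \<Gamma>. x)"
  by (simp_all add: curve_aut_def)

lemma isometry_cong:
  assumes "isometry \<phi>" "\<And>x. x \<in> points \<Gamma> \<Longrightarrow> \<phi> x = \<phi>' x"
  shows "isometry \<phi>'"
  using assms homeomorphic_map_eq[of "curve_top \<Gamma>" "curve_top \<Gamma>" \<phi> \<phi>']
  by (auto simp: isometry_def topspace_curve_top)

lemma isometry_points: "isometry \<phi> \<Longrightarrow> x \<in> points \<Gamma> \<Longrightarrow> \<phi> x \<in> points \<Gamma>"
  using isometry_bij bij_betwE by blast

lemma isometry_comp:
  assumes "isometry \<phi>" "isometry \<phi>'" shows "isometry (\<phi> \<circ> \<phi>')"
  using assms isometry_points homeomorphic_map_compose[of "curve_top \<Gamma>" "curve_top \<Gamma>" \<phi>' "curve_top \<Gamma>" \<phi>]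
  by (auto simp: isometry_def)

lemma isometry_inverse:
  assumes "isometry \<phi>"
  shows "\<exists>\<theta>. isometry \<theta> \<and> (\<forall>x\<in>points \<Gamma>. \<theta> (\<phi> x) = x)"
proof -
  have "homeomorphic_map (curve_top \<Gamma>) (curve_top \<Gamma>) \<phi>" using assms by (simp add: isometry_def)
  then obtain \<theta> where "homeomorphic_maps (curve_top \<Gamma>) (curve_top \<Gamma>) \<phi> \<theta>"
    unfolding homeomorphic_map_maps by (elim exE)
  then have \<theta>: "homeomorphic_map (curve_top \<Gamma>) (curve_top \<Gamma>) \<theta>"
    and left: "\<forall>x\<in>points \<Gamma>. \<theta> (\<phi> x) = x" and right: "\<forall>x\<in>points \<Gamma>. \<phi> (\<theta> x) = x"
    unfolding homeomorphic_maps_map topspace_curve_top by simp_all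
  have maps: "\<theta> x \<in> points \<Gamma>" if "x \<in> points \<Gamma>" for x
    using imageI[OF that, of \<theta>] homeomorphic_imp_surjective_map[OF \<theta>] by (simp add: topspace_curve_top)
  have "cdist \<Gamma> (\<theta> x) (\<theta> y) = cdist \<Gamma> x y" if "x \<in> points \<Gamma>" "y \<in> points \<Gamma>" for x y
  proof -
    have "cdist \<Gamma> (\<phi> (\<theta> x)) (\<phi> (\<theta> y)) = cdist \<Gamma> (\<theta> x) (\<theta> y)"
      using assms maps that by (simp add: isometry_def)
    then show ?thesis using right that by simp
  qed
  then have "isometry \<theta>" using \<theta> by (simp add: isometry_def)
  then show ?thesis using left by blast
qed

lemma group_curve_aut: "group (curve_aut \<Gamma>)"
proof (rule groupI; unfold curve_aut_mult curve_aut_one)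
  have id: "isometry (\<lambda>x\<in>points \<Gamma>. x)"
    by (rule isometry_cong[of id]) (auto simp: isometry_def)
  then show "(\<lambda>x\<in>points \<Gamma>. x) \<in> carrier (curve_aut \<Gamma>)" by (simp add: curve_aut_carrier)
next
  fix \<phi> \<phi>' assume "\<phi> \<in> carrier (curve_aut \<Gamma>)" "\<phi>' \<in> carrier (curve_aut \<Gamma>)"
  then have "isometry (\<phi> \<circ> \<phi>')" by (auto simp: curve_aut_carrier intro: isometry_comp)
  then have "isometry (compose (points \<Gamma>) \<phi> \<phi>')" by (rule isometry_cong) (simp add: compose_eq)
  then show "compose (points \<Gamma>) \<phi> \<phi>' \<in> carrier (curve_aut \<Gamma>)" by (simp add: curve_aut_carrier compose_extensional)
next
  fix \<phi> assume \<phi>: "\<phi> \<in> carrier (curve_aut \<Gamma>)"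
  then have iso: "isometry \<phi>" by (simp add: curve_aut_carrier)
  have "\<phi> \<in> points \<Gamma> \<rightarrow> points \<Gamma>" using isometry_points[OF iso] by auto
  then show "compose (points \<Gamma>) (\<lambda>x\<in>points \<Gamma>. x) \<phi> = \<phi>"
    using \<phi> by (intro Id_compose) (auto simp: curve_aut_carrier)
  obtain \<theta> where \<theta>: "isometry \<theta>" "\<forall>x\<in>points \<Gamma>. \<theta> (\<phi> x) = x" using isometry_inverse[OF iso] by blast
  have "restrict \<theta> (points \<Gamma>) \<in> carrier (curve_aut \<Gamma>)"
    using isometry_cong[OF \<theta>(1), of "restrict \<theta> (points \<Gamma>)"] by (simp add: curve_aut_carrier)
  moreover have "compose (points \<Gamma>) (restrict \<theta> (points \<Gamma>)) \<phi> = (\<lambda>x\<in>points \<Gamma>. x)"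
    using \<theta>(2) isometry_points[OF iso] by (auto simp: compose_def fun_eq_iff restrict_def)
  ultimately show "\<exists>y\<in>carrier (curve_aut \<Gamma>). compose (points \<Gamma>) y \<phi> = (\<lambda>x\<in>points \<Gamma>. x)" by blast
next
  fix x y z assume "x \<in> carrier (curve_aut \<Gamma>)" "y \<in> carrier (curve_aut \<Gamma>)" "z \<in> carrier (curve_aut \<Gamma>)"
  then have "z \<in> points \<Gamma> \<rightarrow> points \<Gamma>" using isometry_points by (auto simp: curve_aut_carrier)
  then show "compose (points \<Gamma>) (compose (points \<Gamma>) x y) z = compose (points \<Gamma>) x (compose (points \<Gamma>) y z)"
    by (rule compose_assoc[symmetric])
qed

text \<open>
  This reverses the order of composition, so it has to be combined with inversion.
\<close>

definition pullback :: "('p \<Rightarrow> 'p) \<Rightarrow> ('p \<Rightarrow> ereal) \<Rightarrow> 'p \<Rightarrow> ereal" where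
  "pullback \<phi> = (\<lambda>f\<in>carrier (Rat \<Gamma>). \<lambda>x\<in>points \<Gamma>. f (\<phi> x))"

lemma pullback_carrier:
  assumes \<phi>: "isometry \<phi>" and f: "f \<in> carrier (Rat \<Gamma>)"
  shows "pullback \<phi> f \<in> carrier (Rat \<Gamma>)"
proof (cases "f = zero_fun")
  case True
  then have "pullback \<phi> f = zero_fun"
    using f isometry_points[OF \<phi>] by (auto simp: pullback_def const_fun_def fun_eq_iff)
  then show ?thesis by (simp add: carrier_Rat)
next
  case False
  then have "integral_pl f" using f by (simp add: carrier_Rat pl_functions_def)
  then have "restrict (f \<circ> \<phi>) (points \<Gamma>) \<in> pl_functions" by (intro restrict_pl integral_pl_isometry \<phi>)
  then show ?thesis using f by (simp add: pullback_def carrier_Rat comp_def)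
qed

lemma pullback_compose:
  assumes \<phi>: "isometry \<phi>" and \<phi>': "isometry \<phi>'"
  shows "pullback (compose (points \<Gamma>) \<phi> \<phi>') = compose (carrier (Rat \<Gamma>)) (pullback \<phi>') (pullback \<phi>)"
proof
  fix f
  show "pullback (compose (points \<Gamma>) \<phi> \<phi>') f = compose (carrier (Rat \<Gamma>)) (pullback \<phi>') (pullback \<phi>) f"
  proof (cases "f \<in> carrier (Rat \<Gamma>)")
    case True
    then show ?thesis
      using pullback_carrier[OF \<phi> True] isometry_points[OF \<phi>']
      by (auto simp: compose_def pullback_def fun_eq_iff restrict_def)
  qed (simp add: compose_def pullback_def)
qed

lemma pullback_id: "f \<in> carrier (Rat \<Gamma>) \<Longrightarrow> pullback (\<lambda>x\<in>points \<Gamma>. x) f = f"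
  using carrier_extensional[of f] by (auto simp: pullback_def fun_eq_iff restrict_def extensional_def)

lemma pullback_rat_aut:
  assumes \<phi>: "\<phi> \<in> carrier (curve_aut \<Gamma>)"
  shows "pullback \<phi> \<in> carrier (rat_aut \<Gamma>)"
  unfolding rat_aut_iff
proof (intro conjI ballI allI impI)
  interpret G: group "curve_aut \<Gamma>" by (rule group_curve_aut)
  let ?\<phi>' = "inv\<^bsub>curve_aut \<Gamma>\<^esub> \<phi>"
  have \<phi>': "?\<phi>' \<in> carrier (curve_aut \<Gamma>)" using \<phi> by simp
  have iso: "isometry \<phi>" "isometry ?\<phi>'" using \<phi> \<phi>' by (auto simp: curve_aut_carrier)
  have "pullback ?\<phi>' (pullback \<phi> f) = f" "pullback \<phi> (pullback ?\<phi>' f) = f" if f: "f \<in> carrier (Rat \<Gamma>)" for f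
    using pullback_compose[OF iso] pullback_compose[OF iso(2,1)] G.l_inv[OF \<phi>] G.r_inv[OF \<phi>] pullback_id[OF f] f
    by (metis compose_eq curve_aut_mult curve_aut_one)+
  then show "bij_betw (pullback \<phi>) (carrier (Rat \<Gamma>)) (carrier (Rat \<Gamma>))"
    using pullback_carrier iso by (intro bij_betw_byWitness[of _ "pullback ?\<phi>'"]) auto
  show "pullback \<phi> \<in> extensional (carrier (Rat \<Gamma>))" by (simp add: pullback_def)
  fix f g assume f: "f \<in> carrier (Rat \<Gamma>)" and g: "g \<in> carrier (Rat \<Gamma>)"
  have val: "pullback \<phi> h x = h (\<phi> x)" if "h \<in> carrier (Rat \<Gamma>)" "x \<in> points \<Gamma>" for h x
    using that by (simp add: pullback_def)
  have "pullback \<phi> f \<otimes>\<^bsub>Rat \<Gamma>\<^esub> pullback \<phi> g = pullback \<phi> (f \<otimes>\<^bsub>Rat \<Gamma>\<^esub> g)"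
  proof (rule Rat_mult_eqI)
    show "pullback \<phi> (f \<otimes>\<^bsub>Rat \<Gamma>\<^esub> g) \<in> carrier (Rat \<Gamma>)" by (intro pullback_carrier iso Rat_mult(1) f g)
    fix x assume x: "x \<in> fin_points \<Gamma>"
    then have "\<phi> x \<in> fin_points \<Gamma>" "x \<in> points \<Gamma>" using isometry_fin_points[OF iso(1)] fin_points_subset by auto
    then show "pullback \<phi> (f \<otimes>\<^bsub>Rat \<Gamma>\<^esub> g) x = pullback \<phi> f x + pullback \<phi> g x"
      using Rat_mult[OF f g] by (simp add: val f g)
  qed
  then show "pullback \<phi> (f \<otimes>\<^bsub>Rat \<Gamma>\<^esub> g) = pullback \<phi> f \<otimes>\<^bsub>Rat \<Gamma>\<^esub> pullback \<phi> g" by simp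
  show "pullback \<phi> (f \<oplus>\<^bsub>Rat \<Gamma>\<^esub> g) = pullback \<phi> f \<oplus>\<^bsub>Rat \<Gamma>\<^esub> pullback \<phi> g"
    unfolding Rat_add[OF pullback_carrier[OF iso(1) f] pullback_carrier[OF iso(1) g]]
    using Rat_add_closed[OF f g] isometry_points[OF iso(1)] f g
    by (auto simp: pullback_def Rat_add[OF f g] fun_eq_iff restrict_def)
next
  fix t :: ereal assume "t \<noteq> \<infinity>"
  then show "pullback \<phi> (const_fun \<Gamma> t) = const_fun \<Gamma> t"
    using const_fun_carrier[of t] \<phi> isometry_points
    by (auto simp: pullback_def const_fun_def fun_eq_iff restrict_def curve_aut_carrier)
qed

lemma pullback_inj:
  assumes \<phi>: "\<phi> \<in> carrier (curve_aut \<Gamma>)" and \<phi>': "\<phi>' \<in> carrier (curve_aut \<Gamma>)" and eq: "pullback \<phi> = pullback \<phi>'"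
  shows "\<phi> = \<phi>'"
proof (rule extensionalityI[of _ "points \<Gamma>"])
  fix x assume x: "x \<in> points \<Gamma>"
  show "\<phi> x = \<phi>' x"
  proof (rule ccontr)
    assume ne: "\<phi> x \<noteq> \<phi>' x"
    have p: "\<phi> x \<in> points \<Gamma>" "\<phi>' x \<in> points \<Gamma>" using \<phi> \<phi>' x isometry_points by (auto simp: curve_aut_carrier)
    obtain f where f: "integral_pl f" "f (\<phi>' x) < f (\<phi> x)" using integral_pl_separates[OF p ne] by blast
    have "restrict f (points \<Gamma>) \<in> carrier (Rat \<Gamma>)" using restrict_pl[OF f(1)] by (simp add: carrier_Rat)
    then have "f (\<phi> x) = f (\<phi>' x)"
      using fun_cong[OF fun_cong[OF eq, of "restrict f (points \<Gamma>)"], of x] x p by (simp add: pullback_def)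
    then show False using f(2) by simp
  qed
qed (use \<phi> \<phi>' in \<open>auto simp: curve_aut_carrier\<close>)

lemma pullback_surj:
  assumes \<psi>: "\<psi> \<in> carrier (rat_aut \<Gamma>)"
  shows "\<exists>\<phi>\<in>carrier (curve_aut \<Gamma>). pullback \<phi> = \<psi>"
proof -
  obtain \<theta> where \<theta>: "isometry \<theta>" "pulls_back \<psi> \<theta>" by (rule aut_induced_by_isometry[OF \<psi>])
  have "pullback (restrict \<theta> (points \<Gamma>)) = \<psi>"
  proof (rule extensionalityI[of _ "carrier (Rat \<Gamma>)"])
    fix f assume f: "f \<in> carrier (Rat \<Gamma>)"
    show "pullback (restrict \<theta> (points \<Gamma>)) f = \<psi> f"
      using \<theta>(2) f carrier_extensional[OF aut_closed[OF \<psi> f]]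
      by (auto simp: pullback_def pulls_back_def fun_eq_iff restrict_def extensional_def)
  qed (use \<psi> in \<open>auto simp: rat_aut_iff pullback_def\<close>)
  moreover have "restrict \<theta> (points \<Gamma>) \<in> carrier (curve_aut \<Gamma>)"
    using isometry_cong[OF \<theta>(1), of "restrict \<theta> (points \<Gamma>)"] by (simp add: curve_aut_carrier)
  ultimately show ?thesis by blast
qed

lemma curve_aut_iso_rat_aut: "curve_aut \<Gamma> \<cong> rat_aut \<Gamma>"
proof -
  interpret G: group "curve_aut \<Gamma>" by (rule group_curve_aut)
  let ?F = "\<lambda>\<phi>. pullback (inv\<^bsub>curve_aut \<Gamma>\<^esub> \<phi>)"
  have "?F \<in> hom (curve_aut \<Gamma>) (rat_aut \<Gamma>)"
  proof (rule homI)
    fix \<phi> \<phi>' assume \<phi>: "\<phi> \<in> carrier (curve_aut \<Gamma>)" and \<phi>': "\<phi>' \<in> carrier (curve_aut \<Gamma>)"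
    have iso: "isometry (inv\<^bsub>curve_aut \<Gamma>\<^esub> \<phi>)" "isometry (inv\<^bsub>curve_aut \<Gamma>\<^esub> \<phi>')"
      using G.inv_closed[OF \<phi>] G.inv_closed[OF \<phi>'] by (auto simp: curve_aut_carrier)
    have "?F (\<phi> \<otimes>\<^bsub>curve_aut \<Gamma>\<^esub> \<phi>') =
        pullback (compose (points \<Gamma>) (inv\<^bsub>curve_aut \<Gamma>\<^esub> \<phi>') (inv\<^bsub>curve_aut \<Gamma>\<^esub> \<phi>))"
      using G.inv_mult_group[OF \<phi> \<phi>'] by (simp add: curve_aut_mult)
    also have "\<dots> = compose (carrier (Rat \<Gamma>)) (?F \<phi>) (?F \<phi>')"
      by (rule pullback_compose[OF iso(2,1)])
    finally show "?F (\<phi> \<otimes>\<^bsub>curve_aut \<Gamma>\<^esub> \<phi>') = ?F \<phi> \<otimes>\<^bsub>rat_aut \<Gamma>\<^esub> ?F \<phi>'"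
      by (simp add: rat_aut_def alg_aut_def)
  qed (simp add: pullback_rat_aut)
  moreover have "bij_betw ?F (carrier (curve_aut \<Gamma>)) (carrier (rat_aut \<Gamma>))"
  proof (rule bij_betw_imageI[OF inj_onI subset_antisym[OF subsetI subsetI]])
    fix \<phi> \<phi>' assume "\<phi> \<in> carrier (curve_aut \<Gamma>)" "\<phi>' \<in> carrier (curve_aut \<Gamma>)" "?F \<phi> = ?F \<phi>'"
    then show "\<phi> = \<phi>'" using pullback_inj G.inv_closed by (metis G.inv_inv)
  next
    fix \<psi> assume "\<psi> \<in> carrier (rat_aut \<Gamma>)"
    then obtain \<phi> where \<phi>: "\<phi> \<in> carrier (curve_aut \<Gamma>)" "pullback \<phi> = \<psi>" using pullback_surj by blast
    then have "?F (inv\<^bsub>curve_aut \<Gamma>\<^esub> \<phi>) = \<psi>" by simp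
    then show "\<psi> \<in> ?F ` carrier (curve_aut \<Gamma>)" using G.inv_closed[OF \<phi>(1)] by blast
  qed (auto intro: pullback_rat_aut)
  ultimately show ?thesis unfolding is_iso_def iso_def by blast
qed

end

theorem corollary1p3:
  fixes \<Gamma> :: "('p, 'e) curve"
  assumes "tropical_curve \<Gamma>"
  shows "group (curve_aut \<Gamma>) \<and> group (rat_aut \<Gamma>) \<and> curve_aut \<Gamma> \<cong> rat_aut \<Gamma>"
proof -
  interpret tropical \<Gamma> by unfold_locales (rule assms)
  show ?thesis using group_curve_aut group_rat_aut curve_aut_iso_rat_aut by blast
qed

end
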